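(* Let $\ell\in\mathbb N$. 1) The surfaces $S_{\ell,+}^o$ and $S_{\ell,-}^o$ are smooth and disjoint, and they are disjoint from the $s$-axis, i.e. from the line $\{\chi=a=0\}$. 2) Each surface $S_{\ell,\pm}^o$ is fibered over the $s$-axis punctured at the origin (via $(\chi,a,s)\mapsto s$) by smooth rational curves of degree $2\ell+1$ conformally parametrized by Riemann spheres punctured in at most $2\ell+1$ points; the projective closures of these curves in $\mathbb{CP}^3\supset\mathbb C^3_{\chi,a,s}$ are parametrized by $\overline{\mathbb C}$. 3) Each surface $S_{\ell,\pm}^o$ is biholomorphically parametrized by the complement of the product $\mathbb C^*_s\times\overline{\mathbb C}$ to an analytic hypersurface (curve), so that the parametrization preserves the coordinate $s$: it sends (the part in the complement of) each $s$-fiber $\{s\}\times\overline{\mathbb C}$ to the $s$-fiber of the surface $S_{\ell,\pm}^o$.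
   Context: $\mathbb N=\{1,2,3,\dots\}$, $\overline{\mathbb C}=\mathbb C\cup\{\infty\}$ is the Riemann sphere, $\mathbb C^*=\mathbb C\setminus\{0\}$. $G_{1,\ell}$ and $G_{2,\ell}$ are the $(\ell+1)\times(\ell+1)$-matrices depending on $(\chi,a,s)\in\mathbb C^3$ with the following entries: for $1\le j\le \ell$: $(G_{1,\ell})_{j,j}=\frac s2$, $(G_{1,\ell})_{j,j+1}=\chi a-j$, $(G_{2,\ell})_{j,\ell+1-j}=\frac a2$, $(G_{2,\ell})_{j,\ell+2-j}=\chi s$; $(G_{1,\ell})_{\ell+1,\ell+1}=\frac12$, $(G_{2,\ell})_{\ell+1,1}=\chi$; all other entries are zero. Set $\mathcal P_{\ell,\pm}(\chi,a,s)=\det(G_{1,\ell}\pm G_{2,\ell})$, $S_{\ell,\pm}=\{\mathcal P_{\ell,\pm}=0\}\subset\mathbb C^3_{\chi,a,s}$ and $S_{\ell,\pm}^o=S_{\ell,\pm}\setminus\{s=0\}$. *)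

theory Defs
  imports "HOL-Complex_Analysis.Complex_Analysis" "Jordan_Normal_Form.Determinant"
begin

section \<open>Complex differentiability on finite products of \<open>\<complex>\<close>\<close>

text \<open>
  \<open>\<complex>\<^sup>n\<close> is the product type \<open>complex \<times> \<dots> \<times> complex\<close>, which the library
  treats as a real normed space only; the class below adds multiplication by complex scalars.
\<close>

class complex_space = real_normed_vector +
  fixes scaleC :: "complex \<Rightarrow> 'a \<Rightarrow> 'a"
  assumes scaleC_add_right: "scaleC c (x + y) = scaleC c x + scaleC c y"
    and scaleC_add_left: "scaleC (c + d) x = scaleC c x + scaleC d x"
    and scaleC_scaleC: "scaleC c (scaleC d x) = scaleC (c * d) x"
    and scaleC_of_real: "scaleC (of_real r) x = r *\<^sub>R x"

lemma scaleC_one: "scaleC 1 x = (x :: 'a::complex_space)"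
  using scaleC_of_real[of 1 x] by simp

lemma scaleC_zero_right: "scaleC c 0 = (0 :: 'a::complex_space)"
  using scaleC_add_right[of c 0 "0 :: 'a"] by simp

instantiation complex :: complex_space
begin
definition scaleC_complex :: "complex \<Rightarrow> complex \<Rightarrow> complex" where
  "scaleC_complex c x = c * x"
instance
  by standard (auto simp: scaleC_complex_def algebra_simps scaleR_conv_of_real)
end

instantiation prod :: (complex_space, complex_space) complex_space
begin
definition scaleC_prod :: "complex \<Rightarrow> 'a \<times> 'b \<Rightarrow> 'a \<times> 'b" where
  "scaleC_prod c x = (scaleC c (fst x), scaleC c (snd x))"
instance
  by standard (auto simp: scaleC_prod_def scaleC_add_right scaleC_add_left scaleC_scaleC
      scaleC_of_real scaleR_prod_def)
end

definition has_complex_derivative ::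
    "('a::complex_space \<Rightarrow> 'b::complex_space) \<Rightarrow> ('a \<Rightarrow> 'b) \<Rightarrow> 'a \<Rightarrow> bool" where
  "has_complex_derivative f f' x \<longleftrightarrow>
     (f has_derivative f') (at x) \<and> (\<forall>c v. f' (scaleC c v) = scaleC c (f' v))"

text \<open>Used for open \<open>V\<close> only.\<close>

definition holo_on :: "('a::complex_space \<Rightarrow> 'b::complex_space) \<Rightarrow> 'a set \<Rightarrow> bool" where
  "holo_on f V \<longleftrightarrow> (\<forall>x\<in>V. \<exists>f'. has_complex_derivative f f' x)"

lemma holo_on_iff_holomorphic_on:
  fixes f :: "complex \<Rightarrow> complex"
  assumes "open V"
  shows "holo_on f V \<longleftrightarrow> f holomorphic_on V"
proof -
  have "(\<exists>f'. has_complex_derivative f f' x) \<longleftrightarrow> f field_differentiable at x" for x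
  proof
    assume "\<exists>f'. has_complex_derivative f f' x"
    then obtain f' where d: "(f has_derivative f') (at x)" and l: "\<And>c v. f' (c * v) = c * f' v"
      by (auto simp: has_complex_derivative_def scaleC_complex_def)
    have "f' v = f' 1 * v" for v
      using l[of v 1] by (simp add: mult.commute)
    then have "f' = (*) (f' 1)" by (rule ext)
    then show "f field_differentiable at x"
      using d unfolding field_differentiable_def has_field_derivative_def by metis
  next
    assume "f field_differentiable at x"
    then obtain d where "(f has_derivative (*) d) (at x)"
      unfolding field_differentiable_def has_field_derivative_def by blast
    then have "has_complex_derivative f ((*) d) x"
      by (simp add: has_complex_derivative_def scaleC_complex_def)
    then show "\<exists>f'. has_complex_derivative f f' x" by blast
  qed
  then show ?thesis
    using assms by (auto simp: holo_on_def holomorphic_on_open field_differentiable_def)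
qed


section \<open>Holomorphic maps between complex manifolds\<close>

text \<open>
  The complex structure on a manifold \<open>'a\<close> is given by a set of injective parametrizations
  \<open>'c \<Rightarrow> 'a\<close> (inverse charts) whose images cover \<open>'a\<close>; every manifold below is
  covered by parametrizations defined on a whole affine space \<open>'c\<close>.

  A map is holomorphic on a subset \<open>U\<close> if near each point of \<open>U\<close> it agrees on \<open>U\<close>
  with an ambient holomorphic map. This is the usual notion when \<open>U\<close> is open, and
  also when \<open>U\<close> is a complex submanifold.
\<close>

definition holomorphic_map ::
    "('c::complex_space \<Rightarrow> 'a) set \<Rightarrow> ('d::complex_space \<Rightarrow> 'b) set \<Rightarrow> 'a set \<Rightarrow> ('a \<Rightarrow> 'b) \<Rightarrow> bool" where
  "holomorphic_map A B U f \<longleftrightarrow>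
     (\<forall>\<phi>\<in>A. \<forall>u. \<phi> u \<in> U \<longrightarrow>
        (\<exists>\<psi>\<in>B. \<exists>V h. open V \<and> u \<in> V \<and> holo_on h V \<and>
           (\<forall>v\<in>V. \<phi> v \<in> U \<longrightarrow> f (\<phi> v) = \<psi> (h v))))"

definition biholomorphic_map ::
    "('c::complex_space \<Rightarrow> 'a) set \<Rightarrow> ('d::complex_space \<Rightarrow> 'b) set \<Rightarrow> 'a set \<Rightarrow> 'b set \<Rightarrow> ('a \<Rightarrow> 'b) \<Rightarrow> bool" where
  "biholomorphic_map A B U W f \<longleftrightarrow>
     bij_betw f U W \<and> holomorphic_map A B U f \<and> holomorphic_map B A W (the_inv_into U f)"

text \<open>
  Analytic hypersurfaces of an open subset \<open>M\<close>. The local equation is required at every point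
  of \<open>M\<close>, not only on \<open>\<Sigma>\<close>, so \<open>\<Sigma>\<close> is closed in \<open>M\<close>.
\<close>

definition analytic_hypersurface ::
    "('c::complex_space \<Rightarrow> 'a) set \<Rightarrow> 'a set \<Rightarrow> 'a set \<Rightarrow> bool" where
  "analytic_hypersurface A M \<Sigma> \<longleftrightarrow>
     \<Sigma> \<subseteq> M \<and>
     (\<forall>\<phi>\<in>A. \<forall>u. \<phi> u \<in> M \<longrightarrow>
        (\<exists>V (F :: 'c \<Rightarrow> complex). open V \<and> connected V \<and> u \<in> V \<and> \<phi> ` V \<subseteq> M \<and>
           holo_on F V \<and> (\<exists>v\<in>V. F v \<noteq> 0) \<and> (\<forall>v\<in>V. \<phi> v \<in> \<Sigma> \<longleftrightarrow> F v = 0)))"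

text \<open>
  Smooth complex submanifolds of an affine space, of codimension the complex dimension of
  \<open>'b\<close>: near each point, the zero set of a holomorphic submersion to \<open>'b\<close>.
\<close>

definition complex_submanifold ::
    "'b::complex_space itself \<Rightarrow> 'a::complex_space set \<Rightarrow> bool" where
  "complex_submanifold _ X \<longleftrightarrow>
     (\<forall>p\<in>X. \<exists>V (F :: 'a \<Rightarrow> 'b) F'. open V \<and> p \<in> V \<and> holo_on F V \<and>
        has_complex_derivative F F' p \<and> surj F' \<and> X \<inter> V = {x \<in> V. F x = 0})"

definition tangent_space :: "'a::complex_space set \<Rightarrow> 'a \<Rightarrow> 'a set" where
  "tangent_space X p =
     {v. \<exists>r>0. \<exists>\<gamma> :: complex \<Rightarrow> 'a. holo_on \<gamma> (ball 0 r) \<and> \<gamma> ` ball 0 r \<subseteq> X \<and> \<gamma> 0 = p \<and>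
           has_complex_derivative \<gamma> (\<lambda>t. scaleC t v) 0}"

text \<open>Surjective onto \<open>B\<close> and submersive along \<open>X\<close>.\<close>

definition holomorphic_fibration ::
    "'a::complex_space set \<Rightarrow> complex set \<Rightarrow> ('a \<Rightarrow> complex) \<Rightarrow> bool" where
  "holomorphic_fibration X B \<pi> \<longleftrightarrow>
     \<pi> ` X = B \<and>
     (\<forall>p\<in>X. \<exists>\<pi>'. has_complex_derivative \<pi> \<pi>' p \<and> \<pi>' ` tangent_space X p = UNIV)"


section \<open>The Riemann sphere and \<open>\<complex>\<P>\<^sup>3\<close>\<close>

datatype sphere = Finite complex | Infty

definition sphere_charts :: "(complex \<Rightarrow> sphere) set" where
  "sphere_charts = {Finite, \<lambda>w. if w = 0 then Infty else Finite (1 / w)}"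

definition plane_sphere_charts :: "(complex \<times> complex \<Rightarrow> complex \<times> sphere) set" where
  "plane_sphere_charts = map_prod id ` sphere_charts"

type_synonym c3 = "complex \<times> complex \<times> complex"
type_synonym c4 = "complex \<times> complex \<times> complex \<times> complex"

definition c3_charts :: "(c3 \<Rightarrow> c3) set" where
  "c3_charts = {id}"

definition proportional :: "c4 \<Rightarrow> c4 \<Rightarrow> bool" where
  "proportional u v \<longleftrightarrow> u \<noteq> 0 \<and> (\<exists>c. c \<noteq> 0 \<and> v = scaleC c u)"

lemma part_equivp_proportional: "part_equivp proportional"
proof (rule part_equivpI)
  show "\<exists>x. proportional x x"
    unfolding proportional_def
    by (intro exI[of _ "(1, 1, 1, 1)"] conjI exI[of _ 1]) (simp_all add: zero_prod_def scaleC_one)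
  show "symp proportional"
  proof (rule sympI)
    fix x y assume "proportional x y"
    then obtain c where c: "x \<noteq> 0" "c \<noteq> 0" "y = scaleC c x"
      by (auto simp: proportional_def)
    then have x: "x = scaleC (1 / c) y"
      by (simp add: scaleC_scaleC scaleC_one)
    then have "y \<noteq> 0"
      using c(1) by (metis scaleC_zero_right)
    with x c(2) show "proportional y x"
      unfolding proportional_def by (intro conjI exI[of _ "1 / c"]) simp_all
  qed
  show "transp proportional"
  proof (rule transpI)
    fix x y z assume "proportional x y" "proportional y z"
    then obtain c d where "x \<noteq> 0" "c \<noteq> 0" "y = scaleC c x" "d \<noteq> 0" "z = scaleC d y"
      by (auto simp: proportional_def)
    then show "proportional x z"
      unfolding proportional_def by (intro conjI exI[of _ "d * c"]) (simp_all add: scaleC_scaleC)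
  qed
qed

text \<open>\<open>abs_cp3 v\<close> is the point with homogeneous coordinates \<open>v\<close>; it is meaningful for \<open>v \<noteq> 0\<close> only.\<close>

quotient_type cp3 = c4 / partial: proportional
  by (rule part_equivp_proportional)

instantiation cp3 :: topological_space
begin
definition open_cp3 :: "cp3 set \<Rightarrow> bool" where
  "open_cp3 U \<longleftrightarrow> open {v. v \<noteq> 0 \<and> abs_cp3 v \<in> U}"
instance
proof
  have "{v. v \<noteq> 0 \<and> abs_cp3 v \<in> UNIV} = - {0}" by auto
  then show "open (UNIV :: cp3 set)"
    by (simp add: open_cp3_def open_Compl)
  fix S T :: "cp3 set"
  assume "open S" "open T"
  moreover have "{v. v \<noteq> 0 \<and> abs_cp3 v \<in> S \<inter> T} =
      {v. v \<noteq> 0 \<and> abs_cp3 v \<in> S} \<inter> {v. v \<noteq> 0 \<and> abs_cp3 v \<in> T}" by auto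
  ultimately show "open (S \<inter> T)"
    by (simp only: open_cp3_def open_Int)
next
  fix K :: "cp3 set set"
  assume "\<forall>S\<in>K. open S"
  moreover have "{v. v \<noteq> 0 \<and> abs_cp3 v \<in> \<Union>K} = (\<Union>S\<in>K. {v. v \<noteq> 0 \<and> abs_cp3 v \<in> S})" by auto
  ultimately show "open (\<Union>K)"
    by (simp only: open_cp3_def) (rule open_UN)
qed
end

definition cp3_charts :: "(c3 \<Rightarrow> cp3) set" where
  "cp3_charts =
     {\<lambda>(x, y, z). abs_cp3 (1, x, y, z), \<lambda>(x, y, z). abs_cp3 (x, 1, y, z),
      \<lambda>(x, y, z). abs_cp3 (x, y, 1, z), \<lambda>(x, y, z). abs_cp3 (x, y, z, 1)}"

definition affine_part :: "c3 \<Rightarrow> cp3" where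
  "affine_part = (\<lambda>(x, y, z). abs_cp3 (x, y, z, 1))"

text \<open>The closure in \<open>\<complex>\<P>\<^sup>3\<close>, which for an algebraic set is also its Zariski closure.\<close>

definition projective_closure :: "c3 set \<Rightarrow> cp3 set" where
  "projective_closure X = closure (affine_part ` X)"

definition hyperplane :: "c4 \<Rightarrow> cp3 set" where
  "hyperplane = (\<lambda>(h1, h2, h3, h4).
     {abs_cp3 (x, y, z, w) | x y z w.
        (x, y, z, w) \<noteq> 0 \<and> h1 * x + h2 * y + h3 * z + h4 * w = 0})"

text \<open>
  Degree of an algebraic curve: the number of points in which its projective closure meets a
  generic hyperplane. Generic means from some dense open set; any two of these meet, so
  the degree is unique.
\<close>

definition has_degree :: "c3 set \<Rightarrow> nat \<Rightarrow> bool" where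
  "has_degree C d \<longleftrightarrow>
     (\<exists>H. open H \<and> closure H = UNIV \<and>
        (\<forall>h\<in>H. finite (projective_closure C \<inter> hyperplane h) \<and>
               card (projective_closure C \<inter> hyperplane h) = d))"

text \<open>
  Rational curves: there is a rational map \<open>t \<mapsto> (p1/p0, p2/p0, p3/p0)\<close>
  to \<open>C\<close> which is injective off a finite set and misses only finitely many points of \<open>C\<close>.
\<close>

definition rational_curve :: "c3 set \<Rightarrow> bool" where
  "rational_curve C \<longleftrightarrow>
     (\<exists>(p0 :: complex poly) p1 p2 p3 E.
        let f = (\<lambda>t. (poly p1 t / poly p0 t, poly p2 t / poly p0 t, poly p3 t / poly p0 t)) in
        finite E \<and> (\<forall>t. poly p0 t = 0 \<longrightarrow> t \<in> E) \<and>
        inj_on f (- E) \<and> f ` (- E) \<subseteq> C \<and> finite (C - f ` (- E)))"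


section \<open>The determinantal surfaces\<close>

text \<open>
  \<open>G1_entry\<close>, \<open>G2_entry\<close> take row and column indices starting at 1; the library's
  matrices are indexed from 0.
\<close>

definition G1_entry :: "nat \<Rightarrow> c3 \<Rightarrow> nat \<Rightarrow> nat \<Rightarrow> complex" where
  "G1_entry l = (\<lambda>(chi, a, s) j k.
     if j \<le> l \<and> k = j then s / 2
     else if j \<le> l \<and> k = j + 1 then chi * a - of_nat j
     else if j = l + 1 \<and> k = l + 1 then 1 / 2
     else 0)"

definition G2_entry :: "nat \<Rightarrow> c3 \<Rightarrow> nat \<Rightarrow> nat \<Rightarrow> complex" where
  "G2_entry l = (\<lambda>(chi, a, s) j k.
     if j \<le> l \<and> k = l + 1 - j then a / 2
     else if j \<le> l \<and> k = l + 2 - j then chi * s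
     else if j = l + 1 \<and> k = 1 then chi
     else 0)"

definition G1 :: "nat \<Rightarrow> c3 \<Rightarrow> complex mat" where
  "G1 l p = Matrix.mat (l + 1) (l + 1) (\<lambda>(i, k). G1_entry l p (i + 1) (k + 1))"

definition G2 :: "nat \<Rightarrow> c3 \<Rightarrow> complex mat" where
  "G2 l p = Matrix.mat (l + 1) (l + 1) (\<lambda>(i, k). G2_entry l p (i + 1) (k + 1))"

text \<open>The sign \<open>\<plusminus>\<close> is \<open>\<epsilon> \<in> {1, -1}\<close>.\<close>

definition detP :: "nat \<Rightarrow> complex \<Rightarrow> c3 \<Rightarrow> complex" where
  "detP l \<epsilon> p = Determinant.det (G1 l p + \<epsilon> \<cdot>\<^sub>m G2 l p)"

definition surface :: "nat \<Rightarrow> complex \<Rightarrow> c3 set" where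
  "surface l \<epsilon> = {p. detP l \<epsilon> p = 0}"

definition s_coord :: "c3 \<Rightarrow> complex" where
  "s_coord = (\<lambda>(chi, a, s). s)"

definition surface_o :: "nat \<Rightarrow> complex \<Rightarrow> c3 set" where
  "surface_o l \<epsilon> = surface l \<epsilon> - {p. s_coord p = 0}"

definition surface_fiber :: "nat \<Rightarrow> complex \<Rightarrow> complex \<Rightarrow> c3 set" where
  "surface_fiber l \<epsilon> s = {p \<in> surface_o l \<epsilon>. s_coord p = s}"

end

theory Submission
  imports Defs "HOL-Computational_Algebra.Fundamental_Theorem_Algebra"
begin

text \<open>
  A kernel vector of \<open>G\<^sub>1 \<plusminus> G\<^sub>2\<close> is a polynomial \<open>p\<close> of degree at most \<open>l\<close> with
  \<open>p' = (s/2 + \<chi> a/z) p + (a/(2z) + \<chi> s) q\<close>, where \<open>q = \<plusminus> z\<^sup>l p(1/z)\<close>. Let \<open>c\<close> be a symmetric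
  solution of \<open>k c\<^sub>k = (s/2) (c\<^sub>k\<^sub>+\<^sub>1 - c\<^sub>k\<^sub>-\<^sub>1)\<close>; up to scaling these sequences form a projective line with
  coordinate \<open>[c\<^sub>0 : c\<^sub>1]\<close>. For exactly one point of this line \<open>p\<close> is a reversed orthogonal polynomial on the unit
  circle, i.e. it is orthogonal to \<open>z, \<dots>, z\<^sup>l\<close> for the functional with moments \<open>c\<close>. Conversely, if the
  Toeplitz determinants \<open>D\<^sub>l\<close> and \<open>D\<^sub>l\<^sub>+\<^sub>1\<close> of \<open>c\<close> do not vanish, then the orthogonal polynomial
  solves the differential equation with \<open>\<chi> = \<plusminus> B\<^sub>l / (2 D\<^sub>l)\<close> and \<open>a = \<mp> s B\<^sub>l\<^sub>+\<^sub>1 / D\<^sub>l\<^sub>+\<^sub>1\<close>, where \<open>B\<^sub>n\<close>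
  arises from \<open>D\<^sub>n\<close> by shifting its last column. This is the parametrization of the \<open>s\<close>-fiber. The forms
  \<open>D\<^sub>l\<close>, \<open>D\<^sub>l\<^sub>+\<^sub>1\<close> have degrees \<open>l\<close>, \<open>l + 1\<close> in \<open>(c\<^sub>0, c\<^sub>1)\<close> and no common zero, and \<open>B\<^sub>n\<close> does not vanish where
  \<open>D\<^sub>n\<close> does; hence the degree \<open>2 l + 1\<close>. The surface is smooth because a kernel vector is
  determined by its moments, so that it has at most one independent deformation with \<open>s\<close> fixed.
\<close>

section \<open>Moments and kernel vectors\<close>

text \<open>The moment relation is integration by parts for the weight exp(-(s/2)(z + 1/z)) on the
  unit circle: a functional L with these moments satisfies L(z p') = (s/2) L((z - 1/z) p). Its
  symmetric solutions are spanned by the modified Bessel sequences (-1)^k I_k(s) and K_k(s), which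
  is why they form a plane. When L is applied to the differential equation, multiplied by z, the
  term (s/2) z p turns into (s/2) p / z and nothing else changes. So the moments of p obey equations
  of the same kind as its coefficients, and these can be solved inwards and outwards from few
  values. The obstacle is that L is complex: no positivity keeps the Toeplitz determinants away from
  zero, and their zeros on the projective line must be treated as well. The substitute is that a
  nonzero L annihilates no polynomial p \<noteq> 0 together with all products z^j p. Hence a
  Toeplitz determinant that vanishes after a nonvanishing one is followed by a nonvanishing
  one.\<close>

definition supported :: "int \<Rightarrow> (int \<Rightarrow> complex) \<Rightarrow> bool" where
  "supported n V \<longleftrightarrow> (\<forall>k. k < 0 \<or> n < k \<longrightarrow> V k = 0)"

definition is_moments :: "complex \<Rightarrow> (int \<Rightarrow> complex) \<Rightarrow> bool" where
  "is_moments s c \<longleftrightarrow> (\<forall>k. c (- k) = c k) \<and> (\<forall>k. of_int k * c k = s / 2 * (c (k + 1) - c (k - 1)))"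

text \<open>
  For the functional \<open>L\<close> with \<open>L z\<^sup>k = c k\<close>, \<open>mpair n c V j\<close> is \<open>L (z\<^sup>-\<^sup>j p)\<close> with \<open>p = \<Sum>\<^sub>k V k z\<^sup>k\<close>. The kernel
  equations of the matrix are \<open>vrow\<close> for \<open>1 \<le> j \<le> n + 1\<close>; extending \<open>V\<close> by zero they hold
  for all integers \<open>j\<close>. Applying \<open>L\<close> turns them into \<open>corow\<close>.
\<close>

definition mpair :: "int \<Rightarrow> (int \<Rightarrow> complex) \<Rightarrow> (int \<Rightarrow> complex) \<Rightarrow> int \<Rightarrow> complex" where
  "mpair n c V j = (\<Sum>k\<in>{0..n}. V k * c (k - j))"

definition vrow :: "int \<Rightarrow> complex \<Rightarrow> complex \<Rightarrow> complex \<Rightarrow> complex \<Rightarrow> (int \<Rightarrow> complex) \<Rightarrow> int \<Rightarrow> complex" where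
  "vrow n e \<kappa> a s V j = s / 2 * V (j - 1) + (\<kappa> * a - of_int j) * V j + e * (a / 2) * V (n - j)
     + e * \<kappa> * s * V (n + 1 - j)"

definition corow :: "int \<Rightarrow> complex \<Rightarrow> complex \<Rightarrow> complex \<Rightarrow> complex \<Rightarrow> (int \<Rightarrow> complex) \<Rightarrow> int \<Rightarrow> complex" where
  "corow n e \<kappa> a s u j = s / 2 * u (j + 1) + (\<kappa> * a - of_int j) * u j + e * (a / 2) * u (n - j)
     + e * \<kappa> * s * u (n + 1 - j)"

definition row_ker :: "int \<Rightarrow> complex \<Rightarrow> complex \<Rightarrow> complex \<Rightarrow> complex \<Rightarrow> (int \<Rightarrow> complex) \<Rightarrow> bool" where
  "row_ker n e \<kappa> a s V \<longleftrightarrow> supported n V \<and> (\<forall>j. vrow n e \<kappa> a s V j = 0)"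

section \<open>Pairing the kernel equations with a moment functional\<close>

lemma is_momentsD:
  assumes "is_moments s c"
  shows "c (- k) = c k" "of_int k * c k = s / 2 * (c (k + 1) - c (k - 1))"
  using assms by (auto simp: is_moments_def)

lemma is_moments_sym: "is_moments s c \<Longrightarrow> c (i - j) = c (j - i)"
  using is_momentsD(1)[of s c "j - i"] by simp

lemma is_moments_zero_eq:
  assumes "is_moments s c" "s \<noteq> 0" "c 0 = 0" "c 1 = 0"
  shows "c k = 0"
proof -
  have "c (int m) = 0 \<and> c (int m + 1) = 0" for m
  proof (induction m)
    case (Suc m)
    have "of_int (int m + 1) * c (int m + 1) = s / 2 * (c (int m + 1 + 1) - c (int m + 1 - 1))"
      by (rule is_momentsD(2)[OF assms(1)])
    with Suc show ?case using assms(2) by (simp add: add.commute)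
  qed (use assms in auto)
  then show ?thesis
    using is_momentsD(1)[OF assms(1), of k] assms(3) by (cases k rule: int_cases3) auto
qed

lemma pair_superset:
  assumes "supported n V" "finite A" "{0..n} \<subseteq> A"
  shows "(\<Sum>k\<in>A. V k * f k) = (\<Sum>k\<in>{0..n}. V k * f k)"
  using assms by (intro sum.mono_neutral_right) (auto simp: supported_def)

lemma pair_lin:
  "mpair n c (\<lambda>k. x * V k + y * W k) j = x * mpair n c V j + y * mpair n c W j"
  unfolding mpair_def by (simp add: sum.distrib sum_distrib_left algebra_simps)

lemma pair_lin_moment:
  "mpair n (\<lambda>k. x * c k + y * d k) V j = x * mpair n c V j + y * mpair n d V j"
  unfolding mpair_def by (simp add: sum.distrib sum_distrib_left algebra_simps)

text \<open>The window \<open>{-1..n+2}\<close> contains the supports of all terms of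
  \<open>vrow\<close> and is symmetric under k -> n + 1 - k, so \<open>V\<close> can be shifted and
  reversed without boundary terms.\<close>

lemma sum_shift:
  assumes "supported n V"
  shows "(\<Sum>k\<in>{-1..n+2}. V (k - 1) * c (k - j)) = mpair n c V (j - 1)"
proof -
  have "(\<Sum>k\<in>{-1..n+2}. V (k - 1) * c (k - j)) = (\<Sum>k\<in>{-2..n+1}. V k * c (k - (j - 1)))"
    by (rule sum.reindex_bij_witness[of _ "\<lambda>k. k + 1" "\<lambda>k. k - 1"]) (auto simp: algebra_simps)
  then show ?thesis
    unfolding mpair_def using assms by (subst (asm) pair_superset) auto
qed

lemma sum_same:
  assumes "supported n V"
  shows "(\<Sum>k\<in>{-1..n+2}. V k * c (k - j)) = mpair n c V j"
  unfolding mpair_def using assms by (subst pair_superset) auto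

text \<open>Integration by parts: k is split as j + (k - j), and the moment relation turns the
  factor k - j into a difference of the two neighbouring pairings.\<close>

lemma sum_weighted:
  assumes "supported n V" "is_moments s c"
  shows "(\<Sum>k\<in>{-1..n+2}. of_int k * V k * c (k - j))
    = of_int j * mpair n c V j + s / 2 * (mpair n c V (j - 1) - mpair n c V (j + 1))"
proof -
  have "of_int k * V k * c (k - j)
      = of_int j * (V k * c (k - j)) + s / 2 * (V k * c (k - (j - 1)) - V k * c (k - (j + 1)))" for k
  proof -
    have "V k * (of_int (k - j) * c (k - j)) = V k * (s / 2 * (c (k - j + 1) - c (k - j - 1)))"
      by (simp only: is_momentsD(2)[OF assms(2), of "k - j"])
    moreover have "k - j + 1 = k - (j - 1)" "k - j - 1 = k - (j + 1)" by auto
    ultimately show ?thesis by (simp add: field_simps)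
  qed
  then show ?thesis
    by (simp only: sum.distrib sum_subtractf sum_distrib_left[symmetric] sum_same[OF assms(1)])
qed

lemma sum_reflect:
  assumes "supported n V" "is_moments s c" "d \<in> {0, 1}"
  shows "(\<Sum>k\<in>{-1..n+2}. V (n + d - k) * c (k - j)) = mpair n c V (n + d - j)"
proof -
  have "(\<Sum>k\<in>{-1..n+2}. V (n + d - k) * c (k - j)) = (\<Sum>k\<in>{d-2..n+d+1}. V k * c (k - (n + d - j)))"
    by (rule sum.reindex_bij_witness[of _ "\<lambda>k. n + d - k" "\<lambda>k. n + d - k"])
       (auto simp: is_moments_sym[OF assms(2)] algebra_simps)
  then show ?thesis
    unfolding mpair_def using assms by (subst (asm) pair_superset) auto
qed

text \<open>The weighted sum contributes the pairing at j - 1 with the sign that cancels the shift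
  term, and leaves the pairing at j + 1. Hence \<open>corow\<close> differs from \<open>vrow\<close>
  in that one index only.\<close>

lemma row_pair:
  assumes "supported n V" "is_moments s c"
  shows "(\<Sum>k\<in>{-1..n+2}. vrow n e \<kappa> a s V k * c (k - j)) = corow n e \<kappa> a s (mpair n c V) j"
proof -
  have "(\<Sum>k\<in>{-1..n+2}. vrow n e \<kappa> a s V k * c (k - j))
     = s / 2 * (\<Sum>k\<in>{-1..n+2}. V (k - 1) * c (k - j))
       + \<kappa> * a * (\<Sum>k\<in>{-1..n+2}. V k * c (k - j)) - (\<Sum>k\<in>{-1..n+2}. of_int k * V k * c (k - j))
       + e * (a / 2) * (\<Sum>k\<in>{-1..n+2}. V (n + 0 - k) * c (k - j))
       + e * \<kappa> * s * (\<Sum>k\<in>{-1..n+2}. V (n + 1 - k) * c (k - j))"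
    unfolding vrow_def by (simp add: sum.distrib sum_subtractf sum_distrib_left algebra_simps)
  also have "\<dots> = corow n e \<kappa> a s (mpair n c V) j"
    unfolding sum_shift[OF assms(1)] sum_same[OF assms(1)] sum_weighted[OF assms]
      sum_reflect[OF assms, of 0, simplified] sum_reflect[OF assms, of 1, simplified] corow_def
    by (simp add: sum_reflect[OF assms, of 0, simplified] sum_reflect[OF assms, of 1, simplified] field_simps)
  finally show ?thesis .
qed

lemma corow_pair:
  assumes "row_ker n e \<kappa> a s V" "is_moments s c"
  shows "corow n e \<kappa> a s (mpair n c V) j = 0"
  using assms row_pair[of n V s c e \<kappa> a j] by (simp add: row_ker_def)

text \<open>
  In terms of \<open>V\<close> and \<open>W k = e V (n - k)\<close> the row equations no longer involve the sign, so
  that solutions for both signs can be subtracted.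
\<close>

lemma coupled_eq_0:
  assumes P: "\<And>j. s / 2 * V (j - 1) + (\<kappa> * a - of_int j) * V j + a / 2 * W j + \<kappa> * s * W (j - 1) = 0"
    and Q: "\<And>j. s / 2 * W j + (\<kappa> * a - of_int (n + 1 - j)) * W (j - 1) + a / 2 * V (j - 1) + \<kappa> * s * V j = 0"
    and neg: "\<And>k. k < (0::int) \<Longrightarrow> V k = 0 \<and> W k = 0" and s: "s \<noteq> 0" and V0: "V 0 = 0"
  shows "V k = (0::complex) \<and> W k = (0::complex)"
proof -
  have "V (int j) = 0 \<and> W (int j) = 0" for j
  proof (induction j)
    case 0
    then show ?case using Q[of 0] neg[of "-1"] V0 s by simp
  next
    case (Suc j)
    define i where "i = int (Suc j)"
    have i: "V (i - 1) = 0" "W (i - 1) = 0" "i > 0" using Suc by (auto simp: i_def)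
    have p: "(\<kappa> * a - of_int i) * V i + a / 2 * W i = 0" using P[of i] i by simp
    have "s * (W i / 2 + \<kappa> * V i) = 0" using Q[of i] i by (simp add: algebra_simps)
    then have q: "W i / 2 + \<kappa> * V i = 0" using s by simp
    have "of_int i * V i = a * (W i / 2 + \<kappa> * V i) - ((\<kappa> * a - of_int i) * V i + a / 2 * W i)"
      by (simp add: algebra_simps)
    then have "V i = 0" unfolding p q using i by simp
    then show ?case using q by (simp add: i_def)
  qed
  then show ?thesis using neg by (metis nonneg_int_cases not_less)
qed

text \<open>The second equation is row n + 1 - j multiplied by the sign; \<open>e * e = 1\<close>
  turns its reflected terms back into \<open>V\<close>.\<close>

lemma vrow_coupled:
  assumes "row_ker n e \<kappa> a s V" "e * e = 1"
  defines "W \<equiv> \<lambda>k. e * V (n - k)"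
  shows "s / 2 * V (j - 1) + (\<kappa> * a - of_int j) * V j + a / 2 * W j + \<kappa> * s * W (j - 1) = 0"
    and "s / 2 * W j + (\<kappa> * a - of_int (n + 1 - j)) * W (j - 1) + a / 2 * V (j - 1) + \<kappa> * s * V j = 0"
proof -
  have R: "vrow n e \<kappa> a s V i = 0" for i using assms(1) by (simp add: row_ker_def)
  have i: "n - (j - 1) = n + 1 - j" "n + 1 - j - 1 = n - j" "n - (n + 1 - j) = j - 1" "n + 1 - (n + 1 - j) = j"
    by auto
  show "s / 2 * V (j - 1) + (\<kappa> * a - of_int j) * V j + a / 2 * W j + \<kappa> * s * W (j - 1) = 0"
    using R[of j] unfolding vrow_def W_def i by (simp add: algebra_simps)
  have "e * (s / 2 * V (n - j) + (\<kappa> * a - of_int (n + 1 - j)) * V (n + 1 - j)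
       + e * (a / 2) * V (j - 1) + e * \<kappa> * s * V j) = 0"
    using R[of "n + 1 - j"] unfolding vrow_def i by simp
  also have "e * (s / 2 * V (n - j) + (\<kappa> * a - of_int (n + 1 - j)) * V (n + 1 - j)
       + e * (a / 2) * V (j - 1) + e * \<kappa> * s * V j)
    = s / 2 * W j + (\<kappa> * a - of_int (n + 1 - j)) * W (j - 1) + e * e * (a / 2 * V (j - 1) + \<kappa> * s * V j)"
    unfolding W_def i by (simp add: algebra_simps)
  finally show "s / 2 * W j + (\<kappa> * a - of_int (n + 1 - j)) * W (j - 1) + a / 2 * V (j - 1) + \<kappa> * s * V j = 0"
    using assms(2) by (simp add: algebra_simps)
qed

text \<open>Makes the kernel at most one-dimensional and justifies the normalization
  \<open>V 0 = 1\<close> of kernel vectors below.\<close>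

lemma row_ker_eq_0:
  assumes K: "row_ker n e \<kappa> a s V" and s: "s \<noteq> 0" and e: "e * e = 1" and V0: "V 0 = 0"
  shows "V k = 0"
proof -
  have "V k = 0 \<and> e * V (n - k) = 0"
    by (rule coupled_eq_0[of s V \<kappa> a "\<lambda>k. e * V (n - k)" n, OF vrow_coupled[OF K e] _ s V0])
       (use K in \<open>auto simp: row_ker_def supported_def\<close>)
  then show ?thesis by simp
qed

text \<open>Induction from both ends: once u i and u (n + 1 - i) vanish, equations i and n - i form
  a homogeneous system for u (i + 1) and u (n - i) with determinant - s (n - i) / 2.\<close>

lemma corow_ends_eq_0:
  assumes C: "\<And>j. 1 \<le> j \<Longrightarrow> j \<le> n - 1 \<Longrightarrow> corow n e \<kappa> a s u j = 0"
    and s: "s \<noteq> 0" and e: "e * e = 1" and u1: "u 1 = 0" and un: "u n = 0"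
    and k: "1 \<le> k" "k \<le> n"
  shows "u k = 0"
proof -
  have "int j < n \<longrightarrow> u (int j + 1) = 0 \<and> u (n - int j) = 0" for j
  proof (induction j)
    case (Suc j)
    show ?case
    proof
      assume j: "int (Suc j) < n"
      define i where "i = int (Suc j)"
      have i: "1 \<le> i" "i < n" "u i = 0" "u (n + 1 - i) = 0" using j Suc by (auto simp: i_def algebra_simps)
      have p: "s / 2 * u (i + 1) + e * (a / 2) * u (n - i) = 0"
        using C[of i] i by (simp add: corow_def)
      have "n - i + 1 = n + 1 - i" "n - (n - i) = i" "n + 1 - (n - i) = i + 1" by auto
      then have q: "(\<kappa> * a - of_int (n - i)) * u (n - i) + e * \<kappa> * s * u (i + 1) = 0"
        using C[of "n - i"] i unfolding corow_def by (simp only:) simp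
      have "of_int (n - i) * u (n - i) = 2 * e * \<kappa> * (s / 2 * u (i + 1) + e * (a / 2) * u (n - i))
          - ((\<kappa> * a - of_int (n - i)) * u (n - i) + e * \<kappa> * s * u (i + 1))
          + (1 - e * e) * (\<kappa> * a * u (n - i))"
        by (simp add: algebra_simps)
      then have "of_int (n - i) * u (n - i) = 0" unfolding p q e by simp
      then have "u (n - i) = 0" using i by (simp del: of_int_diff)
      then show "u (int (Suc j) + 1) = 0 \<and> u (n - int (Suc j)) = 0" using p s by (simp add: i_def)
    qed
  qed (use u1 un in auto)
  from this[of "nat (k - 1)"] show ?thesis using k by simp
qed

text \<open>The combination of \<open>corow\<close> at \<open>0\<close> and \<open>n\<close> from which the outer values \<open>u 0\<close>, \<open>u (n + 1)\<close> drop out.\<close>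

definition bdry :: "int \<Rightarrow> complex \<Rightarrow> complex \<Rightarrow> complex \<Rightarrow> complex \<Rightarrow> (int \<Rightarrow> complex) \<Rightarrow> complex" where
  "bdry n e \<kappa> a s u = s * (1 / 2 - 2 * \<kappa> * \<kappa>) * u 1 + e * (a / 2 - 2 * \<kappa> * (\<kappa> * a - of_int n)) * u n"

lemma bdry_eq:
  assumes "e * e = 1"
  shows "bdry n e \<kappa> a s u = corow n e \<kappa> a s u 0 - 2 * e * \<kappa> * corow n e \<kappa> a s u n"
proof -
  have "corow n e \<kappa> a s u 0 - 2 * e * \<kappa> * corow n e \<kappa> a s u n
    = s * (1 / 2 - (e * e) * 2 * \<kappa> * \<kappa>) * u 1 + e * (a / 2 - 2 * \<kappa> * (\<kappa> * a - of_int n)) * u n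
      + (\<kappa> * a - (e * e) * \<kappa> * a) * u 0"
    by (simp add: corow_def algebra_simps)
  then show ?thesis using assms by (simp add: bdry_def)
qed

text \<open>\<open>bdry\<close> is a relation between u 1 and u n with a nonzero coefficient: that
  of u 1 vanishes only if 4 \<kappa> \<kappa> = 1, and then that of u n is 2 e \<kappa> n. So the
  pairs (u 1, u n) lie on a line, and these two values determine the rest by
  \<open>corow_ends_eq_0\<close>.\<close>

lemma corow_onedim:
  assumes C: "\<And>j. 1 \<le> j \<Longrightarrow> j \<le> n - 1 \<Longrightarrow> corow n e \<kappa> a s u j = 0" "bdry n e \<kappa> a s u = 0"
    and C': "\<And>j. 1 \<le> j \<Longrightarrow> j \<le> n - 1 \<Longrightarrow> corow n e \<kappa> a s u' j = 0" "bdry n e \<kappa> a s u' = 0"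
    and s: "s \<noteq> 0" and e: "e * e = 1" and n: "n \<ge> 1"
  obtains x y where "(x, y) \<noteq> (0, 0)" "\<And>k. 1 \<le> k \<Longrightarrow> k \<le> n \<Longrightarrow> x * u k + y * u' k = 0"
proof -
  have lin: "\<exists>x y. (x, y) \<noteq> (0, 0) \<and> x * p + y * q = 0" for p q :: complex
  proof (cases "p = 0 \<and> q = 0")
    case True then show ?thesis by (intro exI[of _ 1] exI[of _ 1]) auto
  next
    case False then show ?thesis by (intro exI[of _ q] exI[of _ "- p"]) auto
  qed
  have e0: "e \<noteq> 0" using e by auto
  define w where "w x y = (\<lambda>k. x * u k + y * u' k)" for x y
  have cw: "corow n e \<kappa> a s (w x y) j = x * corow n e \<kappa> a s u j + y * corow n e \<kappa> a s u' j" for x y j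
    by (simp add: corow_def w_def algebra_simps)
  have bw: "bdry n e \<kappa> a s (w x y) = x * bdry n e \<kappa> a s u + y * bdry n e \<kappa> a s u'" for x y
    by (simp add: bdry_def w_def field_simps)
  have key: "\<exists>x y. (x, y) \<noteq> (0, 0) \<and> w x y 1 = 0 \<and> w x y n = 0"
  proof (cases "4 * (\<kappa> * \<kappa>) = 1")
    case False
    obtain x y where xy: "(x, y) \<noteq> (0, 0)" "w x y n = 0" using lin[of "u n" "u' n"] by (auto simp: w_def)
    have "s * (1 / 2 - 2 * \<kappa> * \<kappa>) * w x y 1 = 0" using bw[of x y] C(2) C'(2) xy by (simp add: bdry_def)
    moreover have "1 / 2 - 2 * \<kappa> * \<kappa> \<noteq> 0"
    proof
      assume "1 / 2 - 2 * \<kappa> * \<kappa> = 0"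
      then have "2 * (1 / 2 - 2 * \<kappa> * \<kappa>) = 0" by simp
      then show False using False by (simp add: algebra_simps)
    qed
    ultimately show ?thesis using s xy by auto
  next
    case True
    obtain x y where xy: "(x, y) \<noteq> (0, 0)" "w x y 1 = 0" using lin[of "u 1" "u' 1"] by (auto simp: w_def)
    have "e * (a / 2 - 2 * \<kappa> * (\<kappa> * a - of_int n)) * w x y n = 0"
      using bw[of x y] C(2) C'(2) xy by (simp add: bdry_def)
    moreover have "a / 2 - 2 * \<kappa> * (\<kappa> * a - of_int n) = (1 - 4 * (\<kappa> * \<kappa>)) * a / 2 + 2 * \<kappa> * of_int n"
      by (simp add: field_simps)
    moreover have "\<kappa> \<noteq> 0" using True by auto
    ultimately have "w x y n = 0" using True e0 n by simp
    then show ?thesis using xy by blast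
  qed
  then obtain x y where xy: "(x, y) \<noteq> (0, 0)" "w x y 1 = 0" "w x y n = 0" by blast
  have "w x y k = 0" if "1 \<le> k" "k \<le> n" for k
    by (rule corow_ends_eq_0[of n e \<kappa> a s "w x y"]) (use cw C C' s e xy that in auto)
  then show ?thesis using that[of x y] xy by (auto simp: w_def)
qed

text \<open>The polynomials p with L(z^j p) = 0 for all j are stable under z d/dz. Passing from p to
  m p - z p', where m bounds the degree, lowers the bound and multiplies the constant term by m; it
  ends at a nonzero constant, which forces c = 0.\<close>

lemma orthogonal_imp_zero_is_moments:
  assumes "is_moments s c" "supported (int m) V" "V 0 \<noteq> 0" "\<And>j. mpair (int m) c V j = 0"
  shows "c k = 0"
  using assms(2-)
proof (induction m arbitrary: V)
  case 0
  have "V 0 * c (0 - (- k)) = 0"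
    using "0.prems"(3)[of "- k"] by (simp add: mpair_def)
  then show ?case using "0.prems"(2) by simp
next
  case (Suc m)
  define V' where "V' k = (of_int (int (Suc m)) - of_int k) * V k" for k
  have sup: "supported (int m) V'"
    unfolding supported_def
  proof (intro allI impI)
    fix k assume "k < 0 \<or> int m < k"
    then have "k < 0 \<or> k = int (Suc m) \<or> int (Suc m) < k" by linarith
    then show "V' k = 0" using Suc.prems(1) by (auto simp: supported_def V'_def)
  qed
  have "mpair (int m) c V' j = 0" for j
  proof -
    have w: "(\<Sum>k\<in>{-1..int (Suc m)+2}. of_int k * V k * c (k - j)) = 0"
      by (subst sum_weighted[OF Suc.prems(1) assms(1)]) (simp del: of_nat_Suc add: Suc.prems(3))
    have "mpair (int m) c V' j = (\<Sum>k\<in>{-1..int (Suc m)+2}. V' k * c (k - j))"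
      unfolding mpair_def using sup by (subst (2) pair_superset[of "int m"]) auto
    also have "\<dots> = of_int (int (Suc m)) * (\<Sum>k\<in>{-1..int (Suc m)+2}. V k * c (k - j))
        - (\<Sum>k\<in>{-1..int (Suc m)+2}. of_int k * V k * c (k - j))"
      unfolding sum_distrib_left sum_subtractf[symmetric]
      by (rule sum.cong) (auto simp: V'_def algebra_simps)
    also have "\<dots> = 0"
      unfolding w sum_same[OF Suc.prems(1)] Suc.prems(3) by simp
    finally show ?thesis .
  qed
  moreover have "V' 0 = of_nat (Suc m) * V 0" by (simp add: V'_def)
  then have "V' 0 \<noteq> 0" using Suc.prems(2) by (simp del: of_nat_Suc)
  ultimately show ?case using Suc.IH sup by blast
qed

text \<open>The window 0..n of vanishing pairings grows on both sides: equations -q and n + q are a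
  system for u (-q) and u (n + q + 1) with determinant s q / 2. Once all pairings vanish, the
  functional itself is zero.\<close>

lemma row_ker_orthogonal_imp_zero_is_moments:
  assumes K: "row_ker n e \<kappa> a s V" and V0: "V 0 \<noteq> 0" and n: "n \<ge> 1" and s: "s \<noteq> 0"
    and e: "e * e = 1" and M: "is_moments s c"
    and u: "\<And>k. 0 \<le> k \<Longrightarrow> k \<le> n \<Longrightarrow> mpair n c V k = 0"
  shows "c k = 0"
proof -
  define u' where "u' = mpair n c V"
  have C: "corow n e \<kappa> a s u' j = 0" for j using corow_pair[OF K M] by (simp add: u'_def)
  have u0: "u' k = 0" if "0 \<le> k" "k \<le> n" for k using u that by (simp add: u'_def)
  have step: "u' (- int i) = 0 \<and> u' (n + int i + 1) = 0" for i
  proof (induction i)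
    case 0
    have "u' (n + 1) = 0" using C[of n] u0[of 0] u0[of n] u0[of 1] n s by (simp add: corow_def)
    then show ?case using u0[of 0] n by simp
  next
    case (Suc i)
    define q where "q = int i + 1"
    have q: "q \<ge> 1" "u' (1 - q) = 0" "u' (n + q) = 0" using Suc by (auto simp: q_def algebra_simps)
    have f1: "(\<kappa> * a + of_int q) * u' (- q) + e * \<kappa> * s * u' (n + q + 1) = 0"
      using C[of "- q"] q by (simp add: corow_def algebra_simps)
    have f2: "s / 2 * u' (n + q + 1) + e * (a / 2) * u' (- q) = 0"
      using C[of "n + q"] q by (simp add: corow_def algebra_simps)
    have "of_int q * u' (- q) = ((\<kappa> * a + of_int q) * u' (- q) + e * \<kappa> * s * u' (n + q + 1))
         - 2 * e * \<kappa> * (s / 2 * u' (n + q + 1) + e * (a / 2) * u' (- q))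
         + (e * e - 1) * \<kappa> * a * u' (- q)" by (simp add: algebra_simps)
    then have z: "u' (- q) = 0" unfolding f1 f2 e using q by simp
    then have "u' (n + q + 1) = 0" using f2 s by simp
    then show ?case using z by (simp add: q_def algebra_simps)
  qed
  have "u' j = 0" for j
  proof -
    consider "j < 0" | "0 \<le> j" "j \<le> n" | "n < j" by linarith
    then show ?thesis
    proof cases
      case 1 then show ?thesis using step[of "nat (- j)"] by simp
    next
      case 2 then show ?thesis using u0 by simp
    next
      case 3 then show ?thesis using step[of "nat (j - n - 1)"] by simp
    qed
  qed
  then show ?thesis
    using orthogonal_imp_zero_is_moments[of s c "nat n" V k] M K V0 n by (auto simp: row_ker_def u'_def)
qed


text \<open>The pairings of \<open>V\<close> with c and with d solve the same equations, whose
  solutions on 1..n are at most one-dimensional; linearity in the moments transfers the relation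
  between them to c and d.\<close>

lemma ex_orthogonal_is_moments:
  assumes K: "row_ker n e \<kappa> a s V" and n: "n \<ge> 1" and s: "s \<noteq> 0"
    and e: "e * e = 1" and M: "is_moments s c" "is_moments s d"
  obtains x y where "(x, y) \<noteq> (0, 0)"
    "\<And>k. 1 \<le> k \<Longrightarrow> k \<le> n \<Longrightarrow> mpair n (\<lambda>k. x * c k + y * d k) V k = 0"
proof -
  have C: "corow n e \<kappa> a s (mpair n b V) j = 0" if "is_moments s b" for b j
    using corow_pair[OF K that] .
  have B: "bdry n e \<kappa> a s (mpair n b V) = 0" if "is_moments s b" for b
    using C[OF that] by (simp add: bdry_eq[OF e])
  obtain x y where "(x, y) \<noteq> (0, 0)" "\<And>k. 1 \<le> k \<Longrightarrow> k \<le> n \<Longrightarrow> x * mpair n c V k + y * mpair n d V k = 0"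
    using corow_onedim[of n e \<kappa> a s "mpair n c V" "mpair n d V", OF C[OF M(1)] B[OF M(1)] C[OF M(2)] B[OF M(2)] s e n]
    by blast
  then show ?thesis using that[of x y] by (simp add: pair_lin_moment)
qed

section \<open>Orthogonal polynomials and nonsingular Toeplitz matrices\<close>

text \<open>Injectivity of the n x n Toeplitz matrix \<open>c (k - i)\<close>. It is stated for
  integer sequences of bounded support, so that shifted and reversed vectors keep their type;
  \<open>toep_nonzero_iff\<close> is the link to determinants.\<close>

definition nonsing :: "int \<Rightarrow> (int \<Rightarrow> complex) \<Rightarrow> bool" where
  "nonsing n c \<longleftrightarrow> (\<forall>W. supported (n - 1) W \<longrightarrow> (\<forall>i. 0 \<le> i \<and> i < n \<longrightarrow> mpair (n - 1) c W i = 0) \<longrightarrow> (\<forall>k. W k = 0))"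

lemma nonsingD:
  assumes "nonsing n c" "supported (n - 1) W" "\<And>i. 0 \<le> i \<Longrightarrow> i < n \<Longrightarrow> mpair (n - 1) c W i = 0"
  shows "W k = 0"
  using assms unfolding nonsing_def by blast

lemma mpair_shift:
  assumes "W 0 = 0"
  shows "mpair (n - 1) c (\<lambda>k. W (k + 1)) j0 = mpair n c W (j0 + 1)"
proof -
  have "mpair (n - 1) c (\<lambda>k. W (k + 1)) j0 = (\<Sum>k\<in>{1..n}. W k * c (k - (j0 + 1)))"
    unfolding mpair_def
    by (rule sum.reindex_bij_witness[of _ "\<lambda>k. k - 1" "\<lambda>k. k + 1"]) (auto simp: algebra_simps)
  also have "\<dots> = mpair n c W (j0 + 1)"
    unfolding mpair_def
  proof (intro sum.mono_neutral_left ballI)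
    fix i assume "i \<in> {0..n} - {1..n}"
    then have "i = 0" by auto
    then show "W i * c (i - (j0 + 1)) = 0"  using assms by simp
  qed auto
  finally show ?thesis .
qed

lemma supported_shift: "supported n W \<Longrightarrow> W 0 = 0 \<Longrightarrow> supported (n - 1) (\<lambda>k. W (k + 1))"
  unfolding supported_def
proof (intro allI impI)
  fix k assume *: "\<forall>k. k < 0 \<or> n < k \<longrightarrow> W k = 0" "W 0 = 0" "k < 0 \<or> n - 1 < k"
  then have "k + 1 = 0 \<or> k + 1 < 0 \<or> n < k + 1" by linarith
  then show "W (k + 1) = 0" using * by auto
qed

lemma nonsing_shiftD:
  assumes "nonsing n c" "supported n W" "W 0 = 0" "\<And>i. 1 \<le> i \<Longrightarrow> i \<le> n \<Longrightarrow> mpair n c W i = 0"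
  shows "W k = 0"
proof -
  have "W (k - 1 + 1) = 0"
    by (rule nonsingD[OF assms(1), of "\<lambda>k. W (k + 1)"])
      (use assms in \<open>auto simp: supported_shift mpair_shift\<close>)
  then show ?thesis by simp
qed

lemma mpair_superset:
  assumes "supported n V" "n \<le> m"
  shows "mpair m c V j = mpair n c V j"
  unfolding mpair_def using assms by (intro pair_superset) auto

lemma mpair_reflect:
  assumes "is_moments s c"
  shows "mpair n c (\<lambda>k. V (n - k)) j = mpair n c V (n - j)"
  unfolding mpair_def
  by (rule sum.reindex_bij_witness[of _ "\<lambda>k. n - k" "\<lambda>k. n - k"])
     (auto simp: is_moments_sym[OF assms] algebra_simps)

lemma supported_reflect: "supported n V \<Longrightarrow> supported n (\<lambda>k. V (n - k))"
  by (auto simp: supported_def)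

lemma mpair_commute:
  assumes "is_moments s c"
  shows "(\<Sum>i\<in>{0..n}. W i * mpair n c V i) = (\<Sum>i\<in>{0..n}. V i * mpair n c W i)"
proof -
  have "(\<Sum>i\<in>{0..n}. W i * mpair n c V i) = (\<Sum>i\<in>{0..n}. \<Sum>k\<in>{0..n}. V k * (W i * c (k - i)))"
    unfolding mpair_def by (simp add: sum_distrib_left algebra_simps)
  also have "\<dots> = (\<Sum>k\<in>{0..n}. \<Sum>i\<in>{0..n}. V k * (W i * c (i - k)))"
    by (subst sum.swap) (intro sum.cong refl, simp add: is_moments_sym[OF assms])
  finally show ?thesis unfolding mpair_def by (simp add: sum_distrib_left)
qed

text \<open>Let r be the residual of the differential equation. The choice of \<kappa> kills its
  coefficients 0 and n + 1. Orthogonality kills its pairings at 1..n-1, and the choice of a the one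
  at n. So r lives on 1..n and the Toeplitz matrix forces it to be zero.\<close>

lemma orthogonal_imp_row_ker:
  assumes N: "nonsing n c" and sup: "supported n V" and M: "is_moments s c" and n: "n \<ge> 1"
    and e: "e * e = 1" and V0: "V 0 = 1"
    and u: "\<And>k. 1 \<le> k \<Longrightarrow> k \<le> n \<Longrightarrow> mpair n c V k = 0"
    and \<kappa>: "\<kappa> = - (e / 2) * V n" and a: "a * mpair n c V 0 + e * s * mpair n c V (n + 1) = 0"
  shows "row_ker n e \<kappa> a s V"
proof -
  define r where "r = vrow n e \<kappa> a s V"
  have rel: "V n = - 2 * e * \<kappa>"
  proof -
    have "- 2 * e * \<kappa> = (e * e) * V n" by (simp add: \<kappa>)
    then show ?thesis using e by simp
  qed
  have Vz: "V k = 0" if "k < 0 \<or> n < k" for k using sup that by (auto simp: supported_def)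
  have r_out: "r k = 0" if out: "k < 1 \<or> n < k" for k
  proof -
    consider "k < 0" | "k = 0" | "k = n + 1" | "k > n + 1" using out n by linarith
    then show ?thesis
    proof cases
      case 2
      have "r 0 = \<kappa> * a - (e * e) * \<kappa> * a" using Vz[of "-1"] Vz[of "n + 1"] V0 by (simp add: r_def vrow_def rel)
      then show ?thesis using e 2 by simp
    next
      case 3
      then show ?thesis using Vz[of "n + 1"] Vz[of "-1"] V0 by (simp add: r_def vrow_def rel)
    qed (use Vz in \<open>auto simp: r_def vrow_def\<close>)
  qed
  have "r k = 0" for k
  proof (rule nonsing_shiftD[OF N])
    show "supported n r" "r 0 = 0" using r_out by (auto simp: supported_def)
    fix i assume i: "1 \<le> i" "i \<le> n"
    have "mpair n c r i = (\<Sum>k\<in>{-1..n+2}. r k * c (k - i))"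
      unfolding mpair_def using r_out by (subst (2) pair_superset[of n]) (auto simp: supported_def)
    also have "\<dots> = corow n e \<kappa> a s (mpair n c V) i" unfolding r_def by (rule row_pair[OF sup M])
    also have "\<dots> = 0"
    proof (cases "i = n")
      case True
      have "corow n e \<kappa> a s (mpair n c V) n = s / 2 * mpair n c V (n + 1) + e * (a / 2) * mpair n c V 0"
        using n u[of n] u[of 1] by (simp add: corow_def)
      also have "\<dots> = e / 2 * (a * mpair n c V 0 + e * s * mpair n c V (n + 1)) + (1 - e * e) * (s / 2 * mpair n c V (n + 1))"
        by (simp add: field_simps)
      finally show ?thesis using a e True by simp
    next
      case False
      then show ?thesis using i u[of "i + 1"] u[of i] u[of "n - i"] u[of "n + 1 - i"] by (simp add: corow_def)
    qed
    finally show "mpair n c r i = 0" .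
  qed
  then show ?thesis using sup by (simp add: row_ker_def r_def)
qed

text \<open>For size n + 1: pairing a kernel vector \<open>W\<close> with \<open>V\<close> gives
  \<open>W 0 = 0\<close>, and reversal gives \<open>W n = 0\<close>; then the shift of
  \<open>W\<close> is again in the kernel, so every coefficient can be moved to position 0. Size n
  reduces to this by shifting \<open>W\<close> up and subtracting a multiple of
  \<open>V\<close>.\<close>

lemma nonsing_of_orthogonal:
  assumes sup: "supported n V" and M: "is_moments s c" and n: "n \<ge> 0" and V0: "V 0 = 1"
    and u: "\<And>k. 1 \<le> k \<Longrightarrow> k \<le> n \<Longrightarrow> mpair n c V k = 0" and u0: "mpair n c V 0 \<noteq> 0"
  shows "nonsing (n + 1) c" "nonsing n c"
proof -
  define ker where "ker W \<longleftrightarrow> supported n W \<and> (\<forall>i. 0 \<le> i \<and> i \<le> n \<longrightarrow> mpair n c W i = 0)" for W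
  have ker0: "W 0 = 0" if "ker W" for W
  proof -
    have "(\<Sum>i\<in>{0..n}. W i * mpair n c V i) = (\<Sum>i\<in>{0}. W i * mpair n c V i)"
      using n u by (intro sum.mono_neutral_right) auto
    moreover have "(\<Sum>i\<in>{0..n}. V i * mpair n c W i) = 0"
      using that by (intro sum.neutral) (auto simp: ker_def)
    ultimately show ?thesis using mpair_commute[OF M, of W n V] u0 by simp
  qed
  have ker_reflect: "ker (\<lambda>k. W (n - k))" if "ker W" for W
    using that by (auto simp: ker_def mpair_reflect[OF M] supported_reflect)
  have kern: "W n = 0" if "ker W" for W
    using ker0[OF ker_reflect[OF that]] by simp
  have ker_shift: "ker (\<lambda>k. W (k + 1))" if W: "ker W" for W
  proof -
    define W' where "W' = (\<lambda>k. W (k + 1))"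
    have s1: "supported (n - 1) W'" using W ker0[OF W] supported_shift by (simp add: ker_def W'_def)
    have s2: "supported n W'" using s1 by (auto simp: supported_def)
    have p: "mpair n c W' i = mpair n c W (i + 1)" for i
      using mpair_shift[of W n c i, OF ker0[OF W]] mpair_superset[of "n - 1" W' n c i, OF s1] by (simp add: W'_def)
    \<comment> \<open>Only the pairing of the shifted vector at n is unknown. The reversal of
      \<open>V\<close> pairs to zero at 0..n-1 and is used to correct it; the top coefficient, zero
      on the kernel, then shows t = 0.\<close>
    define t where "t = mpair n c W' n / mpair n c V 0"
    define y where "y k = 1 * W' k + (- t) * V (n - k)" for k
    have py: "mpair n c y i = mpair n c W' i - t * mpair n c V (n - i)" for i
      unfolding y_def pair_lin mpair_reflect[OF M] by simp
    have "ker y"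
      unfolding ker_def
    proof (intro conjI allI impI)
      show "supported n y" using s2 sup by (auto simp: supported_def y_def)
      fix i assume i: "0 \<le> i \<and> i \<le> n"
      show "mpair n c y i = 0"
      proof (cases "i = n")
        case True then show ?thesis using u0 by (simp add: py t_def)
      next
        case False then show ?thesis using i W u[of "n - i"] by (simp add: py p ker_def)
      qed
    qed
    then have "y n = 0" by (rule kern)
    moreover have "W' n = 0" using s1 by (simp add: supported_def)
    ultimately have "t = 0" using V0 by (simp add: y_def)
    then have "y = (\<lambda>k. W (k + 1))" by (simp add: fun_eq_iff y_def W'_def)
    then show ?thesis using \<open>ker y\<close> by simp
  qed
  have ker_zero: "W k = 0" if "ker W" for W k
  proof -
    have "\<forall>W. ker W \<longrightarrow> W (int m) = 0" for m
    proof (induction m)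
      case (Suc m)
      show ?case
      proof (intro allI impI)
        fix W assume "ker W"
        then have "W (int m + 1) = 0" using Suc ker_shift by blast
        then show "W (int (Suc m)) = 0" by (simp add: add.commute)
      qed
    qed (use ker0 in auto)
    moreover have "W k = 0" if "k < 0" using \<open>ker W\<close> that by (auto simp: ker_def supported_def)
    ultimately show ?thesis using that by (metis nonneg_int_cases not_less)
  qed
  show "nonsing (n + 1) c"
    unfolding nonsing_def using ker_zero by (auto simp: ker_def)
  show "nonsing n c"
    unfolding nonsing_def
  proof (intro allI impI)
    fix W k assume W: "supported (n - 1) W" "\<forall>i. 0 \<le> i \<and> i < n \<longrightarrow> mpair (n - 1) c W i = 0"
    define W' where "W' = (\<lambda>k. W (k - 1))"
    have W'0: "W' 0 = 0" using W(1) by (simp add: W'_def supported_def)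
    have sW': "supported n W'" using W(1) by (auto simp: W'_def supported_def)
    have p: "mpair n c W' (i + 1) = mpair (n - 1) c W i" for i
      using mpair_shift[of W' n c i, OF W'0] by (simp add: W'_def)
    define t where "t = mpair n c W' 0 / mpair n c V 0"
    define y where "y k = 1 * W' k + (- t) * V k" for k
    have py: "mpair n c y i = mpair n c W' i - t * mpair n c V i" for i
      unfolding y_def pair_lin by simp
    have "ker y"
      unfolding ker_def
    proof (intro conjI allI impI)
      show "supported n y" using sW' sup by (auto simp: supported_def y_def)
      fix i assume i: "0 \<le> i \<and> i \<le> n"
      show "mpair n c y i = 0"
      proof (cases "i = 0")
        case True then show ?thesis using u0 by (simp add: py t_def)
      next
        case False then show ?thesis using i W(2) u[of i] p[of "i - 1"] by (simp add: py)
      qed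
    qed
    then have z: "y j = 0" for j by (rule ker_zero)
    then have "t = 0" using z[of 0] W'0 V0 by (simp add: y_def)
    then show "W k = 0" using z[of "k + 1"] by (simp add: y_def W'_def)
  qed
qed

text \<open>If the pairing at n + 1 vanished too, the condition on a in
  \<open>orthogonal_imp_row_ker\<close> would hold for every a and either sign; a = 0 and sign 1 are
  arbitrary. So \<open>V\<close> would be a kernel vector with vanishing pairings on 0..n, which
  forces c = 0. For n = 0 the vanishing reads c 0 = c 1 = 0.\<close>

lemma orthogonal_next_nonzero:
  assumes N: "nonsing n c" and sup: "supported n V" and M: "is_moments s c" and n: "n \<ge> 0" and s: "s \<noteq> 0"
    and V0: "V 0 = 1" and u: "\<And>k. 0 \<le> k \<Longrightarrow> k \<le> n \<Longrightarrow> mpair n c V k = 0" and c: "c i \<noteq> 0"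
  shows "mpair n c V (n + 1) \<noteq> 0"
proof
  assume z: "mpair n c V (n + 1) = 0"
  show False
  proof (cases "n = 0")
    case True
    then have "c 0 = 0" "c 1 = 0" using u[of 0] z V0 is_momentsD(1)[OF M, of 1] by (auto simp: mpair_def)
    then show False using is_moments_zero_eq[OF M s] c by blast
  next
    case False
    have "row_ker n 1 (- (1 / 2) * V n) 0 s V"
      by (rule orthogonal_imp_row_ker[OF N sup M]) (use False n V0 u z in auto)
    then show False
      using row_ker_orthogonal_imp_zero_is_moments[of n 1 "- (1 / 2) * V n" 0 s V c i] V0 False n s M u c by auto
  qed
qed

text \<open>Padded by a zero, \<open>V\<close> pairs to zero at 0..n but not at n + 1. So it detects
  the last coefficient of a kernel vector of size n + 2 and, after reversal, the first one. What
  remains lives on 1..n and is killed by size n.\<close>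

lemma nonsing_skip:
  assumes N: "nonsing n c" and sup: "supported n V" and M: "is_moments s c" and n: "n \<ge> 0"
    and u: "\<And>k. 0 \<le> k \<Longrightarrow> k \<le> n \<Longrightarrow> mpair n c V k = 0"
    and un: "mpair n c V (n + 1) \<noteq> 0"
  shows "nonsing (n + 2) c"
  unfolding nonsing_def
proof (intro allI impI)
  fix W k assume W0: "supported (n + 2 - 1) W" "\<forall>i. 0 \<le> i \<and> i < n + 2 \<longrightarrow> mpair (n + 2 - 1) c W i = 0"
  have ms: "mpair (n + 1) c V i = mpair n c V i" for i
    by (rule mpair_superset[OF sup]) simp
  have last: "X (n + 1) = 0"
    if X: "\<And>i. 0 \<le> i \<Longrightarrow> i \<le> n + 1 \<Longrightarrow> mpair (n + 1) c X i = 0" for X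
  proof -
    have "(\<Sum>i\<in>{0..n+1}. X i * mpair (n + 1) c V i) = (\<Sum>i\<in>{n+1}. X i * mpair (n + 1) c V i)"
      using n u by (intro sum.mono_neutral_right) (auto simp: ms)
    moreover have "(\<Sum>i\<in>{0..n+1}. V i * mpair (n + 1) c X i) = 0"
      using X by (intro sum.neutral) auto
    ultimately show ?thesis using mpair_commute[OF M, of X "n + 1" V] un by (simp add: ms)
  qed
  have W: "supported (n + 1) W" "\<And>i. 0 \<le> i \<Longrightarrow> i \<le> n + 1 \<Longrightarrow> mpair (n + 1) c W i = 0"
    using W0 by (auto simp: algebra_simps)
  have Wn: "W (n + 1) = 0" by (rule last) (use W in auto)
  have "W (n + 1 - (n + 1)) = 0"
    by (rule last[of "\<lambda>k. W (n + 1 - k)"]) (use W in \<open>auto simp: mpair_reflect[OF M]\<close>)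
  then have W00: "W 0 = 0" by simp
  have sW: "supported n W"
    unfolding supported_def
  proof (intro allI impI)
    fix k assume "k < 0 \<or> n < k"
    then consider "k < 0" | "k = n + 1" | "n + 1 < k" by linarith
    then show "W k = 0" using W(1) Wn by cases (auto simp: supported_def)
  qed
  show "W k = 0"
    by (rule nonsing_shiftD[OF N sW W00]) (use W(2) mpair_superset[OF sW, of "n + 1" c] in auto)
qed

section \<open>Toeplitz determinants\<close>

definition fdet :: "nat \<Rightarrow> (nat \<Rightarrow> nat \<Rightarrow> complex) \<Rightarrow> complex" where
  "fdet n f = Determinant.det (Matrix.mat n n (\<lambda>(i, j). f i j))"

definition fcof :: "nat \<Rightarrow> (nat \<Rightarrow> nat \<Rightarrow> complex) \<Rightarrow> nat \<Rightarrow> nat \<Rightarrow> complex" where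
  "fcof n f i k = (-1) ^ (i + k) * fdet (n - 1) (\<lambda>a b. f (if a < i then a else Suc a) (if b < k then b else Suc b))"

lemma fdet_expand:
  "fdet n f = (\<Sum>p\<in>{p. p permutes {0..<n}}. signof p * (\<Prod>i = 0..<n. f i (p i)))"
proof -
  have "fdet n f = (\<Sum>p\<in>{p. p permutes {0..<n}}. signof p * (\<Prod>i = 0..<n. Matrix.mat n n (\<lambda>(i, j). f i j) $$ (i, p i)))"
    unfolding fdet_def by (rule det_def') simp
  also have "\<dots> = (\<Sum>p\<in>{p. p permutes {0..<n}}. signof p * (\<Prod>i = 0..<n. f i (p i)))"
    by (intro sum.cong refl arg_cong2[of _ _ _ _ "(*)"] prod.cong) auto
  finally show ?thesis .
qed

lemma fdet_cong: "(\<And>i j. i < n \<Longrightarrow> j < n \<Longrightarrow> f i j = g i j) \<Longrightarrow> fdet n f = fdet n g"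
  unfolding fdet_def by (intro arg_cong[of _ _ Determinant.det] eq_matI) auto

lemma mult_vec_index:
  "i < n \<Longrightarrow> vec_index (Matrix.mat n n (\<lambda>(i, j). f i j) *\<^sub>v Matrix.vec n x) i = (\<Sum>k<n. f i k * (x k :: complex))"
  by (simp add: scalar_prod_def atLeast0LessThan)

lemma fdet_eq_0_iff:
  "fdet n f = 0 \<longleftrightarrow> (\<exists>w. (\<exists>k<n. w k \<noteq> 0) \<and> (\<forall>i<n. (\<Sum>k<n. f i k * w k) = 0))"
proof -
  let ?A = "Matrix.mat n n (\<lambda>(i, j). f i j)"
  have "fdet n f = 0 \<longleftrightarrow> (\<exists>v. v \<in> carrier_vec n \<and> v \<noteq> 0\<^sub>v n \<and> ?A *\<^sub>v v = 0\<^sub>v n)"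
    unfolding fdet_def by (rule det_0_iff_vec_prod_zero) simp
  also have "\<dots> \<longleftrightarrow> (\<exists>w. (\<exists>k<n. w k \<noteq> 0) \<and> (\<forall>i<n. (\<Sum>k<n. f i k * w k) = 0))"
  proof
    assume "\<exists>v. v \<in> carrier_vec n \<and> v \<noteq> 0\<^sub>v n \<and> ?A *\<^sub>v v = 0\<^sub>v n"
    then obtain v where v: "v \<in> carrier_vec n" "v \<noteq> 0\<^sub>v n" "?A *\<^sub>v v = 0\<^sub>v n" by blast
    have ve: "Matrix.vec n (\<lambda>k. vec_index v k) = v" using v(1) by auto
    have "\<exists>k<n. vec_index v k \<noteq> 0" using v(1,2) by (metis carrier_vecD eq_vecI index_zero_vec)
    moreover have "(\<Sum>k<n. f i k * vec_index v k) = 0" if "i < n" for i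
      using mult_vec_index[OF that, of f "\<lambda>k. vec_index v k"] that v(3) by (simp add: ve)
    ultimately show "\<exists>w. (\<exists>k<n. w k \<noteq> 0) \<and> (\<forall>i<n. (\<Sum>k<n. f i k * w k) = 0)"
      by (intro exI[of _ "\<lambda>k. vec_index v k"]) auto
  next
    assume "\<exists>w. (\<exists>k<n. w k \<noteq> 0) \<and> (\<forall>i<n. (\<Sum>k<n. f i k * w k) = 0)"
    then obtain w where w: "\<exists>k<n. w k \<noteq> 0" "\<forall>i<n. (\<Sum>k<n. f i k * w k) = 0" by blast
    have "Matrix.vec n w \<noteq> 0\<^sub>v n" using w(1) by (metis index_vec index_zero_vec(1))
    moreover have "?A *\<^sub>v Matrix.vec n w = 0\<^sub>v n"
      by (intro eq_vecI) (use w(2) in \<open>simp_all only: mult_vec_index index_zero_vec dim_mult_mat_vec dim_row_mat\<close>)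
    ultimately show "\<exists>v. v \<in> carrier_vec n \<and> v \<noteq> 0\<^sub>v n \<and> ?A *\<^sub>v v = 0\<^sub>v n"
      by (intro exI[of _ "Matrix.vec n w"]) auto
  qed
  finally show ?thesis .
qed

lemma fdet_replace_col:
  assumes "k < n"
  shows "fdet n (\<lambda>i j. if j = k then (\<Sum>m<n. f i m * x m) else f i j) = x k * fdet n f"
proof -
  let ?A = "Matrix.mat n n (\<lambda>(i, j). f i j)"
  have "Determinant.det (replace_col ?A (?A *\<^sub>v Matrix.vec n x) k) = vec_index (Matrix.vec n x) k * Determinant.det ?A"
    by (rule cramer_lemma_mat) (use assms in auto)
  moreover have "replace_col ?A (?A *\<^sub>v Matrix.vec n x) k
      = Matrix.mat n n (\<lambda>(i, j). if j = k then (\<Sum>m<n. f i m * x m) else f i j)"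
    by (rule eq_matI) (simp_all only: replace_col_def index_mat dim_row_mat dim_col_mat prod.case mult_vec_index)
  ultimately show ?thesis using assms by (simp add: fdet_def)
qed

lemma cofactor_mat: "i < n \<Longrightarrow> k < n \<Longrightarrow> cofactor (Matrix.mat n n (\<lambda>(i, j). f i j)) i k = fcof n f i k"
  unfolding cofactor_def fcof_def fdet_def mat_delete_def
  by (intro arg_cong2[of _ _ _ _ "(*)"] refl arg_cong[of _ _ Determinant.det] eq_matI) auto

lemma fdet_laplace:
  assumes "k < n"
  shows "fdet n (\<lambda>i j. if j = k then y i else f i j) = (\<Sum>i<n. y i * fcof n f i k)"
proof -
  let ?g = "\<lambda>i j. if j = k then y i else f i j"
  have "fdet n ?g = (\<Sum>i<n. Matrix.mat n n (\<lambda>(i, j). ?g i j) $$ (i, k) * cofactor (Matrix.mat n n (\<lambda>(i, j). ?g i j)) i k)"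
    unfolding fdet_def by (rule laplace_expansion_column) (use assms in auto)
  also have "\<dots> = (\<Sum>i<n. y i * fcof n ?g i k)"
    using assms by (intro sum.cong refl) (simp add: cofactor_mat)
  also have "\<dots> = (\<Sum>i<n. y i * fcof n f i k)"
    unfolding fcof_def by (intro sum.cong refl arg_cong2[of _ _ _ _ "(*)"] fdet_cong) auto
  finally show ?thesis .
qed

text \<open>Product with the adjugate, for an arbitrary right-hand side y. A nonzero determinant
  makes it the solution of a linear system; a zero determinant makes it a kernel vector that is
  polynomial in the entries.\<close>

lemma fdet_adj:
  assumes i: "i < n"
  shows "(\<Sum>k<n. f i k * (\<Sum>j<n. y j * fcof n f j k)) = y i * fdet n f"
proof -
  let ?A = "Matrix.mat n n (\<lambda>(i, j). f i j)"
  have A: "?A \<in> carrier_mat n n" by simp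
  have c: "(\<Sum>k<n. f i k * fcof n f j k) = (if i = j then fdet n f else 0)" if j: "j < n" for j
  proof -
    have "(?A * adj_mat ?A) $$ (i, j) = (Determinant.det ?A \<cdot>\<^sub>m 1\<^sub>m n) $$ (i, j)"
      using adj_mat(2)[OF A] by simp
    moreover have "(?A * adj_mat ?A) $$ (i, j) = (\<Sum>k<n. f i k * fcof n f j k)"
      using i j by (simp add: scalar_prod_def adj_mat_def atLeast0LessThan cofactor_mat)
    ultimately show ?thesis using i j by (simp add: fdet_def)
  qed
  have "(\<Sum>k<n. f i k * (\<Sum>j<n. y j * fcof n f j k)) = (\<Sum>k<n. \<Sum>j<n. y j * (f i k * fcof n f j k))"
    by (simp add: sum_distrib_left algebra_simps)
  also have "\<dots> = (\<Sum>j<n. y j * (\<Sum>k<n. f i k * fcof n f j k))"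
    by (subst sum.swap) (simp add: sum_distrib_left)
  also have "\<dots> = (\<Sum>j<n. if i = j then y j * fdet n f else 0)"
    by (intro sum.cong refl) (simp add: c)
  finally show ?thesis using i by simp
qed

text \<open>The moment relation solved for its highest term. The two initial values, not Bessel
  functions, serve as coordinates, so each moment is linear in them and polynomial in 1 / s.\<close>

fun moment_nat :: "complex \<Rightarrow> complex \<times> complex \<Rightarrow> nat \<Rightarrow> complex" where
  "moment_nat s c 0 = fst c"
| "moment_nat s c (Suc 0) = snd c"
| "moment_nat s c (Suc (Suc k)) = moment_nat s c k + 2 * of_nat (Suc k) / s * moment_nat s c (Suc k)"

definition moment :: "complex \<Rightarrow> complex \<times> complex \<Rightarrow> int \<Rightarrow> complex" where
  "moment s c k = moment_nat s c (nat \<bar>k\<bar>)"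

lemma moment_simps [simp]: "moment s c 0 = fst c" "moment s c 1 = snd c"
  by (simp_all add: moment_def)

lemma is_moments_moment:
  assumes "s \<noteq> 0"
  shows "is_moments s (moment s c)"
proof -
  have sym: "moment s c (- k) = moment s c k" for k by (simp add: moment_def)
  have pos: "of_int (int m) * moment s c (int m) = s / 2 * (moment s c (int m + 1) - moment s c (int m - 1))" for m
  proof (cases m)
    case 0 then show ?thesis using sym[of 1] by simp
  next
    case (Suc k)
    have "nat \<bar>int m + 1\<bar> = Suc (Suc k)" "nat \<bar>int m - 1\<bar> = k" "nat \<bar>int m\<bar> = Suc k" using Suc by auto
    then have "moment s c (int m + 1) - moment s c (int m - 1) = 2 * of_nat m / s * moment s c (int m)"
      unfolding moment_def by (simp only: moment_nat.simps Suc) simp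
    then show ?thesis using assms by simp
  qed
  have "of_int k * moment s c k = s / 2 * (moment s c (k + 1) - moment s c (k - 1))" for k
  proof (cases "k \<ge> 0")
    case True then show ?thesis using pos[of "nat k"] by simp
  next
    case False
    then have "of_int (- k) * moment s c (- k) = s / 2 * (moment s c (- k + 1) - moment s c (- k - 1))"
      using pos[of "nat (- k)"] by simp
    moreover have "moment s c (- k + 1) = moment s c (k - 1)" "moment s c (- k - 1) = moment s c (k + 1)"
      using sym[of "k - 1"] sym[of "k + 1"] by simp_all
    ultimately show ?thesis by (simp add: sym algebra_simps)
  qed
  then show ?thesis using sym by (simp add: is_moments_def)
qed

lemma moment_nat_linear: "moment_nat s (x, y) k = x * moment_nat s (1, 0) k + y * moment_nat s (0, 1) k"
  by (induction s "(x, y)" k rule: moment_nat.induct) (simp_all add: algebra_simps)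

lemma moment_linear: "moment s (x, y) k = x * moment s (1, 0) k + y * moment s (0, 1) k"
  unfolding moment_def by (rule moment_nat_linear)

lemma moment_eq_0_iff: "(\<forall>k. moment s c k = 0) \<longleftrightarrow> c = (0, 0)"
proof
  assume "\<forall>k. moment s c k = 0"
  then have "moment s c 0 = 0" "moment s c 1 = 0" by blast+
  then show "c = (0, 0)" by (cases c) simp
qed (simp add: moment_linear[of s 0 0])

text \<open>\<open>toep_num\<close> is, up to sign, the Cramer numerator of the last coefficient of the orthogonal polynomial.\<close>

definition toep :: "nat \<Rightarrow> complex \<Rightarrow> complex \<times> complex \<Rightarrow> complex" where
  "toep n s c = fdet n (\<lambda>i j. moment s c (int j - int i))"

definition toep_num :: "nat \<Rightarrow> complex \<Rightarrow> complex \<times> complex \<Rightarrow> complex" where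
  "toep_num n s c = fdet n (\<lambda>i j. if j = n - 1 then moment s c (int i + 1) else moment s c (int j - int i))"

lemma sum_int_lessThan: "(\<Sum>k\<in>{0..int n - 1}. f k) = (\<Sum>k<n. f (int k))"
  by (rule sum.reindex_bij_witness[of _ int nat]) auto

lemma mpair_nat: "mpair (int n - 1) c W i = (\<Sum>k<n. W (int k) * c (int k - i))"
  unfolding mpair_def by (rule sum_int_lessThan)

definition ext0 :: "nat \<Rightarrow> (nat \<Rightarrow> complex) \<Rightarrow> int \<Rightarrow> complex" where
  "ext0 n w k = (if 0 \<le> k \<and> k < int n then w (nat k) else 0)"

lemma ext0_int [simp]: "k < n \<Longrightarrow> ext0 n w (int k) = w k"
  by (simp add: ext0_def)

lemma supported_ext0: "supported (int n - 1) (ext0 n w)"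
  by (auto simp: supported_def ext0_def)

lemma toep_nonzero_iff: "toep n s c \<noteq> 0 \<longleftrightarrow> nonsing (int n) (moment s c)"
proof
  assume d: "toep n s c \<noteq> 0"
  show "nonsing (int n) (moment s c)"
    unfolding nonsing_def
  proof (intro allI impI)
    fix W k assume W: "supported (int n - 1) W" "\<forall>i. 0 \<le> i \<and> i < int n \<longrightarrow> mpair (int n - 1) (moment s c) W i = 0"
    have z: "\<forall>i<n. (\<Sum>k<n. moment s c (int k - int i) * W (int k)) = 0"
    proof (intro allI impI)
      fix i assume "i < n"
      then have "mpair (int n - 1) (moment s c) W (int i) = 0" using W(2) by simp
      then show "(\<Sum>k<n. moment s c (int k - int i) * W (int k)) = 0" by (simp only: mpair_nat mult.commute)
    qed
    have wz: "W (int k) = 0" if "k < n" for k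
    proof (rule ccontr)
      assume "W (int k) \<noteq> 0"
      then have "toep n s c = 0"
        unfolding toep_def fdet_eq_0_iff using z that by (intro exI[of _ "\<lambda>k. W (int k)"]) auto
      then show False using d by simp
    qed
    have "W k = 0" if "0 \<le> k" "k < int n" using wz[of "nat k"] that by simp
    then show "W k = 0" using W(1) by (cases "0 \<le> k \<and> k < int n") (auto simp: supported_def)
  qed
next
  assume N: "nonsing (int n) (moment s c)"
  show "toep n s c \<noteq> 0"
  proof
    assume "toep n s c = 0"
    then obtain w where w: "\<exists>k<n. w k \<noteq> 0" "\<forall>i<n. (\<Sum>k<n. moment s c (int k - int i) * w k) = 0"
      unfolding toep_def fdet_eq_0_iff by blast
    have "ext0 n w k = 0" for k
    proof (rule nonsingD[OF N supported_ext0])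
      fix i assume i: "0 \<le> i" "i < int n"
      have "mpair (int n - 1) (moment s c) (ext0 n w) i = (\<Sum>k<n. moment s c (int k - int (nat i)) * w k)"
        unfolding mpair_nat using i by (intro sum.cong refl) (simp add: mult.commute)
      then show "mpair (int n - 1) (moment s c) (ext0 n w) i = 0" using spec[OF w(2), of "nat i"] i by simp
    qed
    then show False using w(1) by (metis ext0_int)
  qed
qed

lemma mpair_split:
  "mpair (int n) c V j = V 0 * c (- j) + (\<Sum>k<n. V (int k + 1) * c (int k + 1 - j))"
proof -
  have "mpair (int n) c V j = (\<Sum>k<Suc n. V (int k) * c (int k - j))"
    using mpair_nat[of "Suc n" c V j] by simp
  then show ?thesis by (simp only: sum.lessThan_Suc_shift) (simp add: add.commute)
qed

lemma ex_orthogonal: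
  assumes "toep n s c \<noteq> 0" "s \<noteq> 0"
  obtains V where "supported (int n) V" "V 0 = 1" "\<And>k. 1 \<le> k \<Longrightarrow> k \<le> int n \<Longrightarrow> mpair (int n) (moment s c) V k = 0"
proof -
  let ?f = "\<lambda>i j. moment s c (int j - int i)"
  \<comment> \<open>With \<open>V 0 = 1\<close>, orthogonality at i + 1 is row i of a Toeplitz
    system for the other coefficients of \<open>V\<close>; y is its right-hand side.\<close>
  define y where "y i = - moment s c (int i + 1)" for i
  define x where "x k = (\<Sum>j<n. y j * fcof n ?f j k) / toep n s c" for k
  have x: "(\<Sum>k<n. ?f i k * x k) = y i" if "i < n" for i
    using fdet_adj[OF that, of ?f y] assms(1)
    by (simp add: x_def sum_divide_distrib[symmetric] toep_def)
  define V where "V k = (if k = 0 then 1 else ext0 n x (k - 1))" for k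
  have "supported (int n) V" by (auto simp: V_def ext0_def supported_def)
  moreover have "mpair (int n) (moment s c) V k = 0" if k: "1 \<le> k" "k \<le> int n" for k
  proof -
    have "(\<Sum>m<n. V (int m + 1) * moment s c (int m + 1 - k)) = (\<Sum>m<n. ?f (nat (k - 1)) m * x m)"
      using k by (intro sum.cong refl) (auto simp: V_def mult.commute algebra_simps)
    also have "\<dots> = y (nat (k - 1))" by (rule x) (use k in auto)
    finally show ?thesis using k is_momentsD(1)[OF is_moments_moment[OF assms(2)]]
      by (simp add: mpair_split) (simp add: V_def y_def)
  qed
  ultimately show ?thesis using that[of V] by (simp add: V_def)
qed

lemma toep_num_eq:
  assumes s: "s \<noteq> 0" and n: "n \<ge> 1" and V0: "V 0 = 1"
    and u: "\<And>k. 1 \<le> k \<Longrightarrow> k \<le> int n \<Longrightarrow> mpair (int n) (moment s c) V k = 0"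
  shows "toep_num n s c = - V (int n) * toep n s c"
proof -
  let ?f = "\<lambda>i j. moment s c (int j - int i)"
  have x: "(\<Sum>m<n. ?f i m * (- V (int m + 1))) = moment s c (int i + 1)" if "i < n" for i
  proof -
    have "V 0 * moment s c (- (int i + 1)) + (\<Sum>k<n. V (int k + 1) * moment s c (int k + 1 - (int i + 1))) = 0"
      using u[of "int i + 1"] that by (simp only: mpair_split)
    then show ?thesis using V0 is_momentsD(1)[OF is_moments_moment[OF s], of c "int i + 1"]
      by (simp add: sum_negf mult.commute add_eq_0_iff)
  qed
  have "toep_num n s c = fdet n (\<lambda>i j. if j = n - 1 then (\<Sum>m<n. ?f i m * (- V (int m + 1))) else ?f i j)"
    unfolding toep_num_def by (rule fdet_cong) (simp only: x split: if_splits)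
  also have "\<dots> = - V (int (n - 1) + 1) * fdet n ?f" by (rule fdet_replace_col) (use n in auto)
  finally show ?thesis using n by (simp add: toep_def of_nat_diff)
qed

text \<open>Szego's recursion: \<open>V\<close> minus t times its reversal in degree n + 1 is
  orthogonal at 1..n+1 and keeps the constant term 1. Its last coefficient is - t, to which
  \<open>toep_num_eq\<close> applies.\<close>

lemma orthogonal_ratio:
  assumes s: "s \<noteq> 0" and sup: "supported (int n) V" and V0: "V 0 = 1"
    and u: "\<And>k. 1 \<le> k \<Longrightarrow> k \<le> int n \<Longrightarrow> mpair (int n) (moment s c) V k = 0"
    and u0: "mpair (int n) (moment s c) V 0 \<noteq> 0"
  shows "toep_num (n + 1) s c = mpair (int n) (moment s c) V (int n + 1) / mpair (int n) (moment s c) V 0 * toep (n + 1) s c"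
proof -
  let ?c = "moment s c"
  note M = is_moments_moment[OF s, of c]
  define t where "t = mpair (int n) ?c V (int n + 1) / mpair (int n) ?c V 0"
  define V' where "V' k = 1 * V k + (- t) * V (int n + 1 - k)" for k
  have ms: "mpair (int n + 1) ?c V i = mpair (int n) ?c V i" for i
    by (rule mpair_superset[OF sup]) simp
  have p: "mpair (int n + 1) ?c V' k = mpair (int n) ?c V k - t * mpair (int n) ?c V (int n + 1 - k)" for k
    unfolding V'_def pair_lin mpair_reflect[OF M] ms by simp
  have Vo: "V (int n + 1) = 0" using sup by (simp add: supported_def)
  have "toep_num (n + 1) s c = - V' (int (n + 1)) * toep (n + 1) s c"
  proof (rule toep_num_eq[OF s])
    show "V' 0 = 1" using Vo by (simp add: V'_def V0 add.commute)
    fix k assume k: "1 \<le> k" "k \<le> int (n + 1)"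
    have "mpair (int n + 1) ?c V' k = 0"
    proof (cases "k = int n + 1")
      case True then show ?thesis using u0 by (simp add: p t_def)
    next
      case False then show ?thesis using k u[of k] u[of "int n + 1 - k"] by (simp add: p)
    qed
    then show "mpair (int (n + 1)) ?c V' k = 0" by (simp add: add.commute)
  qed simp
  moreover have "V' (int (n + 1)) = - t" using Vo by (simp add: V'_def V0 add.commute)
  ultimately show ?thesis by (simp add: t_def)
qed

lemma toep_0 [simp]: "toep 0 s c = 1"
  by (simp add: toep_def fdet_def)

lemma toep_1: "toep 1 s c = fst c"
  by (simp add: toep_def fdet_def det_single)

text \<open>The pairings of the orthogonal polynomial \<open>V\<close> vanish on 0..n but not at n +
  1, the situation of \<open>nonsing_skip\<close>. A null vector for \<open>toep_num\<close> becomes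
  a sequence orthogonal at 1..n+1; it is a multiple of \<open>V\<close>, and the pairing at n + 1
  makes the multiple zero.\<close>

lemma toep_step:
  assumes s: "s \<noteq> 0" and c: "c \<noteq> (0, 0)" and D: "toep n s c \<noteq> 0" "toep (n + 1) s c = 0"
  shows "toep (n + 2) s c \<noteq> 0" "toep_num (n + 1) s c \<noteq> 0"
proof -
  let ?c = "moment s c"
  note M = is_moments_moment[OF s, of c]
  have N: "nonsing (int n) ?c" using D(1) by (simp add: toep_nonzero_iff)
  obtain V where V: "supported (int n) V" "V 0 = 1" "\<And>k. 1 \<le> k \<Longrightarrow> k \<le> int n \<Longrightarrow> mpair (int n) ?c V k = 0"
    using ex_orthogonal[OF D(1) s] by blast
  have u0: "mpair (int n) ?c V 0 = 0"
  proof (rule ccontr)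
    assume "mpair (int n) ?c V 0 \<noteq> 0"
    then have "nonsing (int n + 1) ?c" by (intro nonsing_of_orthogonal(1)[OF V(1) M _ V(2) V(3)]) auto
    then have "toep (n + 1) s c \<noteq> 0" by (simp only: toep_nonzero_iff) (simp add: add.commute)
    then show False using D(2) by simp
  qed
  have u: "mpair (int n) ?c V k = 0" if "0 \<le> k" "k \<le> int n" for k
    using V(3) u0 that by (cases "k = 0") auto
  obtain i where i: "?c i \<noteq> 0" using c moment_eq_0_iff[of s c] by blast
  have un: "mpair (int n) ?c V (int n + 1) \<noteq> 0"
    by (rule orthogonal_next_nonzero[OF N V(1) M _ s V(2) u i]) auto
  have "nonsing (int n + 2) ?c" by (rule nonsing_skip[OF N V(1) M _ u un]) auto
  then show "toep (n + 2) s c \<noteq> 0" by (simp only: toep_nonzero_iff) (simp add: add.commute)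
  show "toep_num (n + 1) s c \<noteq> 0"
  proof
    assume "toep_num (n + 1) s c = 0"
    then obtain w where w: "\<exists>k<n+1. w k \<noteq> 0"
      "\<And>i. i < n + 1 \<Longrightarrow> (\<Sum>k<n+1. (if k = n + 1 - 1 then ?c (int i + 1) else ?c (int k - int i)) * w k) = 0"
      unfolding toep_num_def fdet_eq_0_iff by blast
    have w': "(\<Sum>k<n. ?c (int k - int i) * w k) + ?c (int i + 1) * w n = 0" if "i \<le> n" for i
      using w(2)[of i] that by simp
    \<comment> \<open>The shifted last column is c (i + 1) = c (0 - (i + 1)), the column of index 0
      in the pairing at i + 1; its unknown therefore becomes \<open>W 0\<close>.\<close>
    define W where "W k = (if k = 0 then w n else ext0 n w (k - 1))" for k
    have sW: "supported (int n) W" by (auto simp: W_def ext0_def supported_def)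
    have pW: "mpair (int n) ?c W (int i + 1) = 0" if "i \<le> n" for i
    proof -
      have "(\<Sum>m<n. W (int m + 1) * ?c (int m + 1 - (int i + 1))) = (\<Sum>m<n. ?c (int m - int i) * w m)"
        by (intro sum.cong refl) (auto simp: W_def mult.commute)
      then show ?thesis using w'[OF that] is_momentsD(1)[OF M, of "int i + 1"]
        by (simp only: mpair_split) (simp add: W_def mult.commute add.commute)
    qed
    have pW': "mpair (int n) ?c W i = 0" if "1 \<le> i" "i \<le> int n + 1" for i
      using pW[of "nat (i - 1)"] that by simp
    define y where "y k = 1 * W k + (- W 0) * V k" for k
    have py: "mpair (int n) ?c y i = mpair (int n) ?c W i - W 0 * mpair (int n) ?c V i" for i
      unfolding y_def pair_lin by simp
    have y0: "y k = 0" for k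
    proof (rule nonsing_shiftD[OF N])
      show "supported (int n) y" using sW V(1) by (auto simp: supported_def y_def)
      show "y 0 = 0" using V(2) by (simp add: y_def)
    qed (use V(3) pW' in \<open>auto simp: py\<close>)
    have "mpair (int n) ?c y (int n + 1) = 0" using y0 by (simp add: mpair_def)
    then have "W 0 = 0" using un pW'[of "int n + 1"] by (simp add: py)
    then have "W k = 0" for k using y0[of k] by (simp add: y_def)
    then have "W 0 = 0" "W (int k + 1) = 0" for k by auto
    then have "w n = 0" and e: "ext0 n w (int k) = 0" for k by (auto simp: W_def)
    moreover have "w k = 0" if "k < n" for k using e[of k] that by simp
    ultimately have "w k = 0" if "k < n + 1" for k using that by (cases "k = n") auto
    then show False using w(1) by blast
  qed
qed

section \<open>The matrix of the surface\<close>

definition G_entry :: "nat \<Rightarrow> complex \<Rightarrow> c3 \<Rightarrow> nat \<Rightarrow> nat \<Rightarrow> complex" where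
  "G_entry l e p i k = G1_entry l p (i + 1) (k + 1) + e * G2_entry l p (i + 1) (k + 1)"

lemma detP_eq: "detP l e p = fdet (l + 1) (G_entry l e p)"
  unfolding detP_def fdet_def G1_def G2_def G_entry_def
  by (intro arg_cong[of _ _ Determinant.det] eq_matI) auto

text \<open>A sum of indicator terms, because the diagonal bands of \<open>G1_entry\<close> and the
  antidiagonal bands of \<open>G2_entry\<close> may cross, and there the entries add.\<close>

lemma G_entry_split:
  assumes "i < l"
  shows "G_entry l e (\<kappa>, a, s) i k * v = (if k = i then s / 2 * v else 0) + (if k = i + 1 then (\<kappa> * a - of_nat (i + 1)) * v else 0)
    + (if k = l - 1 - i then e * (a / 2) * v else 0) + (if k = l - i then e * \<kappa> * s * v else 0)"
proof -
  have k: "k + 1 = l + 1 - (i + 1) \<longleftrightarrow> k = l - 1 - i" "k + 1 = l + 2 - (i + 1) \<longleftrightarrow> k = l - i" using assms by auto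
  have G1: "G1_entry l (\<kappa>, a, s) (i + 1) (k + 1)
      = (if k = i then s / 2 else 0) + (if k = i + 1 then \<kappa> * a - of_nat (i + 1) else 0)"
    using assms by (simp add: G1_entry_def)
  have G2: "G2_entry l (\<kappa>, a, s) (i + 1) (k + 1)
      = (if k = l - 1 - i then a / 2 else 0) + (if k = l - i then \<kappa> * s else 0)"
    using assms unfolding G2_entry_def prod.case k by auto
  show ?thesis unfolding G_entry_def G1 G2 by (simp add: algebra_simps)
qed

lemma G_entry_last: "G_entry l e (\<kappa>, a, s) l k * v = (if k = l then v / 2 else 0) + (if k = 0 then e * \<kappa> * v else 0)"
  by (auto simp: G_entry_def G1_entry_def G2_entry_def algebra_simps)

lemma G_entry_sum:
  assumes "i < l"
  shows "(\<Sum>k<l+1. G_entry l e (\<kappa>, a, s) i k * V (int k)) = vrow (int l) e \<kappa> a s V (int i + 1)"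
proof -
  have "int (l - 1 - i) = int l - (int i + 1)" "int (l - i) = int l - int i" using assms by auto
  then show ?thesis
    using assms unfolding G_entry_split[OF assms]
    by (simp add: sum.distrib sum.delta vrow_def add.commute del: sum.lessThan_Suc of_nat_diff)
qed

lemma G_entry_sum_last:
  "(\<Sum>k<l+1. G_entry l e (\<kappa>, a, s) l k * V (int k)) = V (int l) / 2 + e * \<kappa> * V 0"
  unfolding G_entry_last by (simp add: sum.distrib sum.delta del: sum.lessThan_Suc)

text \<open>The matrix has the rows \<open>vrow\<close> 1..l and a last row V l / 2 + e \<kappa> V
  0. The outer equations come from that last row: \<open>vrow\<close> at l + 1 is s times it, which
  can be undone, and \<open>vrow\<close> at 0 is e a times it, because of
  \<open>e * e = 1\<close>.\<close>

lemma row_ker_iff: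
  assumes sup: "supported (int l) V" and e: "e * e = 1" and s: "s \<noteq> 0" and l: "l \<ge> 1"
  shows "row_ker (int l) e \<kappa> a s V \<longleftrightarrow> (\<forall>i<l+1. (\<Sum>k<l+1. G_entry l e (\<kappa>, a, s) i k * V (int k)) = 0)"
proof
  assume K: "row_ker (int l) e \<kappa> a s V"
  then have R: "vrow (int l) e \<kappa> a s V j = 0" for j by (simp add: row_ker_def)
  have Vz: "V (int l + 1) = 0" "V (-1) = 0" using sup by (auto simp: supported_def)
  have "s * (V (int l) / 2 + e * \<kappa> * V 0) = 0"
    using R[of "int l + 1"] Vz by (simp add: vrow_def algebra_simps)
  then have "V (int l) / 2 + e * \<kappa> * V 0 = 0" using s by simp
  then show "\<forall>i<l+1. (\<Sum>k<l+1. G_entry l e (\<kappa>, a, s) i k * V (int k)) = 0"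
    using R G_entry_sum G_entry_sum_last by (metis Suc_eq_plus1 less_SucE)
next
  assume Z: "\<forall>i<l+1. (\<Sum>k<l+1. G_entry l e (\<kappa>, a, s) i k * V (int k)) = 0"
  have last: "V (int l) / 2 + e * \<kappa> * V 0 = 0" using Z G_entry_sum_last[of l e \<kappa> a s V] by auto
  have mid: "vrow (int l) e \<kappa> a s V j = 0" if "1 \<le> j" "j \<le> int l" for j
    using Z G_entry_sum[of "nat (j - 1)" l e \<kappa> a s V] that by auto
  have Vz: "V k = 0" if "k < 0 \<or> int l < k" for k using sup that by (auto simp: supported_def)
  have "vrow (int l) e \<kappa> a s V j = 0" for j
  proof -
    consider "j < 0" | "j = 0" | "1 \<le> j" "j \<le> int l" | "j = int l + 1" | "j > int l + 1" by linarith
    then show ?thesis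
    proof cases
      case 2
      have "vrow (int l) e \<kappa> a s V 0 = e * a * (V (int l) / 2 + e * \<kappa> * V 0) + (1 - e * e) * \<kappa> * a * V 0"
        using Vz[of "-1"] Vz[of "int l + 1"] by (simp add: vrow_def algebra_simps)
      then show ?thesis using last e 2 by simp
    next
      case 4
      have "vrow (int l) e \<kappa> a s V (int l + 1) = s * (V (int l) / 2 + e * \<kappa> * V 0)"
        using Vz[of "-1"] Vz[of "int l + 1"] by (simp add: vrow_def algebra_simps)
      then show ?thesis using last 4 by simp
    qed (use mid Vz in \<open>auto simp: vrow_def\<close>)
  qed
  then show "row_ker (int l) e \<kappa> a s V" using sup by (simp add: row_ker_def)
qed

lemma row_ker_scale:
  assumes "row_ker n e \<kappa> a s V"
  shows "row_ker n e \<kappa> a s (\<lambda>k. x * V k)"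
proof -
  have "vrow n e \<kappa> a s (\<lambda>k. x * V k) j = x * vrow n e \<kappa> a s V j" for j
    by (simp add: vrow_def algebra_simps)
  then show ?thesis using assms by (auto simp: row_ker_def supported_def)
qed

lemma detP_zero_iff:
  assumes e: "e * e = 1" and s: "s \<noteq> 0" and l: "l \<ge> 1"
  shows "detP l e (\<kappa>, a, s) = 0 \<longleftrightarrow> (\<exists>V. row_ker (int l) e \<kappa> a s V \<and> V 0 = 1)"
proof
  assume "detP l e (\<kappa>, a, s) = 0"
  then obtain w where w: "\<exists>k<l+1. w k \<noteq> 0" "\<forall>i<l+1. (\<Sum>k<l+1. G_entry l e (\<kappa>, a, s) i k * w k) = 0"
    unfolding detP_eq fdet_eq_0_iff by blast
  define V where "V = ext0 (l + 1) w"
  have sup: "supported (int l) V" using supported_ext0[of "l + 1" w] by (simp add: V_def)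
  have Vw: "V (int k) = w k" if "k < l + 1" for k using that by (simp add: V_def del: of_nat_Suc)
  have K: "row_ker (int l) e \<kappa> a s V"
    unfolding row_ker_iff[OF sup e s l]
  proof (intro allI impI)
    fix i assume i: "i < l + 1"
    have "(\<Sum>k<l+1. G_entry l e (\<kappa>, a, s) i k * V (int k)) = (\<Sum>k<l+1. G_entry l e (\<kappa>, a, s) i k * w k)"
      by (intro sum.cong refl) (simp add: Vw)
    then show "(\<Sum>k<l+1. G_entry l e (\<kappa>, a, s) i k * V (int k)) = 0" using w(2) i by simp
  qed
  have "V 0 \<noteq> 0" using row_ker_eq_0[OF K s e] w(1) Vw by metis
  then have "row_ker (int l) e \<kappa> a s (\<lambda>k. (1 / V 0) * V k) \<and> (1 / V 0) * V 0 = 1"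
    using row_ker_scale[OF K, of "1 / V 0"] by simp
  then show "\<exists>V. row_ker (int l) e \<kappa> a s V \<and> V 0 = 1" by blast
next
  assume "\<exists>V. row_ker (int l) e \<kappa> a s V \<and> V 0 = 1"
  then obtain V where V: "row_ker (int l) e \<kappa> a s V" "V 0 = 1" by blast
  have sup: "supported (int l) V" using V(1) by (simp add: row_ker_def)
  show "detP l e (\<kappa>, a, s) = 0"
    unfolding detP_eq fdet_eq_0_iff
    using V row_ker_iff[OF sup e s l, of \<kappa> a] by (intro exI[of _ "\<lambda>k. V (int k)"]) auto
qed

lemma row_ker_unique:
  assumes "row_ker n e \<kappa> a s V" "row_ker n e \<kappa> a s W" "V 0 = W 0" "s \<noteq> 0" "e * e = 1"
  shows "V = W"
proof
  fix k
  define Y where "Y k = V k - W k" for k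
  have "vrow n e \<kappa> a s Y j = vrow n e \<kappa> a s V j - vrow n e \<kappa> a s W j" for j
    by (simp add: Y_def vrow_def algebra_simps)
  then have "row_ker n e \<kappa> a s Y" using assms by (auto simp: row_ker_def supported_def Y_def)
  then have "Y k = 0" by (rule row_ker_eq_0) (use assms in \<open>auto simp: Y_def\<close>)
  then show "V k = W k" by (simp add: Y_def)
qed

text \<open>The sign is part of W in the coupled variables, so the difference of the two solutions
  vanishes: the vectors agree while their reversals are opposite, against the constant terms
  1.\<close>

lemma row_ker_disjoint:
  assumes K: "row_ker n 1 \<kappa> a s V" "row_ker n (-1) \<kappa> a s V'" "V 0 = 1" "V' 0 = 1" and s: "s \<noteq> 0"
  shows False
proof -
  define Y where "Y k = V k - V' k" for k
  define W where "W k = V (n - k) + V' (n - k)" for k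
  have "Y k = 0 \<and> W k = 0" for k
  proof (rule coupled_eq_0[of s Y \<kappa> a W n])
    fix j
    note A = vrow_coupled[OF K(1), simplified, of j] and B = vrow_coupled[OF K(2), simplified, of j]
    show "s / 2 * Y (j - 1) + (\<kappa> * a - of_int j) * Y j + a / 2 * W j + \<kappa> * s * W (j - 1) = 0"
      using arg_cong2[OF A(1) B(1), of "(-)"] by (simp add: Y_def W_def algebra_simps)
    show "s / 2 * W j + (\<kappa> * a - of_int (n + 1 - j)) * W (j - 1) + a / 2 * Y (j - 1) + \<kappa> * s * Y j = 0"
      using arg_cong2[OF A(2) B(2), of "(-)"] by (simp add: Y_def W_def algebra_simps)
  next
    fix k :: int assume "k < 0"
    then show "Y k = 0 \<and> W k = 0" using K by (auto simp: row_ker_def supported_def Y_def W_def)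
  qed (use K s in \<open>auto simp: Y_def\<close>)
  from this[of 0] this[of n] have "V 0 = V' 0" "V 0 + V' 0 = 0" by (auto simp: Y_def W_def)
  then show False using K by simp
qed

text \<open>The equation degenerates to p' = (s / 2) p, whose power series is exponential and never
  terminates.\<close>

lemma row_ker_axis:
  assumes K: "row_ker (int n) e 0 0 s V" and V0: "V 0 = 1" and s: "s \<noteq> 0"
  shows False
proof -
  have r: "s / 2 * V (j - 1) = of_int j * V j" for j
  proof -
    have "vrow (int n) e 0 0 s V j = 0" using K by (simp add: row_ker_def)
    then show ?thesis by (simp add: vrow_def)
  qed
  have "V (int m) \<noteq> 0" for m
  proof (induction m)
    case (Suc m)
    then show ?case using r[of "int (Suc m)"] s by auto
  qed (use V0 in simp)
  moreover have "V (int (Suc n)) = 0" using K by (simp add: row_ker_def supported_def)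
  ultimately show False by blast
qed

lemma moment_comb: "x * moment s c k + y * moment s d k = moment s (x * fst c + y * fst d, x * snd c + y * snd d) k"
proof -
  have e: "moment s b k = fst b * moment s (1, 0) k + snd b * moment s (0, 1) k" for b
    using moment_linear[of s "fst b" "snd b" k] by simp
  show ?thesis
    unfolding e[of c] e[of d] e[of "(x * fst c + y * fst d, x * snd c + y * snd d)"] by (simp add: algebra_simps)
qed

section \<open>Correspondence of kernel vectors and moment sequences\<close>

definition orth :: "nat \<Rightarrow> complex \<Rightarrow> complex \<times> complex \<Rightarrow> (int \<Rightarrow> complex) \<Rightarrow> bool" where
  "orth l s c V \<longleftrightarrow> (\<forall>k. 1 \<le> k \<and> k \<le> int l \<longrightarrow> mpair (int l) (moment s c) V k = 0)"

definition param :: "complex \<Rightarrow> nat \<Rightarrow> complex \<Rightarrow> complex \<times> complex \<Rightarrow> c3" where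
  "param e l s c = (e / 2 * toep_num l s c / toep l s c, - s * e * toep_num (l + 1) s c / toep (l + 1) s c, s)"

lemma row_ker_orth_u0:
  assumes K: "row_ker (int l) e \<kappa> a s V" and V0: "V 0 = 1" and s: "s \<noteq> 0" and e: "e * e = 1" and l: "l \<ge> 1"
    and c: "c \<noteq> (0, 0)" and o: "orth l s c V"
  shows "mpair (int l) (moment s c) V 0 \<noteq> 0"
proof
  assume z: "mpair (int l) (moment s c) V 0 = 0"
  have "mpair (int l) (moment s c) V k = 0" if "0 \<le> k" "k \<le> int l" for k
    using o z that by (cases "k = 0") (auto simp: orth_def)
  then have "moment s c k = 0" for k
    by (intro row_ker_orthogonal_imp_zero_is_moments[OF K _ _ s e is_moments_moment[OF s]]) (use V0 l in auto)
  then show False using c moment_eq_0_iff by blast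
qed

lemma row_ker_ex_orth:
  assumes K: "row_ker (int l) e \<kappa> a s V" and s: "s \<noteq> 0" and e: "e * e = 1" and l: "l \<ge> 1"
  obtains c where "c \<noteq> (0, 0)" "orth l s c V"
proof -
  obtain x y where xy: "(x, y) \<noteq> (0, 0)"
    "\<And>k. 1 \<le> k \<Longrightarrow> k \<le> int l \<Longrightarrow> mpair (int l) (\<lambda>k. x * moment s (1, 0) k + y * moment s (0, 1) k) V k = 0"
    using ex_orthogonal_is_moments[OF K _ s e is_moments_moment[OF s, of "(1, 0)"] is_moments_moment[OF s, of "(0, 1)"]] l by auto
  have "(\<lambda>k. x * moment s (1, 0) k + y * moment s (0, 1) k) = moment s (x, y)" by (rule ext) (simp add: moment_linear[of s x y])
  then show ?thesis using that[of "(x, y)"] xy by (simp add: orth_def)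
qed

text \<open>The last matrix row gives V l = - 2 e \<kappa>, and by orthogonality
  \<open>corow\<close> at l relates only the pairings at 0 and l + 1. Cramer's rule and
  \<open>orthogonal_ratio\<close> turn these two equations into determinants.\<close>

lemma row_ker_orth_param:
  assumes K: "row_ker (int l) e \<kappa> a s V" and V0: "V 0 = 1" and s: "s \<noteq> 0" and e: "e * e = 1" and l: "l \<ge> 1"
    and c: "c \<noteq> (0, 0)" and o: "orth l s c V"
  shows "toep l s c \<noteq> 0" "toep (l + 1) s c \<noteq> 0" "(\<kappa>, a, s) = param e l s c"
proof -
  let ?u = "mpair (int l) (moment s c) V"
  have sup: "supported (int l) V" using K by (simp add: row_ker_def)
  have u0: "?u 0 \<noteq> 0" by (rule row_ker_orth_u0) fact+
  have u: "?u k = 0" if "1 \<le> k" "k \<le> int l" for k using o that by (simp add: orth_def)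
  note M = is_moments_moment[OF s, of c]
  have N: "nonsing (int l + 1) (moment s c)" "nonsing (int l) (moment s c)"
    using nonsing_of_orthogonal[OF sup M _ V0 u u0] by auto
  show t: "toep l s c \<noteq> 0" using N by (simp add: toep_nonzero_iff)
  show t': "toep (l + 1) s c \<noteq> 0" using N unfolding toep_nonzero_iff by (simp add: add.commute)
  have last: "V (int l) = - 2 * e * \<kappa>"
  proof -
    have "V (int l) / 2 + e * \<kappa> * V 0 = 0"
      using row_ker_iff[OF sup e s l, of \<kappa> a] K G_entry_sum_last[of l e \<kappa> a s V] by auto
    then have "V (int l) + 2 * e * \<kappa> = 0" using V0 by (simp add: field_simps)
    then show ?thesis by (simp add: add_eq_0_iff2)
  qed
  have "toep_num l s c = - V (int l) * toep l s c" using toep_num_eq[OF s l V0 u] .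
  then have "e / 2 * toep_num l s c = (e * e) * \<kappa> * toep l s c" using last by simp
  then have k: "\<kappa> = e / 2 * toep_num l s c / toep l s c" using t e by simp
  have "corow (int l) e \<kappa> a s ?u (int l) = 0" by (rule corow_pair[OF K M])
  then have "s / 2 * ?u (int l + 1) + e * (a / 2) * ?u 0 = 0"
    using u[of "int l"] u[of 1] l by (simp add: corow_def)
  then have "2 * e * (s / 2 * ?u (int l + 1) + e * (a / 2) * ?u 0) = 0" by simp
  then have "e * s * ?u (int l + 1) + (e * e) * a * ?u 0 = 0" by (simp add: algebra_simps)
  then have "a * ?u 0 = - s * e * ?u (int l + 1)" using e by (simp add: add_eq_0_iff algebra_simps)
  then have "a = - s * e * (?u (int l + 1) / ?u 0)" using u0 by (simp add: field_simps)
  moreover have "toep_num (l + 1) s c / toep (l + 1) s c = ?u (int l + 1) / ?u 0"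
    using orthogonal_ratio[OF s sup V0 u u0] t' by simp
  ultimately have "a = - s * e * (toep_num (l + 1) s c / toep (l + 1) s c)" by simp
  then show "(\<kappa>, a, s) = param e l s c" using k by (simp add: param_def)
qed

lemma param_row_ker:
  assumes s: "s \<noteq> 0" and e: "e * e = 1" and l: "l \<ge> 1"
    and t: "toep l s c \<noteq> 0" "toep (l + 1) s c \<noteq> 0" and p: "param e l s c = (\<kappa>, a, s)"
  obtains V where "row_ker (int l) e \<kappa> a s V" "V 0 = 1" "orth l s c V"
proof -
  obtain V where V: "supported (int l) V" "V 0 = 1" "\<And>k. 1 \<le> k \<Longrightarrow> k \<le> int l \<Longrightarrow> mpair (int l) (moment s c) V k = 0"
    using ex_orthogonal[OF t(1) s] by blast
  let ?u = "mpair (int l) (moment s c) V"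
  note M = is_moments_moment[OF s, of c]
  have N: "nonsing (int l) (moment s c)" "nonsing (int l + 1) (moment s c)"
    using t unfolding toep_nonzero_iff by (auto simp: add.commute)
  have u0: "?u 0 \<noteq> 0"
  proof
    assume z: "?u 0 = 0"
    have "V 0 = 0"
    proof (rule nonsingD[OF N(2)])
      show "supported (int l + 1 - 1) V" using V(1) by simp
      fix i assume "0 \<le> i" "i < int l + 1"
      then show "mpair (int l + 1 - 1) (moment s c) V i = 0" using V(3)[of i] z by (cases "i = 0") auto
    qed
    then show False using V by simp
  qed
  have k: "\<kappa> = - (e / 2) * V (int l)"
    using p toep_num_eq[OF s l V(2,3)] t by (auto simp: param_def)
  have a: "a = - s * e * (?u (int l + 1) / ?u 0)"
    using p orthogonal_ratio[OF s V u0] t by (auto simp: param_def)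
  have "row_ker (int l) e \<kappa> a s V"
    by (rule orthogonal_imp_row_ker[OF N(1) V(1) M _ e V(2,3) k]) (use l a u0 in auto)
  then show ?thesis using that V by (simp add: orth_def)
qed

text \<open>The combination of c and d that also kills the pairing at 0 has no pairing left on 0..l,
  so it is the zero sequence.\<close>

lemma orth_unique:
  assumes K: "row_ker (int l) e \<kappa> a s V" and V0: "V 0 = 1" and s: "s \<noteq> 0" and e: "e * e = 1" and l: "l \<ge> 1"
    and o: "orth l s c V" "orth l s d V" and d: "d \<noteq> (0, 0)"
  obtains r where "c = (r * fst d, r * snd d)"
proof -
  let ?u = "\<lambda>c. mpair (int l) (moment s c) V"
  define x y where "x = ?u d 0" and "y = - ?u c 0"
  have x: "x \<noteq> 0" unfolding x_def by (rule row_ker_orth_u0) fact+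
  define b where "b = (x * fst c + y * fst d, x * snd c + y * snd d)"
  have ub: "?u b k = x * ?u c k + y * ?u d k" for k
    unfolding pair_lin_moment[symmetric] b_def moment_comb ..
  have "orth l s b V" using o by (simp add: orth_def ub)
  moreover have "?u b 0 = 0" by (simp add: ub x_def y_def)
  ultimately have "b = (0, 0)" using row_ker_orth_u0[OF K V0 s e l] by blast
  then have "x * fst c = - y * fst d" "x * snd c = - y * snd d" by (auto simp: b_def add_eq_0_iff)
  then have "c = (- y / x * fst d, - y / x * snd d)" using x by (simp add: prod_eq_iff field_simps)
  then show ?thesis by (rule that)
qed

text \<open>
  First-order deformations of a kernel vector along \<open>(\<delta>, \<eta>)\<close> in the \<open>(\<kappa>, a)\<close> plane. Given two independent
  ones, some combination leaves the is_moments unchanged, so it does not move the kernel vector either.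
\<close>

definition dvrow :: "int \<Rightarrow> complex \<Rightarrow> complex \<Rightarrow> complex \<Rightarrow> complex \<Rightarrow> complex \<Rightarrow> complex \<Rightarrow> (int \<Rightarrow> complex) \<Rightarrow> int \<Rightarrow> complex" where
  "dvrow n e \<kappa> a s \<delta> \<eta> V j = (\<delta> * a + \<kappa> * \<eta>) * V j + e * (\<eta> / 2) * V (n - j) + e * \<delta> * s * V (n + 1 - j)"

definition deform :: "int \<Rightarrow> complex \<Rightarrow> complex \<Rightarrow> complex \<Rightarrow> complex \<Rightarrow> complex \<Rightarrow> complex \<Rightarrow> (int \<Rightarrow> complex) \<Rightarrow> (int \<Rightarrow> complex) \<Rightarrow> bool" where
  "deform n e \<kappa> a s \<delta> \<eta> V Y \<longleftrightarrow> supported n Y \<and> Y 0 = 0 \<and> (\<forall>j. vrow n e \<kappa> a s Y j + dvrow n e \<kappa> a s \<delta> \<eta> V j = 0)"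

lemma deform_corow:
  assumes Y: "deform n e \<kappa> a s \<delta> \<eta> V Y" and M: "is_moments s c" and sup: "supported n V"
  shows "corow n e \<kappa> a s (mpair n c Y) j = - ((\<delta> * a + \<kappa> * \<eta>) * mpair n c V j
     + e * (\<eta> / 2) * mpair n c V (n - j) + e * \<delta> * s * mpair n c V (n + 1 - j))"
proof -
  have "0 = (\<Sum>k\<in>{-1..n+2}. (vrow n e \<kappa> a s Y k + dvrow n e \<kappa> a s \<delta> \<eta> V k) * c (k - j))"
    using Y by (simp add: deform_def)
  also have "\<dots> = (\<Sum>k\<in>{-1..n+2}. vrow n e \<kappa> a s Y k * c (k - j))
       + (\<delta> * a + \<kappa> * \<eta>) * (\<Sum>k\<in>{-1..n+2}. V k * c (k - j))
       + e * (\<eta> / 2) * (\<Sum>k\<in>{-1..n+2}. V (n + 0 - k) * c (k - j))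
       + e * \<delta> * s * (\<Sum>k\<in>{-1..n+2}. V (n + 1 - k) * c (k - j))"
    unfolding dvrow_def by (simp add: sum.distrib sum_distrib_left algebra_simps)
  also have "\<dots> = corow n e \<kappa> a s (mpair n c Y) j + ((\<delta> * a + \<kappa> * \<eta>) * mpair n c V j
     + e * (\<eta> / 2) * mpair n c V (n - j) + e * \<delta> * s * mpair n c V (n + 1 - j))"
  proof -
    have r: "(\<Sum>k\<in>{-1..n+2}. V (n + 0 - k) * c (k - j)) = mpair n c V (n + 0 - j)"
      "(\<Sum>k\<in>{-1..n+2}. V (n + 1 - k) * c (k - j)) = mpair n c V (n + 1 - j)"
      by (rule sum_reflect[OF sup M], simp)+
    have "supported n Y" using Y by (simp add: deform_def)
    then show ?thesis
      by (simp only: row_pair[OF _ M] sum_same[OF sup] r) simp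
  qed
  finally show ?thesis by (simp add: add_eq_0_iff add.commute)
qed

lemma no_two_deformations:
  assumes K: "row_ker (int l) e \<kappa> a s V" and V0: "V 0 = 1" and s: "s \<noteq> 0" and e: "e * e = 1" and l: "l \<ge> 1"
    and Y: "deform (int l) e \<kappa> a s 1 0 V Y" and Z: "deform (int l) e \<kappa> a s 0 1 V Z"
  shows False
proof -
  let ?n = "int l"
  obtain c where c: "c \<noteq> (0, 0)" "orth l s c V" using row_ker_ex_orth[OF K s e l] by blast
  note M = is_moments_moment[OF s, of c]
  let ?u = "mpair ?n (moment s c)"
  have sup: "supported ?n V" using K by (simp add: row_ker_def)
  have N: "nonsing ?n (moment s c)" using row_ker_orth_param(1)[OF K V0 s e l c] by (simp add: toep_nonzero_iff)
  have u: "?u V k = 0" if "1 \<le> k" "k \<le> ?n" for k using c that by (simp add: orth_def)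
  have "corow ?n e \<kappa> a s (?u V) ?n = 0" by (rule corow_pair[OF K M])
  then have "s / 2 * ?u V (?n + 1) + e * (a / 2) * ?u V 0 = 0"
    using u[of ?n] u[of 1] l by (simp add: corow_def)
  then have "2 * e * (s / 2 * ?u V (?n + 1) + e * (a / 2) * ?u V 0) = 0" by simp
  then have "e * s * ?u V (?n + 1) + (e * e) * a * ?u V 0 = 0" by (simp add: algebra_simps)
  then have end0: "a * ?u V 0 + e * s * ?u V (?n + 1) = 0" using e by (simp add: add.commute)
  have cor: "corow ?n e \<kappa> a s (?u T) j = 0"
    if "deform ?n e \<kappa> a s \<delta> \<eta> V T" "1 \<le> j" "j \<le> ?n - 1" for \<delta> \<eta> T j
    unfolding deform_corow[OF that(1) M sup] using u[of j] u[of "?n - j"] u[of "?n + 1 - j"] that by simp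
  \<comment> \<open>The coefficient of \<delta> is the relation \<open>end0\<close>, that of \<eta>
    contains e e - 1. So the pairings of a deformation satisfy the homogeneous boundary
    relation.\<close>
  have bd: "bdry ?n e \<kappa> a s (?u T) = 0" if "deform ?n e \<kappa> a s \<delta> \<eta> V T" for \<delta> \<eta> T
  proof -
    have "bdry ?n e \<kappa> a s (?u T) = - ((\<delta> * a + \<kappa> * \<eta>) * ?u V 0 + e * \<delta> * s * ?u V (?n + 1))
        + 2 * e * \<kappa> * (e * (\<eta> / 2) * ?u V 0)"
      unfolding bdry_eq[OF e] deform_corow[OF that M sup] using u[of ?n] u[of 1] l by simp
    also have "\<dots> = - \<delta> * (a * ?u V 0 + e * s * ?u V (?n + 1)) + (e * e - 1) * (\<kappa> * \<eta> * ?u V 0)"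
      by (simp add: algebra_simps)
    finally show ?thesis using end0 e by simp
  qed
  obtain x y where xy: "(x, y) \<noteq> (0, 0)" "\<And>k. 1 \<le> k \<Longrightarrow> k \<le> ?n \<Longrightarrow> x * ?u Y k + y * ?u Z k = 0"
    using corow_onedim[of ?n e \<kappa> a s "?u Y" "?u Z", OF cor[OF Y] bd[OF Y] cor[OF Z] bd[OF Z] s e] l by auto
  define T where "T k = x * Y k + y * Z k" for k
  have T0: "T k = 0" for k
  proof (rule nonsing_shiftD[OF N])
    show "supported ?n T" "T 0 = 0" using Y Z by (auto simp: deform_def supported_def T_def)
    show "?u T i = 0" if "1 \<le> i" "i \<le> ?n" for i unfolding T_def pair_lin using xy that by simp
  qed
  have d: "dvrow ?n e \<kappa> a s x y V j = 0" for j
  proof -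
    have "vrow ?n e \<kappa> a s T j + dvrow ?n e \<kappa> a s x y V j
        = x * (vrow ?n e \<kappa> a s Y j + dvrow ?n e \<kappa> a s 1 0 V j)
        + y * (vrow ?n e \<kappa> a s Z j + dvrow ?n e \<kappa> a s 0 1 V j)"
      by (simp add: vrow_def dvrow_def T_def algebra_simps)
    also have "\<dots> = 0" using Y Z by (simp add: deform_def)
    finally show ?thesis using T0 by (simp add: vrow_def)
  qed
  have Vz: "V (?n + 1) = 0" "V (-1) = 0" using sup by (auto simp: supported_def)
  have "e * x * s = 0" using d[of "?n + 1"] Vz V0 by (simp add: dvrow_def)
  then have x0: "x = 0" using e s by auto
  then have y0: "y \<noteq> 0" using xy by auto
  \<comment> \<open>Only the a-direction is left, and it says q = - 2 \<kappa> p for the signed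
    reversal q. Reversing twice gives 4 \<kappa> \<kappa> = 1, and then the differential equation
    collapses to p' = 0, although the leading coefficient of p is nonzero.\<close>
  have r: "e * V (?n - j) = - 2 * \<kappa> * V j" for j
  proof -
    have "y * (\<kappa> * V j + e * V (?n - j) / 2) = 0" using d[of j] by (simp add: dvrow_def x0 algebra_simps)
    then have "\<kappa> * V j + e * V (?n - j) / 2 = 0" using y0 by simp
    then have "2 * \<kappa> * V j + e * V (?n - j) = 0" by (simp add: field_simps)
    then show ?thesis by (simp add: add_eq_0_iff)
  qed
  have k4: "4 * (\<kappa> * \<kappa>) = 1"
  proof -
    have "e = - 2 * \<kappa> * V ?n" using r[of ?n] V0 by simp
    then have "e * e = - 2 * \<kappa> * (e * V ?n)" by (metis mult.assoc mult.commute)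
    also have "e * V ?n = - 2 * \<kappa>" using r[of 0] V0 by simp
    finally show ?thesis using e by simp
  qed
  have "of_int ?n * V ?n = 0"
  proof -
    have "0 = vrow ?n e \<kappa> a s V ?n" using K by (simp add: row_ker_def)
    also have "\<dots> = s / 2 * V (?n - 1) + (\<kappa> * a - of_int ?n) * V ?n + a / 2 * (e * V (?n - ?n))
        + \<kappa> * s * (e * V (?n - (?n - 1)))"
      by (simp add: vrow_def algebra_simps)
    also have "\<dots> = - of_int ?n * V ?n + (1 - 4 * (\<kappa> * \<kappa>)) * (s / 2 * V (?n - 1))"
      unfolding r by (simp add: algebra_simps)
    finally show ?thesis using k4 by simp
  qed
  then have "V ?n = 0" using l by simp
  then show False using r[of ?n] V0 e by auto
qed

section \<open>Smoothness\<close>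

definition cdiff :: "('a::complex_space \<Rightarrow> 'b::complex_space) \<Rightarrow> 'a \<Rightarrow> bool" where
  "cdiff f x \<longleftrightarrow> (\<exists>f'. has_complex_derivative f f' x)"

lemma cdiffI: "(f has_derivative f') (at x) \<Longrightarrow> (\<And>c v. f' (scaleC c v) = scaleC c (f' v)) \<Longrightarrow> cdiff f x"
  by (auto simp: cdiff_def has_complex_derivative_def)

lemma cdiffE:
  assumes "cdiff f x"
  obtains f' where "(f has_derivative f') (at x)" "\<And>c v. f' (scaleC c v) = scaleC c (f' v)"
  using assms by (auto simp: cdiff_def has_complex_derivative_def)

lemma holo_on_iff_cdiff: "holo_on f V \<longleftrightarrow> (\<forall>x\<in>V. cdiff f x)"
  by (simp add: holo_on_def cdiff_def)

lemma cdiff_const [intro, simp]: "cdiff (\<lambda>x. c) x"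
  by (rule cdiffI[of _ "\<lambda>x. 0"]) (auto simp: scaleC_zero_right)

lemma cdiff_ident [intro, simp]: "cdiff (\<lambda>x. x) x"
  by (rule cdiffI[of _ "\<lambda>x. x"]) auto

lemma cdiff_fst [intro]: "cdiff f x \<Longrightarrow> cdiff (\<lambda>x. fst (f x)) x"
  by (elim cdiffE, rule cdiffI, erule has_derivative_fst) (simp add: scaleC_prod_def)

lemma cdiff_snd [intro]: "cdiff f x \<Longrightarrow> cdiff (\<lambda>x. snd (f x)) x"
  by (elim cdiffE, rule cdiffI, erule has_derivative_snd) (simp add: scaleC_prod_def)

lemma cdiff_Pair [intro]: "cdiff f x \<Longrightarrow> cdiff g x \<Longrightarrow> cdiff (\<lambda>x. (f x, g x)) x"
  by (elim cdiffE, rule cdiffI, erule (1) has_derivative_Pair) (simp add: scaleC_prod_def)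

lemma cdiff_compose: "cdiff f x \<Longrightarrow> cdiff g (f x) \<Longrightarrow> cdiff (\<lambda>x. g (f x)) x"
  by (elim cdiffE, rule cdiffI, erule (1) has_derivative_compose) simp

lemma cdiff_add [intro]: "cdiff f x \<Longrightarrow> cdiff g x \<Longrightarrow> cdiff (\<lambda>x. f x + g x) x"
  by (elim cdiffE, rule cdiffI, erule (1) has_derivative_add) (simp add: scaleC_add_right)

lemma cdiff_mult [intro]:
  fixes f g :: "'a::complex_space \<Rightarrow> complex"
  shows "cdiff f x \<Longrightarrow> cdiff g x \<Longrightarrow> cdiff (\<lambda>x. f x * g x) x"
  by (elim cdiffE, rule cdiffI, erule (1) has_derivative_mult) (simp add: scaleC_complex_def algebra_simps)

lemma cdiff_minus [intro]:
  fixes f :: "'a::complex_space \<Rightarrow> complex"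
  shows "cdiff f x \<Longrightarrow> cdiff (\<lambda>x. - f x) x"
  using cdiff_mult[of "\<lambda>x. -1" x f] by simp

lemma cdiff_diff [intro]:
  fixes f :: "'a::complex_space \<Rightarrow> complex"
  shows "cdiff f x \<Longrightarrow> cdiff g x \<Longrightarrow> cdiff (\<lambda>x. f x - g x) x"
  using cdiff_add[of f x "\<lambda>x. - g x"] by auto

lemma cdiff_inverse:
  fixes f :: "'a::complex_space \<Rightarrow> complex"
  shows "cdiff f x \<Longrightarrow> f x \<noteq> 0 \<Longrightarrow> cdiff (\<lambda>x. inverse (f x)) x"
  by (elim cdiffE, rule cdiffI, erule (1) Deriv.has_derivative_inverse) (simp add: scaleC_complex_def algebra_simps)

lemma cdiff_divide [intro]:
  fixes f :: "'a::complex_space \<Rightarrow> complex"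
  shows "cdiff f x \<Longrightarrow> cdiff g x \<Longrightarrow> g x \<noteq> 0 \<Longrightarrow> cdiff (\<lambda>x. f x / g x) x"
  using cdiff_mult[of f x "\<lambda>x. inverse (g x)"] cdiff_inverse[of g x] by (simp add: divide_inverse)

lemma cdiff_sum [intro]:
  fixes f :: "'i \<Rightarrow> 'a::complex_space \<Rightarrow> complex"
  shows "(\<And>i. i \<in> I \<Longrightarrow> cdiff (f i) x) \<Longrightarrow> cdiff (\<lambda>x. \<Sum>i\<in>I. f i x) x"
  by (induction I rule: infinite_finite_induct) auto

lemma cdiff_prod [intro]:
  fixes f :: "'i \<Rightarrow> 'a::complex_space \<Rightarrow> complex"
  shows "(\<And>i. i \<in> I \<Longrightarrow> cdiff (f i) x) \<Longrightarrow> cdiff (\<lambda>x. \<Prod>i\<in>I. f i x) x"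
  by (induction I rule: infinite_finite_induct) auto

lemma cdiff_If:
  "(P \<Longrightarrow> cdiff f x) \<Longrightarrow> (\<not> P \<Longrightarrow> cdiff g x) \<Longrightarrow> cdiff (\<lambda>x. if P then f x else g x) x"
  by (cases P) auto

lemma cdiff_isCont: "cdiff f x \<Longrightarrow> isCont f x"
  by (elim cdiffE) (rule has_derivative_continuous)

lemma cdiff_fdet:
  assumes "\<And>i j. i < n \<Longrightarrow> j < n \<Longrightarrow> cdiff (\<lambda>x. f x i j) x"
  shows "cdiff (\<lambda>x. fdet n (f x)) x"
  unfolding fdet_expand
proof (intro cdiff_sum cdiff_mult cdiff_const cdiff_prod)
  fix p i assume "p \<in> {p. p permutes {0..<n}}" "i \<in> {0..<n}"
  then have "p i < n" "i < n" using permutes_in_image[of p "{0..<n}" i] by auto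
  then show "cdiff (\<lambda>x. f x i (p i)) x" using assms by blast
qed

lemma cdiff_fcof:
  assumes "\<And>i j. i < n \<Longrightarrow> j < n \<Longrightarrow> cdiff (\<lambda>x. f x i j) x" "i < n" "k < n"
  shows "cdiff (\<lambda>x. fcof n (f x) i k) x"
  unfolding fcof_def by (intro cdiff_mult cdiff_const cdiff_fdet assms) (use assms(2,3) in auto)

lemma cdiff_G_entry:
  assumes "cdiff f x"
  shows "cdiff (\<lambda>x. G_entry l e (f x) i k) x"
proof -
  have "cdiff (\<lambda>p. G_entry l e p i k) p" for p
    unfolding G_entry_def G1_entry_def G2_entry_def case_prod_unfold
    by (intro cdiff_If cdiff_add cdiff_mult cdiff_const cdiff_diff cdiff_fst cdiff_snd cdiff_divide cdiff_ident) auto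
  then show ?thesis using cdiff_compose[OF assms] by blast
qed

lemma cdiff_detP: "cdiff f x \<Longrightarrow> cdiff (\<lambda>x. detP l e (f x)) x"
  unfolding detP_eq by (intro cdiff_fdet cdiff_G_entry)

lemma cdiff_moment:
  assumes "cdiff S x" "cdiff C x" "S x \<noteq> 0"
  shows "cdiff (\<lambda>x. moment (S x) (C x) k) x"
proof -
  have "cdiff (\<lambda>x. moment_nat (S x) (C x) m) x" for m
  proof (induction m rule: induct_nat_012)
    case (ge2 m)
    then show ?case by (simp del: of_nat_Suc) (intro cdiff_add cdiff_mult cdiff_divide cdiff_const assms ge2)
  qed (use assms in auto)
  then show ?thesis by (simp add: moment_def)
qed

lemma cdiff_toep:
  assumes "cdiff S x" "cdiff C x" "S x \<noteq> 0"
  shows "cdiff (\<lambda>x. toep n (S x) (C x)) x" "cdiff (\<lambda>x. toep_num n (S x) (C x)) x"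
proof -
  show "cdiff (\<lambda>x. toep n (S x) (C x)) x"
    unfolding toep_def by (intro cdiff_fdet cdiff_moment assms)
  have "cdiff (\<lambda>x. if j = n - 1 then moment (S x) (C x) (int i + 1) else moment (S x) (C x) (int j - int i)) x" for i j
    using cdiff_moment[OF assms] by (cases "j = n - 1") auto
  then show "cdiff (\<lambda>x. toep_num n (S x) (C x)) x"
    unfolding toep_num_def by (intro cdiff_fdet)
qed

section \<open>The gradient of the determinant\<close>

text \<open>The entries contain the product \<kappa> a, whose variation has the quadratic part
  \<tau> \<tau> \<delta> \<eta>. Along coordinate directions, where \<delta> \<eta> = 0, the
  variation is exactly linear in \<tau>.\<close>

lemma G_entry_vary_sum:
  assumes de: "\<delta> * \<eta> = 0" and i: "i < l + 1"
  shows "(\<Sum>m<l+1. G_entry l e (\<kappa> + \<tau> * \<delta>, a + \<tau> * \<eta>, s) i m * V (int m))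
    = (\<Sum>m<l+1. G_entry l e (\<kappa>, a, s) i m * V (int m))
      + \<tau> * (if i < l then dvrow (int l) e \<kappa> a s \<delta> \<eta> V (int i + 1) else e * \<delta> * V 0)"
proof (cases "i < l")
  case True
  have "vrow (int l) e (\<kappa> + \<tau> * \<delta>) (a + \<tau> * \<eta>) s V j
    = vrow (int l) e \<kappa> a s V j + \<tau> * dvrow (int l) e \<kappa> a s \<delta> \<eta> V j + \<tau> * \<tau> * (\<delta> * \<eta>) * V j" for j
    by (simp add: vrow_def dvrow_def field_simps)
  then show ?thesis using True de by (simp only: G_entry_sum) simp
next
  case False
  then have "i = l" using i by simp
  then show ?thesis by (simp only: G_entry_sum_last) (simp add: algebra_simps)
qed

definition deriv_col :: "nat \<Rightarrow> complex \<Rightarrow> complex \<Rightarrow> complex \<Rightarrow> complex \<Rightarrow> complex \<Rightarrow> complex \<Rightarrow> (int \<Rightarrow> complex) \<Rightarrow> nat \<Rightarrow> complex" where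
  "deriv_col l e \<kappa> a s \<delta> \<eta> V i = (if i < l then dvrow (int l) e \<kappa> a s \<delta> \<eta> V (int i + 1) else e * \<delta> * V 0)"

text \<open>In a null vector w of the modified matrix w 0 is nonzero, since otherwise the rest would
  be a kernel vector with zero constant term. Dividing by w 0 and clearing position 0 solves the
  linearized matrix rows; the outer equations 0 and l + 1 come from the last row.\<close>

lemma deform_of_fdet_0:
  assumes K: "row_ker (int l) e \<kappa> a s V" and V0: "V 0 = 1" and s: "s \<noteq> 0" and e: "e * e = 1" and l: "l \<ge> 1"
    and z: "fdet (l + 1) (\<lambda>i j. if j = 0 then deriv_col l e \<kappa> a s \<delta> \<eta> V i else G_entry l e (\<kappa>, a, s) i j) = 0"
  obtains Y where "deform (int l) e \<kappa> a s \<delta> \<eta> V Y"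
proof -
  have sup: "supported (int l) V" using K by (simp add: row_ker_def)
  define h where "h = deriv_col l e \<kappa> a s \<delta> \<eta> V"
  note h_def' = h_def deriv_col_def
  have ker: "(\<Sum>m<l+1. G_entry l e (\<kappa>, a, s) i m * V (int m)) = 0" if "i < l + 1" for i
    using row_ker_iff[OF sup e s l, of \<kappa> a] K that by blast
  obtain w where w: "\<exists>k<l+1. w k \<noteq> 0"
    "\<And>i. i < l + 1 \<Longrightarrow> (\<Sum>k<l+1. (if k = 0 then h i else G_entry l e (\<kappa>, a, s) i k) * w k) = 0"
    using z unfolding fdet_eq_0_iff h_def by blast
  have w': "h i * w 0 + (\<Sum>k<l. G_entry l e (\<kappa>, a, s) i (Suc k) * w (Suc k)) = 0" if "i < l + 1" for i
    using w(2)[OF that] by (simp add: sum.lessThan_Suc_shift del: sum.lessThan_Suc)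
  define X where "X k = (if k = 0 then 0 else ext0 (l + 1) w k)" for k
  have supX: "supported (int l) X" using supported_ext0[of "l + 1" w] by (auto simp: X_def supported_def)
  have X0: "X 0 = 0" by (simp add: X_def)
  have XG: "(\<Sum>k<l+1. G_entry l e (\<kappa>, a, s) i k * X (int k)) = - h i * w 0" if "i < l + 1" for i
  proof -
    have "(\<Sum>k<l+1. G_entry l e (\<kappa>, a, s) i k * X (int k)) = (\<Sum>k<l. G_entry l e (\<kappa>, a, s) i (Suc k) * X (int (Suc k)))"
      using X0 by (simp add: sum.lessThan_Suc_shift del: sum.lessThan_Suc of_nat_Suc)
    also have "\<dots> = (\<Sum>k<l. G_entry l e (\<kappa>, a, s) i (Suc k) * w (Suc k))"
      by (intro sum.cong refl) (simp add: X_def del: of_nat_Suc)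
    finally show ?thesis using w'[OF that] by (simp add: add_eq_0_iff)
  qed
  have w0: "w 0 \<noteq> 0"
  proof
    assume z: "w 0 = 0"
    then have "row_ker (int l) e \<kappa> a s X" using row_ker_iff[OF supX e s l, of \<kappa> a] XG by auto
    then have "X k = 0" for k using X0 by (rule row_ker_eq_0[OF _ s e])
    then have "w k = 0" if "k < l + 1" for k
      using z that by (cases "k = 0") (auto simp: X_def dest: meta_spec[of _ "int k"])
    then show False using w(1) by blast
  qed
  define Y where "Y k = X k / w 0" for k
  have supY: "supported (int l) Y" using supX by (auto simp: Y_def supported_def)
  have Y0: "Y 0 = 0" by (simp add: Y_def X0)
  have YG: "(\<Sum>k<l+1. G_entry l e (\<kappa>, a, s) i k * Y (int k)) = - h i" if "i < l + 1" for i
    using XG[OF that] w0 by (simp add: Y_def sum_divide_distrib[symmetric])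
  have lastY: "Y (int l) = - 2 * e * \<delta>"
  proof -
    have "Y (int l) / 2 = - (e * \<delta>)"
      using YG[of l] G_entry_sum_last[of l e \<kappa> a s Y] Y0 V0 by (simp add: h_def')
    then show ?thesis by (simp add: field_simps)
  qed
  have lastV: "V (int l) = - 2 * e * \<kappa>"
  proof -
    have "V (int l) / 2 = - (e * \<kappa>)"
      using ker[of l] G_entry_sum_last[of l e \<kappa> a s V] V0 by (simp add: add_eq_0_iff2)
    then show ?thesis by (simp add: field_simps)
  qed
  have out: "V k = 0" "Y k = 0" if "k < 0 \<or> int l < k" for k
    using sup supY that by (auto simp: supported_def)
  have "vrow (int l) e \<kappa> a s Y j + dvrow (int l) e \<kappa> a s \<delta> \<eta> V j = 0" for j
  proof -
    consider "j < 0" | "j = 0" | "1 \<le> j" "j \<le> int l" | "j = int l + 1" | "j > int l + 1" by linarith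
    then show ?thesis
    proof cases
      case 2
      have "vrow (int l) e \<kappa> a s Y 0 + dvrow (int l) e \<kappa> a s \<delta> \<eta> V 0
        = (1 - e * e) * (\<delta> * a + \<kappa> * \<eta>)"
        using out[of "-1"] out[of "int l + 1"]
        by (simp add: vrow_def dvrow_def Y0 V0 lastY lastV algebra_simps)
      then show ?thesis using e 2 by simp
    next
      case 3
      have i: "nat (j - 1) < l" using 3 by auto
      have "vrow (int l) e \<kappa> a s Y j = - h (nat (j - 1))"
        using YG[of "nat (j - 1)"] G_entry_sum[OF i, of e \<kappa> a s Y] i 3 by simp
      then show ?thesis using i 3 by (simp add: h_def')
    next
      case 4
      then show ?thesis using out[of "-1"] out[of "int l + 1"]
        by (simp add: vrow_def dvrow_def Y0 V0 lastY)
    qed (use out in \<open>auto simp: vrow_def dvrow_def\<close>)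
  qed
  then show ?thesis using that[of Y] supY Y0 by (simp add: deform_def)
qed

text \<open>As \<open>V 0 = 1\<close>, replacing column 0 by the matrix applied to \<open>V\<close>
  keeps the determinant. This column is zero at the base point, so along the line the determinant is
  \<tau> R(\<tau>), with derivative R 0, the determinant of \<open>deform_of_fdet_0\<close>.\<close>

lemma deform_of_derivative_0:
  assumes K: "row_ker (int l) e \<kappa> a s V" and V0: "V 0 = 1" and s: "s \<noteq> 0" and e: "e * e = 1" and l: "l \<ge> 1"
    and de: "\<delta> * \<eta> = 0" and D: "has_complex_derivative (detP l e) F' (\<kappa>, a, s)" and z: "F' (\<delta>, \<eta>, 0) = 0"
  obtains Y where "deform (int l) e \<kappa> a s \<delta> \<eta> V Y"
proof -
  have sup: "supported (int l) V" using K by (simp add: row_ker_def)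
  define h where "h = deriv_col l e \<kappa> a s \<delta> \<eta> V"
  define P where "P \<tau> = (\<kappa> + \<tau> * \<delta>, a + \<tau> * \<eta>, s)" for \<tau> :: complex
  define R where "R \<tau> = fdet (l + 1) (\<lambda>i j. if j = 0 then h i else G_entry l e (P \<tau>) i j)" for \<tau>
  have ker: "(\<Sum>m<l+1. G_entry l e (\<kappa>, a, s) i m * V (int m)) = 0" if "i < l + 1" for i
    using row_ker_iff[OF sup e s l, of \<kappa> a] K that by blast
  have prod: "detP l e (P \<tau>) = \<tau> * R \<tau>" for \<tau>
  proof -
    have "detP l e (P \<tau>) = V (int 0) * fdet (l + 1) (G_entry l e (P \<tau>))" using V0 by (simp add: detP_eq)
    also have "\<dots> = fdet (l + 1) (\<lambda>i j. if j = 0 then (\<Sum>m<l+1. G_entry l e (P \<tau>) i m * V (int m)) else G_entry l e (P \<tau>) i j)"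
      by (rule fdet_replace_col[symmetric]) simp
    also have "\<dots> = fdet (l + 1) (\<lambda>i j. if j = 0 then \<tau> * h i else G_entry l e (P \<tau>) i j)"
      by (rule fdet_cong) (simp only: P_def G_entry_vary_sum[OF de] ker h_def deriv_col_def add_0 split: if_splits)
    also have "\<dots> = (\<Sum>i<l+1. \<tau> * h i * fcof (l + 1) (G_entry l e (P \<tau>)) i 0)" by (rule fdet_laplace) simp
    also have "\<dots> = \<tau> * (\<Sum>i<l+1. h i * fcof (l + 1) (G_entry l e (P \<tau>)) i 0)"
      unfolding sum_distrib_left by (simp only: mult.assoc)
    also have "(\<Sum>i<l+1. h i * fcof (l + 1) (G_entry l e (P \<tau>)) i 0) = R \<tau>"
      unfolding R_def by (rule fdet_laplace[symmetric]) simp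
    finally show ?thesis .
  qed
  have dP: "(P has_derivative (\<lambda>\<tau>. (\<tau> * \<delta>, \<tau> * \<eta>, 0))) (at 0)"
    unfolding P_def by (auto intro!: derivative_eq_intros has_derivative_Pair)
  have "cdiff P 0" by (rule cdiffI[OF dP]) (simp add: scaleC_prod_def scaleC_complex_def algebra_simps)
  have "cdiff (\<lambda>\<tau>. if j = 0 then h i else G_entry l e (P \<tau>) i j) 0" for i j
    using cdiff_G_entry[OF \<open>cdiff P 0\<close>] by (cases "j = 0") auto
  then have "cdiff R 0" unfolding R_def by (intro cdiff_fdet)
  then have cont: "isCont R 0" by (rule cdiff_isCont)
  have F': "(detP l e has_derivative F') (at (P 0))" "\<And>c v. F' (scaleC c v) = scaleC c (F' v)"
    using D by (auto simp: has_complex_derivative_def P_def)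
  have "((\<lambda>\<tau>. detP l e (P \<tau>)) has_derivative (\<lambda>\<tau>. F' (\<tau> * \<delta>, \<tau> * \<eta>, 0))) (at 0)"
    by (rule has_derivative_compose[OF dP F'(1)])
  moreover have "F' (\<tau> * \<delta>, \<tau> * \<eta>, 0) = 0" for \<tau>
    using F'(2)[of \<tau> "(\<delta>, \<eta>, 0)"] z by (simp add: scaleC_prod_def scaleC_complex_def)
  moreover have "(*) 0 = (\<lambda>\<tau>::complex. 0::complex)" by auto
  ultimately have "((\<lambda>\<tau>. \<tau> * R \<tau>) has_field_derivative 0) (at 0)"
    by (simp add: prod has_field_derivative_def)
  then have "((\<lambda>\<tau>. (\<tau> * R \<tau> - 0 * R 0) / (\<tau> - 0)) \<longlongrightarrow> 0) (at 0)" by (simp only: has_field_derivative_iff)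
  then have "(R \<longlongrightarrow> 0) (at 0)"
    by (rule Lim_transform_eventually) (auto simp: eventually_at intro!: exI[of _ 1])
  have P0: "P 0 = (\<kappa>, a, s)" by (simp add: P_def)
  have "R 0 = 0" using cont \<open>(R \<longlongrightarrow> 0) (at 0)\<close> LIM_unique by (auto simp: isCont_def)
  then have "fdet (l + 1) (\<lambda>i j. if j = 0 then deriv_col l e \<kappa> a s \<delta> \<eta> V i else G_entry l e (\<kappa>, a, s) i j) = 0"
    unfolding R_def P0 h_def .
  from deform_of_fdet_0[OF K V0 s e l this] show ?thesis using that by blast
qed

text \<open>If all cofactors of column 0 vanished, every replacement of that column would be
  singular and both coordinate directions would admit deformations. The weights y later produce,
  from cofactors, a kernel vector with nonzero constant term.\<close>

lemma ex_column:
  assumes K: "row_ker (int l) e \<kappa> a s V" and V0: "V 0 = 1" and s: "s \<noteq> 0" and e: "e * e = 1" and l: "l \<ge> 1"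
  obtains y where "(\<Sum>i<l+1. y i * fcof (l + 1) (G_entry l e (\<kappa>, a, s)) i 0) \<noteq> 0"
proof (rule ccontr)
  assume "\<not> thesis"
  then have "(\<Sum>i<l+1. y i * fcof (l + 1) (G_entry l e (\<kappa>, a, s)) i 0) = 0" for y using that by blast
  then have z: "fdet (l + 1) (\<lambda>i j. if j = 0 then y i else G_entry l e (\<kappa>, a, s) i j) = 0" for y
    by (subst fdet_laplace) simp_all
  obtain Y where Y: "deform (int l) e \<kappa> a s 1 0 V Y" using deform_of_fdet_0[OF K V0 s e l z] by blast
  obtain Z where Z: "deform (int l) e \<kappa> a s 0 1 V Z" using deform_of_fdet_0[OF K V0 s e l z] by blast
  show False by (rule no_two_deformations[OF K V0 s e l Y Z])
qed

text \<open>The direction keeps s fixed, so the same statement serves the surface and its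
  fibers.\<close>

lemma detP_gradient:
  assumes p: "detP l e (\<kappa>, a, s) = 0" and s: "s \<noteq> 0" and e: "e * e = 1" and l: "l \<ge> 1"
    and D: "has_complex_derivative (detP l e) F' (\<kappa>, a, s)"
  obtains \<delta> \<eta> where "F' (\<delta>, \<eta>, 0) \<noteq> 0"
proof -
  obtain V where V: "row_ker (int l) e \<kappa> a s V" "V 0 = 1" using p detP_zero_iff[OF e s l] by blast
  have "F' (1, 0, 0) \<noteq> 0 \<or> F' (0, 1, 0) \<noteq> 0"
  proof (rule ccontr)
    assume "\<not> (F' (1, 0, 0) \<noteq> 0 \<or> F' (0, 1, 0) \<noteq> 0)"
    then have z: "F' (1, 0, 0) = 0" "F' (0, 1, 0) = 0" by auto
    obtain Y where Y: "deform (int l) e \<kappa> a s 1 0 V Y"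
      by (rule deform_of_derivative_0[OF V s e l _ D z(1)]) simp
    obtain Z where Z: "deform (int l) e \<kappa> a s 0 1 V Z"
      by (rule deform_of_derivative_0[OF V s e l _ D z(2)]) simp
    show False by (rule no_two_deformations[OF V s e l Y Z])
  qed
  then show ?thesis using that by blast
qed

lemma open_s_nonzero: "open {p :: c3. snd (snd p) \<noteq> 0}"
  by (intro open_Collect_neq continuous_intros)

lemma surface_o_iff: "(\<kappa>, a, s) \<in> surface_o l e \<longleftrightarrow> detP l e (\<kappa>, a, s) = 0 \<and> s \<noteq> 0"
  by (simp add: surface_o_def surface_def s_coord_def)

lemma complex_submanifoldI:
  fixes F :: "'a::complex_space \<Rightarrow> 'b::complex_space"
  assumes "open V" "X = {x \<in> V. F x = 0}" "\<And>x. cdiff F x"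
    "\<And>p. p \<in> X \<Longrightarrow> \<exists>F'. has_complex_derivative F F' p \<and> surj F'"
  shows "complex_submanifold TYPE('b) X"
  unfolding complex_submanifold_def
proof
  fix p assume p: "p \<in> X"
  then obtain F' where "has_complex_derivative F F' p" "surj F'" using assms(4) by blast
  moreover have "holo_on F V" using assms(3) by (simp add: holo_on_iff_cdiff)
  moreover have "X \<inter> V = {x \<in> V. F x = 0}" "p \<in> V" using assms(2) p by auto
  ultimately show "\<exists>V (F :: 'a \<Rightarrow> 'b) F'. open V \<and> p \<in> V \<and> holo_on F V \<and>
      has_complex_derivative F F' p \<and> surj F' \<and> X \<inter> V = {x \<in> V. F x = 0}"
    using assms(1) by blast
qed

lemma submanifold_surface_o:
  assumes e: "e * e = 1" and l: "l \<ge> 1"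
  shows "complex_submanifold TYPE(complex) (surface_o l e)"
proof (rule complex_submanifoldI[OF open_s_nonzero])
  show "surface_o l e = {x \<in> {p. snd (snd p) \<noteq> 0}. detP l e x = 0}" by (auto simp: surface_o_iff)
  show "cdiff (detP l e) p" for p using cdiff_detP[of "\<lambda>x. x"] by simp
  fix p assume p: "p \<in> surface_o l e"
  obtain \<kappa> a s where k: "p = (\<kappa>, a, s)" by (cases p)
  have P: "detP l e (\<kappa>, a, s) = 0" "s \<noteq> 0" using p by (auto simp: surface_o_iff k)
  obtain F' where F': "has_complex_derivative (detP l e) F' p"
    using cdiff_detP[of "\<lambda>x. x" p l e] by (auto simp: cdiff_def)
  obtain \<delta> \<eta> where d: "F' (\<delta>, \<eta>, 0) \<noteq> 0" using detP_gradient[OF P e l] F' k by metis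
  have "F' (scaleC (y / F' (\<delta>, \<eta>, 0)) (\<delta>, \<eta>, 0)) = y" for y
    using F' d by (simp add: has_complex_derivative_def) (simp add: scaleC_complex_def)
  then have "surj F'" unfolding surj_def by metis
  then show "\<exists>F'. has_complex_derivative (detP l e) F' p \<and> surj F'" using F' by blast
qed

lemma submanifold_surface_fiber:
  assumes e: "e * e = 1" and l: "l \<ge> 1"
  shows "complex_submanifold TYPE(complex \<times> complex) (surface_fiber l e s0)"
proof (rule complex_submanifoldI[OF open_s_nonzero])
  define H where "H p = (detP l e p, snd (snd p) - s0)" for p :: c3
  show "surface_fiber l e s0 = {x \<in> {p. snd (snd p) \<noteq> 0}. H x = 0}"
    by (auto simp: surface_fiber_def surface_o_iff H_def s_coord_def zero_prod_def)
  show "cdiff H p" for p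
    unfolding H_def using cdiff_detP[of "\<lambda>x. x"] by (intro cdiff_Pair cdiff_diff cdiff_snd) auto
  fix p assume p: "p \<in> surface_fiber l e s0"
  obtain \<kappa> a s where k: "p = (\<kappa>, a, s)" by (cases p)
  have P: "detP l e (\<kappa>, a, s) = 0" "s \<noteq> 0" using p by (auto simp: surface_fiber_def surface_o_iff k)
  obtain F' where F': "has_complex_derivative (detP l e) F' p"
    using cdiff_detP[of "\<lambda>x. x" p l e] by (auto simp: cdiff_def)
  obtain \<delta> \<eta> where d: "F' (\<delta>, \<eta>, 0) \<noteq> 0" using detP_gradient[OF P e l] F' k by metis
  define H' where "H' v = (F' v, snd (snd v))" for v :: c3
  have hd: "has_complex_derivative H H' p"
    using F' unfolding has_complex_derivative_def H_def H'_def
    by (auto intro!: derivative_eq_intros has_derivative_Pair simp: scaleC_prod_def)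
  have lin: "linear F'" using F' by (auto simp: has_complex_derivative_def has_derivative_def bounded_linear.linear)
  have "\<exists>v. H' v = y" for y
  proof -
    define k where "k = (fst y - F' (0, 0, snd y)) / F' (\<delta>, \<eta>, 0)"
    have "F' ((0, 0, snd y) + scaleC k (\<delta>, \<eta>, 0)) = F' (0, 0, snd y) + scaleC k (F' (\<delta>, \<eta>, 0))"
      using F' by (simp only: linear_add[OF lin] has_complex_derivative_def)
    then have "H' ((0, 0, snd y) + scaleC k (\<delta>, \<eta>, 0)) = y"
      using d by (simp add: H'_def scaleC_prod_def scaleC_complex_def k_def prod_eq_iff)
    then show ?thesis by blast
  qed
  then have "surj H'" by (metis surjI)
  then show "\<exists>H'. has_complex_derivative H H' p \<and> surj H'" using hd by blast
qed

lemma surface_o_disjoint: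
  assumes "l \<ge> 1"
  shows "surface_o l 1 \<inter> surface_o l (-1) = {}"
proof -
  have False if "(\<kappa>, a, s) \<in> surface_o l 1" "(\<kappa>, a, s) \<in> surface_o l (-1)" for \<kappa> a s
    using that detP_zero_iff[of 1 s l \<kappa> a] detP_zero_iff[of "-1" s l \<kappa> a] assms row_ker_disjoint
    by (auto simp: surface_o_iff)
  then show ?thesis by fastforce
qed

lemma surface_o_axis:
  assumes "l \<ge> 1" "e * e = 1"
  shows "surface_o l e \<inter> {(chi, a, s). chi = 0 \<and> a = 0} = {}"
proof -
  have False if "(0, 0, s) \<in> surface_o l e" for s
    using that detP_zero_iff[of e s l 0 0] assms row_ker_axis by (auto simp: surface_o_iff)
  then show ?thesis by fastforce
qed

section \<open>Parametrization\<close>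

text \<open>The sphere is the projective line of moment sequences with coordinate c 1 / c 0;
  \<open>Infty\<close> is the case c 0 = 0.\<close>

definition coords :: "sphere \<Rightarrow> complex \<times> complex" where
  "coords z = (case z of Finite t \<Rightarrow> (1, t) | Infty \<Rightarrow> (0, 1))"

definition point_of :: "complex \<times> complex \<Rightarrow> sphere" where
  "point_of c = (if fst c = 0 then Infty else Finite (snd c / fst c))"

lemma coords_simps [simp]: "coords (Finite t) = (1, t)" "coords Infty = (0, 1)"
  by (simp_all add: coords_def)

lemma point_of_coords [simp]: "point_of (coords z) = z"
  by (cases z) (simp_all add: point_of_def)

lemma coords_nonzero [simp]: "coords z \<noteq> (0, 0)"
  by (cases z) simp_all

lemma point_of_scale: "r \<noteq> 0 \<Longrightarrow> point_of (r * fst c, r * snd c) = point_of c"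
  by (simp add: point_of_def)

lemma coords_point_of:
  assumes "c \<noteq> (0, 0)"
  obtains r where "r \<noteq> 0" "c = (r * fst (coords (point_of c)), r * snd (coords (point_of c)))"
proof (cases "fst c = 0")
  case True then show ?thesis using assms that[of "snd c"] by (cases c) (auto simp: point_of_def)
next
  case False then show ?thesis using that[of "fst c"] by (cases c) (auto simp: point_of_def)
qed

lemma fdet_scale: "fdet n (\<lambda>i j. r * f i j) = r ^ n * fdet n f"
  unfolding fdet_expand sum_distrib_left by (intro sum.cong refl) (simp add: prod.distrib algebra_simps)

lemma moment_scale: "moment s (r * fst c, r * snd c) k = r * moment s c k"
  using moment_comb[of r s c k 0 c] by simp

lemma toep_scale: "toep n s (r * fst c, r * snd c) = r ^ n * toep n s c"
  unfolding toep_def moment_scale by (rule fdet_scale)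

lemma toep_num_scale: "toep_num n s (r * fst c, r * snd c) = r ^ n * toep_num n s c"
proof -
  have "toep_num n s (r * fst c, r * snd c)
      = fdet n (\<lambda>i j. r * (if j = n - 1 then moment s c (int i + 1) else moment s c (int j - int i)))"
    unfolding toep_num_def moment_scale by (rule fdet_cong) auto
  then show ?thesis unfolding fdet_scale toep_num_def .
qed

definition denom :: "nat \<Rightarrow> complex \<Rightarrow> complex \<times> complex \<Rightarrow> complex" where
  "denom l s c = toep l s c * toep (l + 1) s c"

lemma denom_scale: "denom l s (r * fst c, r * snd c) = r ^ (2 * l + 1) * denom l s c"
  unfolding denom_def toep_scale by (simp add: power_add power_mult power2_eq_square power_mult_distrib)

lemma denom_point_of: "c \<noteq> (0, 0) \<Longrightarrow> denom l s (coords (point_of c)) = 0 \<longleftrightarrow> denom l s c = 0"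
  by (metis coords_point_of denom_scale mult_eq_0_iff power_not_zero)

lemma param_scale: "r \<noteq> 0 \<Longrightarrow> param e l s (r * fst c, r * snd c) = param e l s c"
  unfolding param_def toep_scale toep_num_scale by simp

lemma param_point_of: "c \<noteq> (0, 0) \<Longrightarrow> param e l s (coords (point_of c)) = param e l s c"
  by (metis coords_point_of param_scale)

lemma param_s [simp]: "snd (snd (param e l s c)) = s"
  by (simp add: param_def)

lemma toep_consecutive:
  assumes "s \<noteq> 0" "c \<noteq> (0, 0)"
  shows "toep n s c \<noteq> 0 \<or> toep (n + 1) s c \<noteq> 0"
proof (induction n)
  case (Suc n)
  then show ?case using toep_step(1)[OF assms, of n] by (cases "toep (n + 1) s c = 0") auto
qed simp

lemma toep_num_nonzero:
  assumes "s \<noteq> 0" "c \<noteq> (0, 0)" "n \<ge> 1" "toep n s c = 0"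
  shows "toep_num n s c \<noteq> 0"
proof -
  obtain m where m: "n = m + 1" using assms(3) by (metis add.commute le_iff_add)
  then have "toep m s c \<noteq> 0" using toep_consecutive[OF assms(1,2), of m] assms(4) by auto
  then show ?thesis using toep_step(2)[OF assms(1,2)] assms(4) m by blast
qed

text \<open>A form of degree \<open>n\<close> on the projective line is recorded by its values at \<open>(1, t)\<close> and \<open>(0, 1)\<close> only.\<close>

definition form :: "nat \<Rightarrow> (complex \<times> complex \<Rightarrow> complex) \<Rightarrow> complex poly \<Rightarrow> bool" where
  "form n F P \<longleftrightarrow> Polynomial.degree P \<le> n \<and> (\<forall>t. F (1, t) = poly P t) \<and> F (0, 1) = poly.coeff P n"

lemma coeff_mult_top:
  assumes "Polynomial.degree P \<le> n" "Polynomial.degree Q \<le> m"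
  shows "poly.coeff (P * Q) (n + m) = poly.coeff P n * poly.coeff Q (m::nat)"
proof -
  have "poly.coeff (P * Q) (n + m) = (\<Sum>i\<le>n + m. poly.coeff P i * poly.coeff Q (n + m - i))"
    by (rule coeff_mult)
  also have "\<dots> = (\<Sum>i\<in>{n}. poly.coeff P i * poly.coeff Q (n + m - i))"
  proof (rule sum.mono_neutral_right)
    show "\<forall>i\<in>{..n + m} - {n}. poly.coeff P i * poly.coeff Q (n + m - i) = 0"
    proof
      fix i assume "i \<in> {..n + m} - {n}"
      then have "i > n \<or> n + m - i > m" by auto
      then show "poly.coeff P i * poly.coeff Q (n + m - i) = 0" using assms by (auto simp: coeff_eq_0)
    qed
  qed auto
  finally show ?thesis by simp
qed

lemma form_mult: "form n F P \<Longrightarrow> form m G Q \<Longrightarrow> form (n + m) (\<lambda>c. F c * G c) (P * Q)"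
  unfolding form_def using degree_mult_le[of P Q] coeff_mult_top[of P n Q m] by auto

lemma form_add: "form n F P \<Longrightarrow> form n G Q \<Longrightarrow> form n (\<lambda>c. F c + G c) (P + Q)"
  unfolding form_def by (auto intro: degree_add_le)

lemma form_smult: "form n F P \<Longrightarrow> form n (\<lambda>c. a * F c) (Polynomial.smult a P)"
  unfolding form_def by (auto intro: order_trans[OF degree_smult_le])

lemma form_sum: "(\<And>i. i \<in> I \<Longrightarrow> form n (F i) (P i)) \<Longrightarrow> form n (\<lambda>c. \<Sum>i\<in>I. F i c) (\<Sum>i\<in>I. P i)"
  by (induction I rule: infinite_finite_induct) (auto intro: form_add simp: form_def[of n "\<lambda>_. 0" 0])

lemma form_prod: "finite I \<Longrightarrow> (\<And>i. i \<in> I \<Longrightarrow> form 1 (F i) (P i)) \<Longrightarrow> form (card I) (\<lambda>c. \<Prod>i\<in>I. F i c) (\<Prod>i\<in>I. P i)"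
proof (induction I rule: finite_induct)
  case empty then show ?case by (simp add: form_def)
next
  case (insert i I)
  then show ?case using form_mult[of 1 "F i" "P i" "card I"] by simp
qed

lemma form_moment: "form 1 (\<lambda>c. moment s c k) [:moment s (1, 0) k, moment s (0, 1) k:]"
  unfolding form_def
proof (intro conjI allI)
  show "moment s (1, t) k = poly [:moment s (1, 0) k, moment s (0, 1) k:] t" for t
    using moment_linear[of s 1 t k] by simp
qed simp_all

lemma form_fdet:
  assumes "\<And>i j. i < n \<Longrightarrow> j < n \<Longrightarrow> \<exists>P. form 1 (\<lambda>c. f c i j) P"
  shows "\<exists>P. form n (\<lambda>c. fdet n (f c)) P"
proof -
  obtain P where P: "\<And>i j. i < n \<Longrightarrow> j < n \<Longrightarrow> form 1 (\<lambda>c. f c i j) (P i j)" using assms by metis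
  have "form n (\<lambda>c. fdet n (f c)) (\<Sum>p\<in>{p. p permutes {0..<n}}. Polynomial.smult (signof p) (\<Prod>i\<in>{0..<n}. P i (p i)))"
    unfolding fdet_expand
  proof (intro form_sum form_smult)
    fix p assume p: "p \<in> {p. p permutes {0..<n}}"
    have "form (card {0..<n}) (\<lambda>c. \<Prod>i\<in>{0..<n}. f c i (p i)) (\<Prod>i\<in>{0..<n}. P i (p i))"
      using p permutes_in_image[of p "{0..<n}"] by (intro form_prod P) auto
    then show "form n (\<lambda>c. \<Prod>i\<in>{0..<n}. f c i (p i)) (\<Prod>i\<in>{0..<n}. P i (p i))" by simp
  qed
  then show ?thesis by blast
qed

lemma form_toep: "\<exists>P. form n (toep n s) P" "\<exists>P. form n (toep_num n s) P"
proof -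
  have "\<exists>P. form n (\<lambda>c. fdet n (\<lambda>i j. moment s c (int j - int i))) P"
    by (rule form_fdet) (blast intro: form_moment)
  then show "\<exists>P. form n (toep n s) P" by (simp add: toep_def[abs_def])
  have "\<exists>P. form n (\<lambda>c. fdet n (\<lambda>i j. if j = n - 1 then moment s c (int i + 1) else moment s c (int j - int i))) P"
  proof (rule form_fdet)
    fix i j show "\<exists>P. form 1 (\<lambda>c. if j = n - 1 then moment s c (int i + 1) else moment s c (int j - int i)) P"
      using form_moment[of s "int i + 1"] form_moment[of s "int j - int i"] by (cases "j = n - 1") auto
  qed
  then show "\<exists>P. form n (toep_num n s) P" by (simp add: toep_num_def[abs_def])
qed

text \<open>If \<open>toep n\<close> vanished identically then \<open>toep (n - 1)\<close> would be a form without zeros.\<close>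

lemma form_toep_nonzero:
  assumes s: "s \<noteq> 0" and P: "form n (toep n s) P"
  shows "P \<noteq> 0"
proof
  assume P0: "P = 0"
  have z: "toep n s (1, t) = 0" "toep n s (0, 1) = 0" for t using P P0 by (auto simp: form_def)
  have n: "n \<noteq> 0" using z(2) by (intro notI) simp
  then obtain m where m: "n = m + 1" by (metis Suc_eq_plus1 not0_implies_Suc)
  have m0: "m \<noteq> 0" using z(1) m toep_1[of s "(1, 0)"] by (intro notI) simp
  obtain Q where Q: "form m (toep m s) Q" using form_toep by blast
  have "toep m s c \<noteq> 0" if "c = (1, t) \<or> c = (0, 1)" for c t
    using toep_consecutive[OF s, of c m] z m that by auto
  then have "toep m s (1, t) \<noteq> 0" "toep m s (0, 1) \<noteq> 0" for t by auto
  then have q: "poly Q t \<noteq> 0" "poly.coeff Q m \<noteq> 0" for t using Q by (auto simp: form_def)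
  then have "Polynomial.degree Q \<noteq> 0" using m0 by (metis coeff_eq_0 le_degree not_gr_zero le_zero_eq)
  then have "\<not> constant (poly Q)" by (simp add: constant_degree)
  then show False using fundamental_theorem_of_algebra q(1) by blast
qed

lemma form_denom:
  assumes "s \<noteq> 0"
  obtains P where "form (2 * l + 1) (denom l s) P" "P \<noteq> 0"
proof -
  obtain P Q where "form l (toep l s) P" "form (l + 1) (toep (l + 1) s) Q" using form_toep by metis
  moreover from this have "form (l + (l + 1)) (denom l s) (P * Q)" unfolding denom_def[abs_def] by (intro form_mult)
  ultimately show ?thesis using that[of "P * Q"] form_toep_nonzero[OF assms] by (auto simp: mult_2)
qed

text \<open>A zero at \<open>Infty\<close> is a vanishing top coefficient; it lowers the degree and
  so is paid for by one finite root fewer.\<close>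

lemma form_zeros:
  assumes F: "form n F P" and P: "P \<noteq> 0"
  shows "finite {z. F (coords z) = 0}" "card {z. F (coords z) = 0} \<le> n"
proof -
  have e: "{z. F (coords z) = 0} = Finite ` {t. poly P t = 0} \<union> (if poly.coeff P n = 0 then {Infty} else {})" (is "?Z = ?R")
  proof (rule Set.set_eqI)
    fix z show "z \<in> ?Z \<longleftrightarrow> z \<in> ?R" using F by (cases z) (auto simp: form_def)
  qed
  have fin: "finite {t. poly P t = 0}" using P by (rule poly_roots_finite)
  show "finite {z. F (coords z) = 0}" unfolding e using fin by simp
  have "Polynomial.degree P < n" if "poly.coeff P n = 0"
    using that P F by (metis form_def le_neq_implies_less leading_coeff_0_iff)
  moreover have "card (Finite ` {t. poly P t = 0}) \<le> Polynomial.degree P"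
    using card_poly_roots_bound[OF P] card_image_le[OF fin, of Finite] by linarith
  moreover have "Polynomial.degree P \<le> n" using F by (simp add: form_def)
  ultimately show "card {z. F (coords z) = 0} \<le> n"
    unfolding e using card_Un_le[of "Finite ` {t. poly P t = 0}" "if poly.coeff P n = 0 then {Infty} else {}"]
    by (auto split: if_splits)
qed

section \<open>The parametrization and its holomorphic inverse\<close>

definition poles :: "nat \<Rightarrow> complex \<Rightarrow> sphere set" where
  "poles l s = {z. denom l s (coords z) = 0}"

lemma poles_finite:
  assumes "s \<noteq> 0"
  shows "finite (poles l s)" "card (poles l s) \<le> 2 * l + 1"
  using form_denom[OF assms, of l] form_zeros unfolding poles_def by metis+

definition dom_Phi :: "nat \<Rightarrow> (complex \<times> sphere) set" where
  "dom_Phi l = {(s, z). s \<noteq> 0 \<and> z \<notin> poles l s}"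

lemma dom_PhiI: "s \<noteq> 0 \<Longrightarrow> denom l s c \<noteq> 0 \<Longrightarrow> c \<noteq> (0, 0) \<Longrightarrow> (s, point_of c) \<in> dom_Phi l"
  by (simp add: dom_Phi_def poles_def denom_point_of)

definition Phi :: "complex \<Rightarrow> nat \<Rightarrow> complex \<times> sphere \<Rightarrow> c3" where
  "Phi e l = (\<lambda>(s, z). param e l s (coords z))"

lemma param_in_surface:
  assumes e: "e * e = 1" and l: "l \<ge> 1" and s: "s \<noteq> 0" and t: "denom l s c \<noteq> 0"
  shows "param e l s c \<in> surface_o l e"
proof -
  obtain \<kappa> a where p: "param e l s c = (\<kappa>, a, s)" by (simp add: param_def)
  have "toep l s c \<noteq> 0" "toep (l + 1) s c \<noteq> 0" using t by (auto simp: denom_def)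
  from param_row_ker[OF s e l this p] show ?thesis
    using s p by (metis surface_o_iff detP_zero_iff[OF e s l])
qed

lemma surface_cases:
  assumes e: "e * e = 1" and l: "l \<ge> 1" and p: "(\<kappa>, a, s) \<in> surface_o l e"
  obtains V c where "s \<noteq> 0" "row_ker (int l) e \<kappa> a s V" "V 0 = 1" "c \<noteq> (0, 0)" "orth l s c V"
    "denom l s c \<noteq> 0" "(\<kappa>, a, s) = param e l s c"
proof -
  have s: "s \<noteq> 0" "detP l e (\<kappa>, a, s) = 0" using p by (auto simp: surface_o_iff)
  obtain V where V: "row_ker (int l) e \<kappa> a s V" "V 0 = 1" using detP_zero_iff[OF e s(1) l] s(2) by blast
  obtain c where c: "c \<noteq> (0, 0)" "orth l s c V" using row_ker_ex_orth[OF V(1) s(1) e l] by blast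
  show ?thesis using that[OF s(1) V c] row_ker_orth_param[OF V s(1) e l c] by (simp add: denom_def)
qed

text \<open>Equal images have the same normalized kernel vector, and moment sequences orthogonal to
  it are proportional. Conversely every kernel vector has such a sequence, which gives its point
  back through \<open>row_ker_orth_param\<close>.\<close>

lemma Phi_bij:
  assumes e: "e * e = 1" and l: "l \<ge> 1"
  shows "bij_betw (Phi e l) (dom_Phi l) (surface_o l e)"
  unfolding bij_betw_def
proof
  show "inj_on (Phi e l) (dom_Phi l)"
  proof (rule inj_onI, clarify)
    fix s z s' z' assume d: "(s, z) \<in> dom_Phi l" "(s', z') \<in> dom_Phi l" and eq: "Phi e l (s, z) = Phi e l (s', z')"
    have s: "s = s'" using arg_cong[OF eq, of "\<lambda>p. snd (snd p)"] by (simp add: Phi_def)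
    obtain \<kappa> a where p: "param e l s (coords z) = (\<kappa>, a, s)" by (simp add: param_def)
    have p': "param e l s (coords z') = (\<kappa>, a, s)" using eq p s by (simp add: Phi_def)
    have s0: "s \<noteq> 0" and t: "toep l s (coords z) \<noteq> 0" "toep (l + 1) s (coords z) \<noteq> 0"
      "toep l s (coords z') \<noteq> 0" "toep (l + 1) s (coords z') \<noteq> 0"
      using d s by (auto simp: dom_Phi_def poles_def denom_def)
    obtain V where V: "row_ker (int l) e \<kappa> a s V" "V 0 = 1" "orth l s (coords z) V"
      using param_row_ker[OF s0 e l t(1,2) p] by blast
    obtain V' where V': "row_ker (int l) e \<kappa> a s V'" "V' 0 = 1" "orth l s (coords z') V'"
      using param_row_ker[OF s0 e l t(3,4) p'] by blast
    have "V = V'" using row_ker_unique[OF V(1) V'(1) _ s0 e] V V' by simp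
    then obtain r where r: "coords z = (r * fst (coords z'), r * snd (coords z'))"
      using orth_unique[OF V(1,2) s0 e l V(3), of "coords z'"] V'(3) by auto
    then have "r \<noteq> 0" using coords_nonzero[of z] by (auto simp del: coords_nonzero)
    then have "point_of (coords z) = point_of (coords z')" using r point_of_scale by metis
    then show "s = s' \<and> z = z'" using s by simp
  qed
  show "Phi e l ` dom_Phi l = surface_o l e"
  proof (intro equalityI subsetI)
    fix p assume "p \<in> Phi e l ` dom_Phi l"
    then obtain s z where "p = param e l s (coords z)" "s \<noteq> 0" "denom l s (coords z) \<noteq> 0" by (auto simp: Phi_def dom_Phi_def poles_def)
    then show "p \<in> surface_o l e" using param_in_surface[OF e l] by blast
  next
    fix p assume p: "p \<in> surface_o l e"
    obtain \<kappa> a s where k: "p = (\<kappa>, a, s)" by (cases p)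
    obtain c where c: "s \<noteq> 0" "c \<noteq> (0, 0)" "denom l s c \<noteq> 0" "(\<kappa>, a, s) = param e l s c"
      using surface_cases[OF e l p[unfolded k]] by blast
    then have "p = Phi e l (s, point_of c)" by (simp add: k Phi_def param_point_of)
    then show "p \<in> Phi e l ` dom_Phi l" using dom_PhiI c by blast
  qed
qed

lemma open_nonzero:
  fixes g :: "'a::complex_space \<Rightarrow> complex"
  assumes "open V" "\<And>x. x \<in> V \<Longrightarrow> cdiff g x"
  shows "open {x \<in> V. g x \<noteq> 0}"
proof -
  have "continuous_on V g"
    using assms(2) cdiff_isCont continuous_at_imp_continuous_on by blast
  then have "open (V \<inter> g -` (- {0}))" using assms(1) by (intro continuous_open_preimage) auto
  moreover have "V \<inter> g -` (- {0}) = {x \<in> V. g x \<noteq> 0}" by auto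
  ultimately show ?thesis by simp
qed

lemma sphere_chartE:
  assumes "\<phi> \<in> sphere_charts"
  obtains h where "h = (\<lambda>w. (1, w)) \<or> h = (\<lambda>w. (w, 1))" "\<And>w. \<phi> w = point_of (h w)" "\<And>w. h w \<noteq> (0, 0)" "\<And>w. cdiff h w"
proof -
  have "cdiff (\<lambda>w. (1, w)) w" "cdiff (\<lambda>w. (w, 1)) w" for w :: complex
    by (intro cdiff_Pair cdiff_const cdiff_ident)+
  note c = this
  from assms consider "\<phi> = Finite" | "\<phi> = (\<lambda>w. if w = 0 then Infty else Finite (1 / w))"
    by (auto simp: sphere_charts_def)
  then show ?thesis
  proof cases
    case 1 then show ?thesis using c by (intro that[of "\<lambda>w. (1, w)"]) (auto simp: point_of_def)
  next
    case 2 then show ?thesis using c by (intro that[of "\<lambda>w. (w, 1)"]) (auto simp: point_of_def)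
  qed
qed

lemma point_of_chart_local:
  assumes "open W" "p \<in> W" "\<And>x. x \<in> W \<Longrightarrow> cdiff c x" "c p \<noteq> (0, 0)"
  obtains \<psi> W' h where "\<psi> \<in> sphere_charts" "open W'" "p \<in> W'" "W' \<subseteq> W" "\<And>x. x \<in> W' \<Longrightarrow> cdiff h x"
    "\<And>x. x \<in> W' \<Longrightarrow> point_of (c x) = \<psi> (h x)"
proof (cases "fst (c p) = 0")
  case False
  show ?thesis
  proof (rule that[of Finite "{x \<in> W. fst (c x) \<noteq> 0}" "\<lambda>x. snd (c x) / fst (c x)"])
    show "open {x \<in> W. fst (c x) \<noteq> 0}" using assms by (intro open_nonzero cdiff_fst) auto
  qed (use False assms in \<open>auto intro!: cdiff_divide cdiff_fst cdiff_snd simp: sphere_charts_def point_of_def\<close>)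
next
  case True
  then have s: "snd (c p) \<noteq> 0" using assms by (auto simp: prod_eq_iff)
  show ?thesis
  proof (rule that[of "\<lambda>w. if w = 0 then Infty else Finite (1 / w)" "{x \<in> W. snd (c x) \<noteq> 0}" "\<lambda>x. fst (c x) / snd (c x)"])
    show "open {x \<in> W. snd (c x) \<noteq> 0}" using assms by (intro open_nonzero cdiff_snd) auto
  qed (use s assms in \<open>auto intro!: cdiff_divide cdiff_fst cdiff_snd simp: sphere_charts_def point_of_def\<close>)
qed

text \<open>The inverse extends to an ambient neighbourhood by explicit formulas: a kernel vector
  from cofactors, then the moment sequence orthogonal to it as the solution (- B, A) of a single
  linear equation.\<close>

lemma Phi_local_inverse:
  assumes e: "e * e = 1" and l: "l \<ge> 1" and p: "p \<in> surface_o l e"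
  obtains \<psi> W h where "\<psi> \<in> sphere_charts" "open W" "p \<in> W" "\<And>x. x \<in> W \<Longrightarrow> cdiff h x"
    "\<And>x. x \<in> W \<Longrightarrow> x \<in> surface_o l e \<Longrightarrow> (snd (snd x), \<psi> (h x)) \<in> dom_Phi l \<and> Phi e l (snd (snd x), \<psi> (h x)) = x"
proof -
  obtain \<kappa> a s where k: "p = (\<kappa>, a, s)" by (cases p)
  obtain V where V: "s \<noteq> 0" "row_ker (int l) e \<kappa> a s V" "V 0 = 1"
    using surface_cases[OF e l p[unfolded k]] by blast
  obtain y where y: "(\<Sum>i<l+1. y i * fcof (l + 1) (G_entry l e p) i 0) \<noteq> 0"
    using ex_column[OF V(2,3,1) e l] k by blast
  define w where "w x k = (\<Sum>i<l+1. y i * fcof (l + 1) (G_entry l e x) i k)" for x k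
  define X where "X x = ext0 (l + 1) (w x)" for x
  have cw: "cdiff (\<lambda>x. w x k) x" if "k < l + 1" for x k
    unfolding w_def by (intro cdiff_sum cdiff_mult cdiff_const cdiff_fcof cdiff_G_entry cdiff_ident that) auto
  have cX: "cdiff (\<lambda>x. X x k) x" for x k
    unfolding X_def ext0_def by (rule cdiff_If, rule cw, auto)
  have supX: "supported (int l) (X x)" for x using supported_ext0[of "l + 1"] by (simp add: X_def)
  have X0: "X x 0 = w x 0" for x by (simp add: X_def ext0_def)
  have ker: "row_ker (int l) e (fst x) (fst (snd x)) (snd (snd x)) (X x)"
    if "x \<in> surface_o l e" for x
  proof -
    obtain \<kappa> a s where x: "x = (\<kappa>, a, s)" by (cases x)
    have s: "s \<noteq> 0" "fdet (l + 1) (G_entry l e x) = 0" using that by (auto simp: surface_o_iff x detP_eq)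
    have "(\<Sum>k<l+1. G_entry l e x i k * X x (int k)) = 0" if i: "i < l + 1" for i
    proof -
      have "(\<Sum>k<l+1. G_entry l e x i k * X x (int k)) = (\<Sum>k<l+1. G_entry l e x i k * w x k)"
        by (intro sum.cong refl) (simp add: X_def)
      also have "\<dots> = y i * fdet (l + 1) (G_entry l e x)" unfolding w_def by (rule fdet_adj[OF i])
      finally show ?thesis using s by simp
    qed
    then have "\<forall>i<l+1. (\<Sum>k<l+1. G_entry l e (\<kappa>, a, s) i k * X x (int k)) = 0" unfolding x by blast
    then show ?thesis using row_ker_iff[OF supX e s(1) l] by (simp add: x)
  qed
  define A where "A x k = mpair (int l) (moment (snd (snd x)) (1, 0)) (X x) k" for x :: c3 and k
  define B where "B x k = mpair (int l) (moment (snd (snd x)) (0, 1)) (X x) k" for x :: c3 and k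
  have AB: "mpair (int l) (moment (snd (snd x)) c) (X x) k = fst c * A x k + snd c * B x k" for x c k
  proof -
    have "moment (snd (snd x)) c = (\<lambda>k. fst c * moment (snd (snd x)) (1, 0) k + snd c * moment (snd (snd x)) (0, 1) k)"
      using moment_linear[of "snd (snd x)" "fst c" "snd c"] by (intro ext) simp
    then show ?thesis unfolding A_def B_def pair_lin_moment[symmetric] by (rule arg_cong)
  qed
  have kp: "row_ker (int l) e \<kappa> a s (\<lambda>k. (1 / X p 0) * X p k)" "(1 / X p 0) * X p 0 = 1"
    using row_ker_scale[OF ker[OF p], of "1 / X p 0"] y by (simp_all add: k X0 w_def)
  have scale_orth: "orth l s c (\<lambda>k. r * V k) \<longleftrightarrow> orth l s c V" if "r \<noteq> 0" for r s c V
  proof -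
    have "mpair (int l) (moment s c) (\<lambda>k. r * V k) j = r * mpair (int l) (moment s c) V j" for j
      unfolding mpair_def sum_distrib_left by (simp only: mult.assoc)
    then show ?thesis using that by (simp add: orth_def)
  qed
  have X0p: "X p 0 \<noteq> 0" using y by (simp add: X0 w_def)
  \<comment> \<open>If all pairings vanished at p, both basis sequences would be orthogonal to the
    same kernel vector, against \<open>orth_unique\<close>.\<close>
  obtain j where j: "1 \<le> j" "j \<le> int l" "A p j \<noteq> 0 \<or> B p j \<noteq> 0"
  proof (rule ccontr)
    assume nt: "\<not> thesis"
    note ob = that
    have "A p i = 0 \<and> B p i = 0" if "1 \<le> i" "i \<le> int l" for i using nt ob[OF that] by auto
    then have "orth l s (1, 0) (X p)" "orth l s (0, 1) (X p)" by (auto simp: orth_def k A_def B_def)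
    then obtain r where "(1, 0) = (r * fst (0, 1), r * snd (0, 1 :: complex))"
      using orth_unique[OF kp V(1) e l, of "(1, 0)" "(0, 1)"] scale_orth[of "1 / X p 0"] X0p by auto
    then show False by simp
  qed
  define c where "c x = (- B x j, A x j)" for x
  define W0 where "W0 = {x :: c3. snd (snd x) \<noteq> 0}"
  have cA: "cdiff (\<lambda>x. A x j) x" and cB: "cdiff (\<lambda>x. B x j) x" if "x \<in> W0" for x
    unfolding A_def B_def mpair_def
    using that by (auto intro!: cdiff_sum cdiff_mult cX cdiff_moment cdiff_snd cdiff_const cdiff_ident simp: W0_def)
  define W where "W = {x \<in> W0. X x 0 \<noteq> 0} \<inter> ({x \<in> W0. A x j \<noteq> 0} \<union> {x \<in> W0. B x j \<noteq> 0})"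
  have oW0: "open W0" using open_s_nonzero by (simp add: W0_def)
  have oW: "open W" unfolding W_def by (intro open_Int open_Un open_nonzero[OF oW0] cA cB cX)
  have pW: "p \<in> W" using j X0p V(1) by (auto simp: W_def W0_def k)
  have cc: "cdiff c x" if "x \<in> W" for x
    unfolding c_def using that by (intro cdiff_Pair cdiff_minus cA cB) (auto simp: W_def)
  have c0: "c x \<noteq> (0, 0)" if "x \<in> W" for x using that by (auto simp: W_def c_def)
  have inv: "(snd (snd x), point_of (c x)) \<in> dom_Phi l \<and> Phi e l (snd (snd x), point_of (c x)) = x"
    if x: "x \<in> W" "x \<in> surface_o l e" for x
  proof -
    obtain \<kappa> a s where k: "x = (\<kappa>, a, s)" by (cases x)
    have s: "s \<noteq> 0" and Xx: "X x 0 \<noteq> 0" and ABx: "A x j \<noteq> 0 \<or> B x j \<noteq> 0"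
      using x by (auto simp: W_def W0_def k)
    define r where "r = 1 / X x 0"
    have r: "r \<noteq> 0" using Xx by (simp add: r_def)
    have K: "row_ker (int l) e \<kappa> a s (\<lambda>k. r * X x k)" "r * X x 0 = 1"
      using row_ker_scale[OF ker[OF x(2)], of r] Xx by (simp_all add: k r_def)
    obtain d where d: "d \<noteq> (0, 0)" "orth l s d (\<lambda>k. r * X x k)"
      using row_ker_ex_orth[OF K(1) s e l] by blast
    then have d': "fst d * A x i + snd d * B x i = 0" if "1 \<le> i" "i \<le> int l" for i
      using that AB[of x d i] scale_orth[OF r] by (simp add: orth_def k)
    \<comment> \<open>Both c x and the orthogonal sequence d solve equation j, which is nontrivial
      on \<open>W\<close>, so they are proportional; d solves the other equations, hence c x
      does.\<close>
    have "\<exists>q. c x = (q * fst d, q * snd d)"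
    proof (cases "fst d = 0")
      case True
      then have "snd d \<noteq> 0" "B x j = 0" using d(1) d'[OF j(1,2)] by (auto simp: prod_eq_iff)
      then show ?thesis using True by (intro exI[of _ "A x j / snd d"]) (simp add: c_def)
    next
      case False
      then have "A x j = - (B x j / fst d) * snd d" using d'[OF j(1,2)] by (simp add: field_simps add_eq_0_iff2)
      then show ?thesis using False by (intro exI[of _ "- (B x j / fst d)"]) (simp add: c_def)
    qed
    then obtain q where q: "c x = (q * fst d, q * snd d)" by blast
    have "fst (c x) * A x i + snd (c x) * B x i = q * (fst d * A x i + snd d * B x i)" for i
      unfolding q by (simp add: algebra_simps)
    then have "orth l s (c x) (X x)" using d' AB[of x "c x"] by (simp add: orth_def k)
    then have o: "orth l s (c x) (\<lambda>k. r * X x k)" using scale_orth[OF r] by blast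
    note t = row_ker_orth_param[OF K s e l c0[OF x(1)] o]
    have "denom l s (c x) \<noteq> 0" using t(1,2) by (simp add: denom_def)
    then have "(s, point_of (c x)) \<in> dom_Phi l" using dom_PhiI[OF s _ c0[OF x(1)]] by blast
    moreover have "Phi e l (s, point_of (c x)) = x"
      unfolding Phi_def prod.case param_point_of[OF c0[OF x(1)]] by (rule t(3)[folded k, symmetric])
    moreover have "snd (snd x) = s" by (simp add: k)
    ultimately show ?thesis by simp
  qed
  obtain \<psi> W' h where h: "\<psi> \<in> sphere_charts" "open W'" "p \<in> W'" "W' \<subseteq> W" "\<And>x. x \<in> W' \<Longrightarrow> cdiff h x"
    "\<And>x. x \<in> W' \<Longrightarrow> point_of (c x) = \<psi> (h x)"
    using point_of_chart_local[OF oW pW cc c0[OF pW]] by metis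
  show ?thesis
  proof (rule that[OF h(1-3,5)])
    fix x assume x: "x \<in> W'" "x \<in> surface_o l e"
    show "(snd (snd x), \<psi> (h x)) \<in> dom_Phi l \<and> Phi e l (snd (snd x), \<psi> (h x)) = x"
      unfolding h(6)[OF x(1), symmetric] using inv[of x] x h(4) by blast
  qed
qed

lemma holomorphic_mapI:
  assumes "\<And>\<phi> u. \<phi> \<in> A \<Longrightarrow> \<phi> u \<in> U \<Longrightarrow>
    \<exists>\<psi>\<in>B. \<exists>V h. open V \<and> u \<in> V \<and> (\<forall>v\<in>V. cdiff h v \<and> (\<phi> v \<in> U \<longrightarrow> f (\<phi> v) = \<psi> (h v)))"
  shows "holomorphic_map A B U f"
  using assms unfolding holomorphic_map_def holo_on_iff_cdiff by meson

lemma cdiff_param: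
  assumes "cdiff S x" "cdiff C x" "S x \<noteq> 0" "denom l (S x) (C x) \<noteq> 0"
  shows "cdiff (\<lambda>x. param e l (S x) (C x)) x"
  unfolding param_def using assms
  by (intro cdiff_Pair cdiff_divide cdiff_mult cdiff_const cdiff_minus cdiff_toep) (auto simp: denom_def)

lemma cdiff_denom:
  assumes "cdiff S x" "cdiff C x" "S x \<noteq> 0"
  shows "cdiff (\<lambda>x. denom l (S x) (C x)) x"
  unfolding denom_def using assms by (intro cdiff_mult cdiff_toep)

lemma Phi_biholomorphic:
  assumes e: "e * e = 1" and l: "l \<ge> 1"
  shows "biholomorphic_map plane_sphere_charts c3_charts (dom_Phi l) (surface_o l e) (Phi e l)"
  unfolding biholomorphic_map_def
proof (intro conjI)
  note bij = Phi_bij[OF e l]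
  then show "bij_betw (Phi e l) (dom_Phi l) (surface_o l e)" .
  show "holomorphic_map plane_sphere_charts c3_charts (dom_Phi l) (Phi e l)"
  proof (rule holomorphic_mapI)
    fix \<phi> u assume "\<phi> \<in> plane_sphere_charts" and u: "\<phi> u \<in> dom_Phi l"
    then obtain \<phi>' where \<phi>': "\<phi> = map_prod id \<phi>'" "\<phi>' \<in> sphere_charts" by (auto simp: plane_sphere_charts_def)
    obtain h where h: "\<And>w. \<phi>' w = point_of (h w)" "\<And>w. h w \<noteq> (0, 0)" "\<And>w. cdiff h w"
      using sphere_chartE[OF \<phi>'(2)] by metis
    have ch: "cdiff (\<lambda>x. h (snd x)) x" for x :: "complex \<times> complex"
      by (rule cdiff_compose[of snd]) (use h cdiff_snd[of "\<lambda>x. x"] in auto)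
    define W0 where "W0 = {x :: complex \<times> complex. fst x \<noteq> 0}"
    have o0: "open W0" unfolding W0_def by (intro open_Collect_neq continuous_intros)
    define W where "W = {x \<in> W0. denom l (fst x) (h (snd x)) \<noteq> 0}"
    have oW: "open W" unfolding W_def
      by (rule open_nonzero[OF o0]) (auto intro!: cdiff_denom ch cdiff_fst simp: W0_def)
    have dom: "\<phi> v \<in> dom_Phi l \<longleftrightarrow> v \<in> W" for v
      using h(2) by (cases v) (simp add: \<phi>'(1) h(1) dom_Phi_def poles_def W_def W0_def denom_point_of)
    have "cdiff (\<lambda>x. param e l (fst x) (h (snd x))) v" if "v \<in> W" for v
      using that by (auto intro!: cdiff_param ch cdiff_fst simp: W0_def W_def)
    moreover have "Phi e l (\<phi> v) = id (param e l (fst v) (h (snd v)))" for v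
      using h(2) by (cases v) (simp add: \<phi>'(1) h(1) Phi_def param_point_of)
    ultimately show "\<exists>\<psi>\<in>c3_charts. \<exists>V h. open V \<and> u \<in> V \<and>
        (\<forall>v\<in>V. cdiff h v \<and> (\<phi> v \<in> dom_Phi l \<longrightarrow> Phi e l (\<phi> v) = \<psi> (h v)))"
      using oW u dom unfolding c3_charts_def by blast
  qed
  show "holomorphic_map c3_charts plane_sphere_charts (surface_o l e) (the_inv_into (dom_Phi l) (Phi e l))"
  proof (rule holomorphic_mapI)
    fix \<phi> :: "c3 \<Rightarrow> c3" and p assume "\<phi> \<in> c3_charts" "\<phi> p \<in> surface_o l e"
    then have \<phi>: "\<phi> = id" and p: "p \<in> surface_o l e" by (auto simp: c3_charts_def)
    obtain \<psi> W h where h: "\<psi> \<in> sphere_charts" "open W" "p \<in> W" "\<And>x. x \<in> W \<Longrightarrow> cdiff h x"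
      "\<And>x. x \<in> W \<Longrightarrow> x \<in> surface_o l e \<Longrightarrow> (snd (snd x), \<psi> (h x)) \<in> dom_Phi l \<and> Phi e l (snd (snd x), \<psi> (h x)) = x"
      using Phi_local_inverse[OF e l p] by metis
    have "cdiff (\<lambda>x. (snd (snd x), h x)) x" if "x \<in> W" for x
      using h(4)[OF that] by (auto intro!: cdiff_Pair cdiff_snd)
    moreover have "the_inv_into (dom_Phi l) (Phi e l) x = map_prod id \<psi> (snd (snd x), h x)"
      if "x \<in> W" "x \<in> surface_o l e" for x
      using that h(5)[of x] bij by (intro the_inv_into_f_eq) (auto simp: bij_betw_def)
    ultimately show "\<exists>\<psi>\<in>plane_sphere_charts. \<exists>V h. open V \<and> p \<in> V \<and>
        (\<forall>v\<in>V. cdiff h v \<and> (\<phi> v \<in> surface_o l e \<longrightarrow> the_inv_into (dom_Phi l) (Phi e l) (\<phi> v) = \<psi> (h v)))"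
      using h(1-3) unfolding \<phi> plane_sphere_charts_def
      by (intro bexI[of _ "map_prod id \<psi>"] exI[of _ W] exI[of _ "\<lambda>x. (snd (snd x), h x)"]) auto
  qed
qed

text \<open>The local inverse of the whole surface preserves s, so its sphere component inverts the
  fiber map.\<close>

lemma fiber_biholomorphic:
  assumes e: "e * e = 1" and l: "l \<ge> 1" and s: "s \<noteq> 0"
  shows "biholomorphic_map sphere_charts c3_charts (- poles l s) (surface_fiber l e s) (\<lambda>z. param e l s (coords z))"
  unfolding biholomorphic_map_def
proof (intro conjI)
  let ?f = "\<lambda>z. param e l s (coords z)"
  have dom: "z \<in> - poles l s \<longleftrightarrow> (s, z) \<in> dom_Phi l" for z using s by (simp add: dom_Phi_def)
  have f: "?f z = Phi e l (s, z)" for z by (simp add: Phi_def)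
  have inj: "inj_on ?f (- poles l s)"
  proof (rule inj_onI)
    fix z z' assume z: "z \<in> - poles l s" "z' \<in> - poles l s" "?f z = ?f z'"
    have "inj_on (Phi e l) (dom_Phi l)" using Phi_bij[OF e l] by (simp add: bij_betw_def)
    then have "(s, z) = (s, z')" using z(3,1,2) unfolding dom f by (rule inj_onD)
    then show "z = z'" by simp
  qed
  have img: "?f ` (- poles l s) = surface_fiber l e s"
  proof (intro equalityI subsetI)
    fix p assume "p \<in> ?f ` (- poles l s)"
    then obtain z where z: "z \<notin> poles l s" "p = ?f z" by auto
    then show "p \<in> surface_fiber l e s"
      using param_in_surface[OF e l s, of "coords z"] by (simp add: surface_fiber_def poles_def s_coord_def case_prod_unfold)
  next
    fix p assume p: "p \<in> surface_fiber l e s"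
    then have "p \<in> Phi e l ` dom_Phi l" using Phi_bij[OF e l] by (simp add: bij_betw_def surface_fiber_def)
    then obtain s' z where z: "(s', z) \<in> dom_Phi l" "p = param e l s' (coords z)" by (auto simp: Phi_def)
    then have "s' = s" using p by (simp add: surface_fiber_def s_coord_def param_def)
    then show "p \<in> ?f ` (- poles l s)" using z by (auto simp: dom_Phi_def)
  qed
  show "bij_betw ?f (- poles l s) (surface_fiber l e s)" using inj img by (simp add: bij_betw_def)
  show "holomorphic_map sphere_charts c3_charts (- poles l s) ?f"
  proof (rule holomorphic_mapI)
    fix \<phi> u assume \<phi>: "\<phi> \<in> sphere_charts" and u: "\<phi> u \<in> - poles l s"
    obtain h where h: "\<And>w. \<phi> w = point_of (h w)" "\<And>w. h w \<noteq> (0, 0)" "\<And>w. cdiff h w"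
      using sphere_chartE[OF \<phi>] by metis
    define W where "W = {x \<in> UNIV. denom l s (h x) \<noteq> 0}"
    have oW: "open W" unfolding W_def by (rule open_nonzero) (auto intro!: cdiff_denom h s)
    have dom: "\<phi> v \<in> - poles l s \<longleftrightarrow> v \<in> W" for v
      using h(2) by (simp add: h(1) poles_def W_def denom_point_of)
    have "cdiff (\<lambda>x. param e l s (h x)) v" if "v \<in> W" for v
      using that by (auto intro!: cdiff_param h s simp: W_def)
    moreover have "?f (\<phi> v) = id (param e l s (h v))" for v using h(2) by (simp add: h(1) param_point_of)
    ultimately show "\<exists>\<psi>\<in>c3_charts. \<exists>V h. open V \<and> u \<in> V \<and>
        (\<forall>v\<in>V. cdiff h v \<and> (\<phi> v \<in> - poles l s \<longrightarrow> ?f (\<phi> v) = \<psi> (h v)))"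
      using oW u dom unfolding c3_charts_def by blast
  qed
  show "holomorphic_map c3_charts sphere_charts (surface_fiber l e s) (the_inv_into (- poles l s) ?f)"
  proof (rule holomorphic_mapI)
    fix \<phi> :: "c3 \<Rightarrow> c3" and p assume "\<phi> \<in> c3_charts" "\<phi> p \<in> surface_fiber l e s"
    then have \<phi>: "\<phi> = id" and p: "p \<in> surface_o l e" by (auto simp: c3_charts_def surface_fiber_def)
    obtain \<psi> W h where h: "\<psi> \<in> sphere_charts" "open W" "p \<in> W" "\<And>x. x \<in> W \<Longrightarrow> cdiff h x"
      "\<And>x. x \<in> W \<Longrightarrow> x \<in> surface_o l e \<Longrightarrow> (snd (snd x), \<psi> (h x)) \<in> dom_Phi l \<and> Phi e l (snd (snd x), \<psi> (h x)) = x"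
      using Phi_local_inverse[OF e l p] by metis
    have "the_inv_into (- poles l s) ?f x = \<psi> (h x)" if x: "x \<in> W" "x \<in> surface_fiber l e s" for x
    proof (rule the_inv_into_f_eq[OF inj])
      have "snd (snd x) = s" "x \<in> surface_o l e" using x by (auto simp: surface_fiber_def s_coord_def case_prod_unfold)
      then show "?f (\<psi> (h x)) = x" "\<psi> (h x) \<in> - poles l s" using h(5)[OF x(1)] unfolding f dom by auto
    qed
    then show "\<exists>\<psi>\<in>sphere_charts. \<exists>V h. open V \<and> p \<in> V \<and>
        (\<forall>v\<in>V. cdiff h v \<and> (\<phi> v \<in> surface_fiber l e s \<longrightarrow> the_inv_into (- poles l s) ?f (\<phi> v) = \<psi> (h v)))"
      using h(1-4) unfolding \<phi> by (intro bexI[of _ \<psi>] exI[of _ W] exI[of _ h]) auto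
  qed
qed

section \<open>Fibration and generic hyperplane sections\<close>

lemma surface_fiber_eq:
  assumes "e * e = 1" "l \<ge> 1" "s \<noteq> 0"
  shows "surface_fiber l e s = (\<lambda>z. param e l s (coords z)) ` (- poles l s)"
    and "inj_on (\<lambda>z. param e l s (coords z)) (- poles l s)"
  using fiber_biholomorphic[OF assms] by (auto simp: biholomorphic_map_def bij_betw_def)

lemma infinite_sphere: "infinite (UNIV :: sphere set)"
proof
  assume "finite (UNIV :: sphere set)"
  then have "finite (range Finite)" by (rule finite_subset[rotated]) simp
  then show False using infinite_UNIV_char_0 by (auto simp: finite_image_iff inj_on_def)
qed

lemma ex_nonpole: "s \<noteq> 0 \<Longrightarrow> \<exists>z. z \<notin> poles l s"
  using poles_finite(1)[of s l] infinite_sphere by (metis UNIV_I ex_new_if_finite)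

lemma fibration:
  assumes e: "e * e = 1" and l: "l \<ge> 1"
  shows "holomorphic_fibration (surface_o l e) (- {0}) s_coord"
  unfolding holomorphic_fibration_def
proof (intro conjI ballI)
  show "s_coord ` surface_o l e = - {0}"
  proof (intro equalityI subsetI)
    fix s assume "s \<in> s_coord ` surface_o l e"
    then show "s \<in> - {0}" by (auto simp: surface_o_def)
  next
    fix s :: complex assume s: "s \<in> - {0}"
    then obtain z where "z \<notin> poles l s" using ex_nonpole by blast
    then have "param e l s (coords z) \<in> surface_o l e" using param_in_surface[OF e l] s by (simp add: poles_def)
    moreover have "s_coord (param e l s (coords z)) = s" by (simp add: s_coord_def param_def)
    ultimately show "s \<in> s_coord ` surface_o l e" by force
  qed
next
  fix p assume p: "p \<in> surface_o l e"
  obtain \<kappa> a s where k: "p = (\<kappa>, a, s)" by (cases p)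
  obtain c where c: "s \<noteq> 0" "denom l s c \<noteq> 0" "p = param e l s c"
    using surface_cases[OF e l p[unfolded k]] k by metis
  have "v \<in> (\<lambda>v. snd (snd v)) ` tangent_space (surface_o l e) p" for v
  proof -
    \<comment> \<open>The moment sequence stays fixed while s moves with velocity v. Near \<tau> = 0
      the denominator stays nonzero, so this is a curve in the surface with tangent vector over
      v.\<close>
    define S where "S \<tau> = s + \<tau> * v" for \<tau>
    define \<gamma> where "\<gamma> \<tau> = param e l (S \<tau>) c" for \<tau>
    have cS: "cdiff S \<tau>" for \<tau> unfolding S_def by (intro cdiff_add cdiff_mult cdiff_const cdiff_ident)
    define U where "U = {\<tau> \<in> {\<tau> \<in> UNIV. S \<tau> \<noteq> 0}. denom l (S \<tau>) c \<noteq> 0}"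
    have "open {\<tau> \<in> UNIV. S \<tau> \<noteq> 0}" using cS by (intro open_nonzero) auto
    then have "open U" unfolding U_def by (rule open_nonzero) (auto intro!: cdiff_denom cS)
    moreover have "0 \<in> U" using c by (simp add: U_def S_def)
    ultimately obtain r where r: "r > 0" "ball 0 r \<subseteq> U" by (meson openE)
    have cg: "cdiff \<gamma> \<tau>" if "\<tau> \<in> U" for \<tau>
      unfolding \<gamma>_def using that by (intro cdiff_param cS cdiff_const) (auto simp: U_def)
    obtain g' where g': "(\<gamma> has_derivative g') (at 0)" "\<And>c v. g' (scaleC c v) = scaleC c (g' v)"
      using cg[OF \<open>0 \<in> U\<close>] by (rule cdiffE) blast
    have g1: "g' t = scaleC t (g' 1)" for t using g'(2)[of t 1] by (simp add: scaleC_complex_def)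
    have "has_complex_derivative \<gamma> (\<lambda>t. scaleC t (g' 1)) 0"
      using g' unfolding has_complex_derivative_def g1[symmetric] by simp
    moreover have "holo_on \<gamma> (ball 0 r)" using cg r by (auto simp: holo_on_iff_cdiff)
    moreover have "\<gamma> ` ball 0 r \<subseteq> surface_o l e"
      using r param_in_surface[OF e l] unfolding \<gamma>_def U_def by blast
    moreover have "\<gamma> 0 = p" using c by (simp add: \<gamma>_def S_def)
    ultimately have "g' 1 \<in> tangent_space (surface_o l e) p" unfolding tangent_space_def using r(1) by blast
    moreover have "snd (snd (g' 1)) = v"
    proof -
      have "((\<lambda>\<tau>. snd (snd (\<gamma> \<tau>))) has_derivative (\<lambda>\<tau>. snd (snd (g' \<tau>)))) (at 0)"
        by (intro has_derivative_snd g'(1))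
      then have "(S has_derivative (\<lambda>\<tau>. snd (snd (g' \<tau>)))) (at 0)" by (simp add: \<gamma>_def)
      moreover have "(S has_derivative (\<lambda>\<tau>. \<tau> * v)) (at 0)"
        unfolding S_def by (auto intro!: derivative_eq_intros)
      ultimately have "(\<lambda>\<tau>. snd (snd (g' \<tau>))) = (\<lambda>\<tau>. \<tau> * v)" by (rule has_derivative_unique)
      then show ?thesis by (metis mult_1)
    qed
    ultimately show ?thesis by force
  qed
  then have "(\<lambda>v. snd (snd v)) ` tangent_space (surface_o l e) p = UNIV" by blast
  moreover have "has_complex_derivative s_coord (\<lambda>v. snd (snd v)) p"
    unfolding has_complex_derivative_def s_coord_def case_prod_unfold
    by (auto intro!: derivative_eq_intros simp: scaleC_prod_def)
  ultimately show "\<exists>\<pi>'. has_complex_derivative s_coord \<pi>' p \<and> \<pi>' ` tangent_space (surface_o l e) p = UNIV"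
    by blast
qed

text \<open>In a chart, \<open>denom\<close> is an equation over a whole disc of values of s that
  avoids 0. It is not identically zero because each fiber has finitely many poles.\<close>

lemma hypersurface:
  "analytic_hypersurface plane_sphere_charts ((- {0}) \<times> UNIV) {(s, z). s \<noteq> 0 \<and> z \<in> poles l s}"
  unfolding analytic_hypersurface_def
proof (intro conjI ballI allI impI)
  show "{(s, z). s \<noteq> 0 \<and> z \<in> poles l s} \<subseteq> (- {0}) \<times> UNIV" by auto
  fix \<phi> u assume "\<phi> \<in> plane_sphere_charts" and u: "\<phi> u \<in> (- {0}) \<times> UNIV"
  then obtain \<phi>' where \<phi>': "\<phi> = map_prod id \<phi>'" "\<phi>' \<in> sphere_charts" by (auto simp: plane_sphere_charts_def)
  obtain h where h0: "h = (\<lambda>w. (1, w)) \<or> h = (\<lambda>w. (w, 1))"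
    and h: "\<And>w. \<phi>' w = point_of (h w)" "\<And>w. h w \<noteq> (0, 0)" "\<And>w. cdiff h w"
    using sphere_chartE[OF \<phi>'(2)] by metis
  have ch: "cdiff (\<lambda>x. h (snd x)) x" for x :: "complex \<times> complex"
    by (rule cdiff_compose[of snd]) (use h cdiff_snd[of "\<lambda>x. x"] in auto)
  define s where "s = fst u"
  have s: "s \<noteq> 0" using u by (cases u) (auto simp: \<phi>'(1) s_def)
  define V where "V = ball s (norm s) \<times> (UNIV :: complex set)"
  have V0: "fst v \<noteq> 0" if "v \<in> V" for v using that by (auto simp: V_def dist_norm)
  have "open V" unfolding V_def by (intro open_Times) auto
  moreover have "connected V" unfolding V_def by (intro connected_Times) auto
  moreover have "u \<in> V" using s by (cases u) (simp add: V_def s_def)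
  moreover have "\<phi> ` V \<subseteq> (- {0}) \<times> UNIV" using V0 by (auto simp: \<phi>'(1))
  moreover have "holo_on (\<lambda>x. denom l (fst x) (h (snd x))) V"
    unfolding holo_on_iff_cdiff using V0 by (auto intro!: cdiff_denom ch cdiff_fst)
  moreover have "\<exists>v\<in>V. denom l (fst v) (h (snd v)) \<noteq> 0"
  proof -
    have "finite {w. \<phi>' w \<in> poles l s}"
    proof (rule finite_vimageI[OF poles_finite(1)[OF s], of \<phi>' l, unfolded vimage_def])
      show "inj \<phi>'" using h0 unfolding h(1) by (auto simp: inj_on_def point_of_def split: if_splits)
    qed
    then obtain w where "\<phi>' w \<notin> poles l s" using ex_new_if_finite[OF infinite_UNIV_char_0] by blast
    then have "denom l s (h w) \<noteq> 0" using h(2) by (simp add: h(1) poles_def denom_point_of)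
    moreover have "(s, w) \<in> V" using s by (simp add: V_def)
    ultimately show ?thesis by force
  qed
  moreover have "\<forall>v\<in>V. \<phi> v \<in> {(s, z). s \<noteq> 0 \<and> z \<in> poles l s} \<longleftrightarrow> denom l (fst v) (h (snd v)) = 0"
    using V0 h(2) by (auto simp: \<phi>'(1) h(1) poles_def denom_point_of)
  ultimately show "\<exists>V (F :: complex \<times> complex \<Rightarrow> complex). open V \<and> connected V \<and> u \<in> V \<and> \<phi> ` V \<subseteq> (- {0}) \<times> UNIV \<and>
           holo_on F V \<and> (\<exists>v\<in>V. F v \<noteq> 0) \<and> (\<forall>v\<in>V. \<phi> v \<in> {(s, z). s \<noteq> 0 \<and> z \<in> poles l s} \<longleftrightarrow> F v = 0)"
    by blast
qed

section \<open>Homogeneous coordinates of the fibers\<close>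

definition hom_param1 :: "complex \<Rightarrow> nat \<Rightarrow> complex \<Rightarrow> complex \<times> complex \<Rightarrow> complex" where
  "hom_param1 e l s c = e / 2 * (toep_num l s c * toep (l + 1) s c)"

definition hom_param2 :: "complex \<Rightarrow> nat \<Rightarrow> complex \<Rightarrow> complex \<times> complex \<Rightarrow> complex" where
  "hom_param2 e l s c = - s * e * (toep l s c * toep_num (l + 1) s c)"

definition hom_param :: "complex \<Rightarrow> nat \<Rightarrow> complex \<Rightarrow> complex \<times> complex \<Rightarrow> c4" where
  "hom_param e l s c = (hom_param1 e l s c, hom_param2 e l s c, s * denom l s c, denom l s c)"

lemma param_eq_hom_param:
  "denom l s c \<noteq> 0 \<Longrightarrow> param e l s c = (hom_param1 e l s c / denom l s c, hom_param2 e l s c / denom l s c, s)"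
  by (simp add: param_def hom_param1_def hom_param2_def denom_def)

text \<open>At a pole exactly one of \<open>toep l\<close>, \<open>toep (l + 1)\<close> vanishes,
  and the corresponding numerator does not. Hence every pole goes to [1:0:0:0] or [0:1:0:0].\<close>

lemma hom_param_at_pole:
  assumes s: "s \<noteq> 0" and e: "e * e = 1" and l: "l \<ge> 1" and c: "c \<noteq> (0, 0)" and t: "denom l s c = 0"
  shows "hom_param1 e l s c = 0 \<longleftrightarrow> hom_param2 e l s c \<noteq> 0"
proof -
  have "e \<noteq> 0" using e by auto
  then show ?thesis
    using toep_num_nonzero[OF s c, of l] toep_num_nonzero[OF s c, of "l + 1"] toep_consecutive[OF s c, of l] l t s
    by (auto simp: hom_param1_def hom_param2_def denom_def)
qed

lemma hom_param_nonzero: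
  assumes "s \<noteq> 0" "e * e = 1" "l \<ge> 1" "c \<noteq> (0, 0)"
  shows "hom_param e l s c \<noteq> 0"
  using hom_param_at_pole[OF assms] by (auto simp: hom_param_def zero_prod_def)

lemma hom_param_scale: "hom_param e l s (r * fst c, r * snd c) = scaleC (r ^ (2 * l + 1)) (hom_param e l s c)"
proof -
  have p: "r ^ (2 * l + 1) = r ^ l * r ^ (l + 1)" by (simp add: power_add[symmetric] mult_2)
  have "hom_param1 e l s (r * fst c, r * snd c) = r ^ (2 * l + 1) * hom_param1 e l s c"
    unfolding hom_param1_def toep_scale toep_num_scale p by (simp only: mult_ac)
  moreover have "hom_param2 e l s (r * fst c, r * snd c) = r ^ (2 * l + 1) * hom_param2 e l s c"
    unfolding hom_param2_def toep_scale toep_num_scale p by (simp only: mult_ac)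
  ultimately show ?thesis
    unfolding hom_param_def denom_scale scaleC_prod_def scaleC_complex_def by (simp only: fst_conv snd_conv mult_ac)
qed

lemma hom_param_forms:
  assumes "s \<noteq> 0"
  obtains P1 P2 P4 where "form (2 * l + 1) (hom_param1 e l s) P1" "form (2 * l + 1) (hom_param2 e l s) P2"
    "form (2 * l + 1) (denom l s) P4" "P4 \<noteq> 0"
proof -
  obtain A A' B B' where F: "form l (toep l s) A" "form (l + 1) (toep (l + 1) s) A'"
    "form l (toep_num l s) B" "form (l + 1) (toep_num (l + 1) s) B'"
    using form_toep by metis
  have n: "l + (l + 1) = 2 * l + 1" by simp
  obtain P4 where "form (2 * l + 1) (denom l s) P4" "P4 \<noteq> 0" using form_denom[OF assms] by blast
  moreover have "form (2 * l + 1) (hom_param1 e l s) (Polynomial.smult (e / 2) (B * A'))"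
    using form_smult[OF form_mult[OF F(3,2)], of "e / 2"] unfolding n hom_param1_def[abs_def] .
  moreover have "form (2 * l + 1) (hom_param2 e l s) (Polynomial.smult (- s * e) (A * B'))"
    using form_smult[OF form_mult[OF F(1,4)], of "- s * e"] unfolding n hom_param2_def[abs_def] .
  ultimately show ?thesis by (rule that[rotated 2])
qed

lemma fiber_rational:
  assumes e: "e * e = 1" and l: "l \<ge> 1" and s: "s \<noteq> 0"
  shows "rational_curve (surface_fiber l e s)"
proof -
  obtain P1 P2 P4 where P: "form (2 * l + 1) (hom_param1 e l s) P1" "form (2 * l + 1) (hom_param2 e l s) P2"
    "form (2 * l + 1) (denom l s) P4" "P4 \<noteq> 0" using hom_param_forms[OF s] by blast
  define E where "E = {t. poly P4 t = 0}"
  define f where "f = (\<lambda>t. (poly P1 t / poly P4 t, poly P2 t / poly P4 t, poly (Polynomial.smult s P4) t / poly P4 t))"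
  have np: "Finite t \<in> - poles l s \<longleftrightarrow> t \<in> - E" for t using P by (simp add: poles_def E_def form_def)
  have f: "f t = param e l s (coords (Finite t))" if "t \<in> - E" for t
    using that P np[of t] by (simp add: f_def param_eq_hom_param poles_def form_def)
  note S = surface_fiber_eq[OF e l s]
  have "inj_on f (- E)"
  proof (rule inj_onI)
    fix t t' assume "t \<in> - E" "t' \<in> - E" "f t = f t'"
    then have "Finite t = Finite t'" using np f by (intro inj_onD[OF S(2)]) auto
    then show "t = t'" by simp
  qed
  moreover have "f ` (- E) \<subseteq> surface_fiber l e s"
  proof (rule image_subsetI)
    fix t assume t: "t \<in> - E"
    show "f t \<in> surface_fiber l e s" unfolding S(1) f[OF t] using t np by blast
  qed
  moreover have "surface_fiber l e s - f ` (- E) \<subseteq> {param e l s (coords Infty)}"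
  proof
    fix p assume p: "p \<in> surface_fiber l e s - f ` (- E)"
    then obtain z where z: "z \<in> - poles l s" "p = param e l s (coords z)" unfolding S(1) by blast
    show "p \<in> {param e l s (coords Infty)}"
    proof (cases z)
      case (Finite t)
      then have "t \<in> - E" "p = f t" using z np f by auto
      then show ?thesis using p by blast
    qed (use z in simp)
  qed
  moreover from this have "finite (surface_fiber l e s - f ` (- E))" by (rule finite_subset) simp
  moreover have "finite E" unfolding E_def by (rule poly_roots_finite) fact
  moreover have "\<forall>t. poly P4 t = 0 \<longrightarrow> t \<in> E" by (simp add: E_def)
  ultimately show ?thesis
    unfolding rational_curve_def Let_def
    by (intro exI[of _ P4] exI[of _ P1] exI[of _ P2] exI[of _ "Polynomial.smult s P4"] exI[of _ E], fold f_def)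
      (intro conjI)
qed

text \<open>Used twice with a closed disc as compact factor: for hyperplanes without multiple
  intersections, and for the closed image in projective space.\<close>

lemma closed_compact_projection:
  fixes C :: "('a::metric_space \<times> 'b::metric_space) set"
  assumes K: "compact K" and C: "closed C"
  shows "closed {x. \<exists>y\<in>K. (x, y) \<in> C}"
  unfolding closed_sequential_limits
proof (intro allI impI, elim conjE)
  fix f x assume f: "\<forall>n. f n \<in> {x. \<exists>y\<in>K. (x, y) \<in> C}" and lim: "f \<longlonglongrightarrow> x"
  then have "\<forall>n. \<exists>y. y \<in> K \<and> (f n, y) \<in> C" by auto
  then obtain y where y: "\<And>n. y n \<in> K" "\<And>n. (f n, y n) \<in> C" by metis
  obtain b r where r: "b \<in> K" "strict_mono r" "(y \<circ> r) \<longlonglongrightarrow> b"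
    using K y(1) unfolding compact_def by metis
  have "(\<lambda>n. ((f \<circ> r) n, (y \<circ> r) n)) \<longlonglongrightarrow> (x, b)"
    by (intro tendsto_Pair LIMSEQ_subseq_LIMSEQ[OF lim r(2)] r(3))
  then have "(x, b) \<in> C" using C y(2) by (elim closed_sequentially[rotated 2]) auto
  then show "x \<in> {x. \<exists>y\<in>K. (x, y) \<in> C}" using r(1) by blast
qed

lemma poly_sum_le: "Polynomial.degree P \<le> n \<Longrightarrow> poly P t = (\<Sum>i\<le>n. poly.coeff P i * (t :: complex) ^ i)"
  unfolding poly_altdef by (rule sum.mono_neutral_left) (auto simp: coeff_eq_0)

lemma poly_pderiv_sum:
  assumes "Polynomial.degree P \<le> n"
  shows "poly (pderiv P) t = (\<Sum>i\<le>n. of_nat i * poly.coeff P i * (t :: complex) ^ (i - 1))"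
proof -
  have "((\<lambda>t. \<Sum>i\<le>n. poly.coeff P i * t ^ i) has_field_derivative
      (\<Sum>i\<le>n. of_nat i * poly.coeff P i * t ^ (i - 1))) (at t)"
    by (auto intro!: derivative_eq_intros sum.cong simp: algebra_simps)
  moreover have "poly P = (\<lambda>t. \<Sum>i\<le>n. poly.coeff P i * t ^ i)"
    by (rule ext) (rule poly_sum_le[OF assms])
  ultimately have "(poly P has_field_derivative (\<Sum>i\<le>n. of_nat i * poly.coeff P i * t ^ (i - 1))) (at t)"
    by simp
  then show ?thesis using poly_DERIV by (rule DERIV_unique[rotated])
qed

lemma dist_Pair_le: "dist (a, b) (c, d) \<le> dist a c + dist b d"
  unfolding dist_Pair_Pair by (rule sqrt_sum_squares_le_sum) auto

text \<open>
  The quotient \<open>(h1 P1 + h2 P2) / P4\<close> has degree \<open>N\<close>; all but finitely many of its values are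
  taken at \<open>N\<close> distinct points. Double roots of modulus above \<open>1\<close> are detected in the coordinate
  \<open>w = 1 / t\<close>, so that the parameter ranges over compact discs and \<open>H\<close> is open.
\<close>

lemma generic_squarefree:
  fixes P1 P2 P4 :: "complex poly" and s :: complex
  assumes deg: "Polynomial.degree P1 \<le> N" "Polynomial.degree P2 \<le> N" "Polynomial.degree P4 \<le> N"
    and N: "N \<ge> 1" and P4: "P4 \<noteq> 0"
    and pole: "\<And>t. poly P4 t = 0 \<Longrightarrow> poly P1 t = 0 \<longleftrightarrow> poly P2 t \<noteq> 0"
    and inf: "poly.coeff P4 N = 0 \<Longrightarrow> poly.coeff P1 N = 0 \<longleftrightarrow> poly.coeff P2 N \<noteq> 0"
  defines "R \<equiv> \<lambda>(h1, h2, h3, h4). Polynomial.smult h1 P1 + Polynomial.smult h2 P2 + Polynomial.smult (h3 * s + h4) P4"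
  obtains H :: "c4 set" where "open H" "closure H = UNIV"
    "\<And>h. h \<in> H \<Longrightarrow> fst h \<noteq> 0 \<and> fst (snd h) \<noteq> 0 \<and> poly.coeff (R h) N \<noteq> 0 \<and> rsquarefree (R h)"
proof -
  define a where "a h i = fst h * poly.coeff P1 i + fst (snd h) * poly.coeff P2 i
     + (fst (snd (snd h)) * s + snd (snd (snd h))) * poly.coeff P4 i" for h :: c4 and i
  have aR: "poly.coeff (R h) i = a h i" for h i by (simp add: R_def a_def case_prod_unfold)
  have degR: "Polynomial.degree (R h) \<le> N" for h
    using deg unfolding R_def case_prod_unfold
    by (intro degree_add_le) (auto intro: order_trans[OF degree_smult_le])
  have ca: "continuous_on A (\<lambda>x. a (f x) i)" if "continuous_on A f" for A and f :: "'x::topological_space \<Rightarrow> c4" and i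
    unfolding a_def by (intro continuous_intros that)
  \<comment> \<open>At i = 0 the truncated exponent i - 1 is harmless, since the factor i is zero.
    \<open>C2\<close> expresses, for w \<noteq> 0, w^N R(1/w) = 0 and w^(N-1) R'(1/w) = 0.\<close>
  define C1 where "C1 = {(h, t). (\<Sum>i\<le>N. a h i * t ^ i) = 0 \<and> (\<Sum>i\<le>N. of_nat i * a h i * t ^ (i - 1)) = 0}"
  define C2 where "C2 = {(h, w). (\<Sum>i\<le>N. a h i * w ^ (N - i)) = 0 \<and> (\<Sum>i\<le>N. of_nat i * a h i * w ^ (N - i)) = 0}"
  have "closed C1" "closed C2"
    unfolding C1_def C2_def case_prod_unfold
    by (intro closed_Collect_conj closed_Collect_eq continuous_intros ca)+
  then have cl: "closed {h. \<exists>t\<in>cball 0 1. (h, t) \<in> C1}" "closed {h. \<exists>t\<in>cball 0 1. (h, t) \<in> C2}"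
    using closed_compact_projection[OF compact_cball] by blast+
  define H where "H = {h. fst h \<noteq> 0} \<inter> {h. fst (snd h) \<noteq> 0} \<inter> {h. a h N \<noteq> 0}
     \<inter> (- {h. \<exists>t\<in>cball 0 1. (h, t) \<in> C1}) \<inter> (- {h. \<exists>t\<in>cball 0 1. (h, t) \<in> C2})"
  have "open H"
    unfolding H_def by (intro open_Int open_Compl cl open_Collect_neq continuous_intros ca)
  have R0: "poly (R h) t = (\<Sum>i\<le>N. a h i * t ^ i)" and R1: "poly (pderiv (R h)) t = (\<Sum>i\<le>N. of_nat i * a h i * t ^ (i - 1))" for h t
    using poly_sum_le[OF degR] poly_pderiv_sum[OF degR] by (simp_all add: aR)
  have inv: "(\<Sum>i\<le>N. a h i * w ^ (N - i)) = w ^ N * poly (R h) (1 / w)"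
     "(\<Sum>i\<le>N. of_nat i * a h i * w ^ (N - i)) = w ^ (N - 1) * poly (pderiv (R h)) (1 / w)" if "w \<noteq> 0" for h w
  proof -
    have "w ^ (N - i) = w ^ N * (1 / w) ^ i" if "i \<le> N" for i
      using that \<open>w \<noteq> 0\<close> by (simp add: power_diff power_one_over)
    then show "(\<Sum>i\<le>N. a h i * w ^ (N - i)) = w ^ N * poly (R h) (1 / w)"
      unfolding R0 sum_distrib_left by (intro sum.cong) auto
    have "of_nat i * w ^ (N - i) = of_nat i * (w ^ (N - 1) * (1 / w) ^ (i - 1))" if "i \<le> N" for i
    proof (cases i)
      case (Suc j)
      then have j: "N - i = (N - 1) - j" "j \<le> N - 1" using that by auto
      have "w ^ (N - i) = w ^ (N - 1) / w ^ j" unfolding j(1) by (rule power_diff) (use j \<open>w \<noteq> 0\<close> in auto)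
      then show ?thesis unfolding Suc by (simp add: power_one_over)
    qed simp
    then show "(\<Sum>i\<le>N. of_nat i * a h i * w ^ (N - i)) = w ^ (N - 1) * poly (pderiv (R h)) (1 / w)"
      unfolding R1 sum_distrib_left by (intro sum.cong) (auto simp: algebra_simps)
  qed
  have H1: "fst h \<noteq> 0 \<and> fst (snd h) \<noteq> 0 \<and> poly.coeff (R h) N \<noteq> 0 \<and> rsquarefree (R h)" if "h \<in> H" for h
  proof -
    have "\<not> (poly (R h) t = 0 \<and> poly (pderiv (R h)) t = 0)" for t
    proof
      assume b: "poly (R h) t = 0 \<and> poly (pderiv (R h)) t = 0"
      show False
      proof (cases "norm t \<le> 1")
        case True
        then have "(h, t) \<in> C1" using b by (simp add: C1_def R0 R1)
        then show False using that True by (auto simp: H_def)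
      next
        case False
        then have t: "t \<noteq> 0" by auto
        have "(h, 1 / t) \<in> C2" using b t inv[of "1 / t" h] by (simp add: C2_def)
        moreover have "norm (1 / t) \<le> 1" using False by (simp add: norm_divide divide_le_eq_1)
        ultimately show False using that by (auto simp: H_def)
      qed
    qed
    then show ?thesis using that by (auto simp: H_def aR rsquarefree_roots)
  qed
  have H2: "h \<in> H" if h: "fst h \<noteq> 0" "fst (snd h) \<noteq> 0" "a h N \<noteq> 0"
    "\<And>t. poly (R h) t = 0 \<Longrightarrow> poly (pderiv (R h)) t = 0 \<Longrightarrow> False" for h
  proof -
    have "(h, t) \<notin> C1" for t using h(4)[of t] by (auto simp: C1_def R0 R1)
    moreover have "(h, w) \<notin> C2" for w
    proof (cases "w = 0")
      case True
      have "(\<Sum>i\<le>N. a h i * 0 ^ (N - i)) = (\<Sum>i\<in>{N}. a h i * 0 ^ (N - i))"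
        by (rule sum.mono_neutral_right) auto
      then show ?thesis using True h(3) by (simp add: C2_def)
    next
      case False
      then show ?thesis using h(4)[of "1 / w"] inv[OF False, of h] by (auto simp: C2_def)
    qed
    ultimately show ?thesis using h by (auto simp: H_def)
  qed
  \<comment> \<open>Finiteness in h4 alone gives density: h1 and h2 are moved off zero, then h4 is
    moved.\<close>
  have fin: "finite {h4. (h1, h2, h3, h4) \<notin> H}" if h: "h1 \<noteq> 0" "h2 \<noteq> 0" for h1 h2 h3
  proof -
    define M where "M = Polynomial.smult h1 P1 + Polynomial.smult h2 P2 + Polynomial.smult (h3 * s) P4"
    have RM: "R (h1, h2, h3, h4) = M + Polynomial.smult h4 P4" for h4
      by (simp add: R_def M_def smult_add_left algebra_simps)
    have Mp: "poly M t \<noteq> 0" if "poly P4 t = 0" for t using pole[OF that] that h by (auto simp: M_def)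
    have aN: "finite {h4. a (h1, h2, h3, h4) N = 0}"
    proof (cases "poly.coeff P4 N = 0")
      case True
      then have "{h4. a (h1, h2, h3, h4) N = 0} = {}" using inf[OF True] h by (auto simp: a_def)
      then show ?thesis by simp
    next
      case False
      have "a (h1, h2, h3, h4) N = poly.coeff M N + h4 * poly.coeff P4 N" for h4
        unfolding aR[symmetric] RM by simp
      then have "{h4. a (h1, h2, h3, h4) N = 0} \<subseteq> {- poly.coeff M N / poly.coeff P4 N}"
        using False by (auto simp: field_simps add_eq_0_iff)
      then show ?thesis by (rule finite_subset) simp
    qed
    \<comment> \<open>The Wronskian of M and P4 vanishes at a double root t of M + h4 P4, and h4 is
      then - M / P4 at t. If W were zero, comparing orders at a root of P4, where M is nonzero,
      would be contradictory; for constant P4 also M would be constant and coefficient N zero for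
      all h4.\<close>
    define W where "W = M * pderiv P4 - pderiv M * P4"
    have "W \<noteq> 0"
    proof
      assume "W = 0"
      then have eq: "M * pderiv P4 = pderiv M * P4" by (simp add: W_def)
      show False
      proof (cases "Polynomial.degree P4 = 0")
        case True
        then have "pderiv P4 = 0" by (simp add: pderiv_eq_0_iff)
        then have "pderiv M = 0" using eq P4 by simp
        then have "Polynomial.degree M = 0" by (simp add: pderiv_eq_0_iff)
        then have "a (h1, h2, h3, h4) N = 0" for h4
          unfolding aR[symmetric] RM using True N by (simp add: coeff_eq_0)
        then have "{h4. a (h1, h2, h3, h4) N = 0} = UNIV" by auto
        then show False using aN infinite_UNIV_char_0 by metis
      next
        case False
        then have "\<not> constant (poly P4)" by (simp add: constant_degree)
        then obtain t where t: "poly P4 t = 0" using fundamental_theorem_of_algebra by blast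
        have p': "pderiv P4 \<noteq> 0" using False by (simp add: pderiv_eq_0_iff)
        have M0: "M \<noteq> 0" using Mp[OF t] by auto
        have nz: "M * pderiv P4 \<noteq> 0" using p' M0 by simp
        have "order t P4 = Suc (order t (pderiv P4))" by (rule order_pderiv[OF P4 t])
        moreover have "order t (M * pderiv P4) = order t M + order t (pderiv P4)" using nz by (rule order_mult)
        moreover have "order t (pderiv M * P4) = order t (pderiv M) + order t P4"
          using nz unfolding eq by (rule order_mult)
        moreover have "order t M = 0" using Mp[OF t] by (simp add: order_0I)
        ultimately show False using eq by simp
      qed
    qed
    then have fT: "finite {t. poly W t = 0}" by (rule poly_roots_finite)
    have "{h4. (h1, h2, h3, h4) \<notin> H} \<subseteq> {h4. a (h1, h2, h3, h4) N = 0} \<union> (\<lambda>t. - poly M t / poly P4 t) ` {t. poly W t = 0}"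
    proof
      fix h4 assume "h4 \<in> {h4. (h1, h2, h3, h4) \<notin> H}"
      then have nH: "(h1, h2, h3, h4) \<notin> H" by simp
      show "h4 \<in> {h4. a (h1, h2, h3, h4) N = 0} \<union> (\<lambda>t. - poly M t / poly P4 t) ` {t. poly W t = 0}"
      proof (cases "a (h1, h2, h3, h4) N = 0")
        case False
        then obtain t where t: "poly M t + h4 * poly P4 t = 0" "poly (pderiv M) t + h4 * poly (pderiv P4) t = 0"
          using H2[of "(h1, h2, h3, h4)"] nH h by (auto simp: RM pderiv_add pderiv_smult)
        then have p: "poly P4 t \<noteq> 0" using Mp by auto
        then have h4: "h4 = - poly M t / poly P4 t" using t(1) by (simp add: field_simps add_eq_0_iff)
        have "poly W t = (poly M t + h4 * poly P4 t) * poly (pderiv P4) t - (poly (pderiv M) t + h4 * poly (pderiv P4) t) * poly P4 t"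
          by (simp add: W_def algebra_simps)
        then show ?thesis using t h4 by auto
      qed auto
    qed
    then show ?thesis by (rule finite_subset) (use aN fT in auto)
  qed
  have near: "\<exists>y. y \<notin> F \<and> dist y x < d" if "finite F" "d > 0" for F :: "complex set" and x d
  proof -
    have "infinite (ball x d)" using that(2) by (simp add: uncountable_ball uncountable_infinite)
    then have "\<not> ball x d \<subseteq> F" using that(1) finite_subset by blast
    then obtain y where "y \<in> ball x d" "y \<notin> F" by blast
    then show ?thesis by (auto simp: dist_commute)
  qed
  have "x \<in> closure H" for x
  proof -
    obtain x1 x2 x3 x4 where x: "x = (x1, x2, x3, x4)" by (cases x)
    have "\<exists>y\<in>H. dist y x < d" if "d > 0" for d
    proof -
      have d3: "d / 3 > 0" using that by simp
      obtain y1 where y1: "y1 \<notin> {0}" "dist y1 x1 < d / 3" using near[OF _ d3, of "{0}"] by auto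
      obtain y2 where y2: "y2 \<notin> {0}" "dist y2 x2 < d / 3" using near[OF _ d3, of "{0}"] by auto
      obtain y4 where y4: "y4 \<notin> {h4. (y1, y2, x3, h4) \<notin> H}" "dist y4 x4 < d / 3"
        using near[OF fin d3, of y1 y2 x3] y1 y2 by auto
      have "dist (y1, y2, x3, y4) x \<le> dist y1 x1 + (dist y2 x2 + (dist x3 x3 + dist y4 x4))"
        unfolding x by (intro order_trans[OF dist_Pair_le] add_mono order_refl)
      also have "\<dots> < d" using y1 y2 y4 by simp
      finally show ?thesis using y4(1) by auto
    qed
    then show ?thesis by (simp add: closure_approachable)
  qed
  then have "closure H = UNIV" by auto
  then show ?thesis using that \<open>open H\<close> H1 by blast
qed

section \<open>Projective closure and degree\<close>

lemma proportional_refl: "u \<noteq> 0 \<Longrightarrow> proportional u u"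
  unfolding proportional_def by (intro conjI exI[of _ 1]) (auto simp: scaleC_one)

lemma abs_cp3_scale:
  assumes "u \<noteq> 0" "k \<noteq> 0"
  shows "abs_cp3 (scaleC k u) = abs_cp3 u"
proof -
  have "proportional u (scaleC k u)" using assms by (auto simp: proportional_def)
  then show ?thesis using Quotient3_rel_abs[OF Quotient3_cp3] by metis
qed

lemma abs_cp3_eqD:
  assumes "abs_cp3 u = abs_cp3 v" "u \<noteq> 0" "v \<noteq> 0"
  obtains k where "k \<noteq> 0" "v = scaleC k u"
proof -
  have "proportional u v"
    using Quotient3_rel[OF Quotient3_cp3, of u v] assms proportional_refl by blast
  then show ?thesis using that by (auto simp: proportional_def)
qed

lemma scaleC4: "scaleC k (x, y, z, w) = (k * x, k * y, k * z, k * w)"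
  for k x y z w :: complex
  by (simp add: scaleC_prod_def scaleC_complex_def)

lemma abs_cp3_normalize:
  fixes x y z w :: complex
  shows "w \<noteq> 0 \<Longrightarrow> abs_cp3 (x, y, z, w) = abs_cp3 (x / w, y / w, z / w, 1)"
    and "x \<noteq> 0 \<Longrightarrow> abs_cp3 (x, y, z, w) = abs_cp3 (1, y / x, z / x, w / x)"
    and "y \<noteq> 0 \<Longrightarrow> abs_cp3 (x, y, z, w) = abs_cp3 (x / y, 1, z / y, w / y)"
proof -
  show "abs_cp3 (x, y, z, w) = abs_cp3 (x / w, y / w, z / w, 1)" if "w \<noteq> 0"
    using abs_cp3_scale[of "(x / w, y / w, z / w, 1)" w] that by (simp add: scaleC4 zero_prod_def)
  show "abs_cp3 (x, y, z, w) = abs_cp3 (1, y / x, z / x, w / x)" if "x \<noteq> 0"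
    using abs_cp3_scale[of "(1, y / x, z / x, w / x)" x] that by (simp add: scaleC4 zero_prod_def)
  show "abs_cp3 (x, y, z, w) = abs_cp3 (x / y, 1, z / y, w / y)" if "y \<noteq> 0"
    using abs_cp3_scale[of "(x / y, 1, z / y, w / y)" y] that by (simp add: scaleC4 zero_prod_def)
qed

lemma inj_affine_part: "inj affine_part"
proof (rule injI)
  fix p q :: c3 assume eq: "affine_part p = affine_part q"
  obtain x y z x' y' z' where pq: "p = (x, y, z)" "q = (x', y', z')" by (cases p; cases q)
  have "abs_cp3 (x, y, z, 1) = abs_cp3 (x', y', z', 1)" using eq by (simp add: affine_part_def pq)
  moreover have "(x, y, z, 1) \<noteq> (0 :: c4)" "(x', y', z', 1) \<noteq> (0 :: c4)" by (auto simp: zero_prod_def)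
  ultimately obtain k where "(x', y', z', 1) = scaleC k (x, y, z, 1 :: complex)"
    using abs_cp3_eqD by blast
  then show "p = q" by (simp add: scaleC4 pq)
qed

definition proj_param :: "complex \<Rightarrow> nat \<Rightarrow> complex \<Rightarrow> sphere \<Rightarrow> cp3" where
  "proj_param e l s z = abs_cp3 (hom_param e l s (coords z))"

lemma proj_param_point_of:
  assumes "s \<noteq> 0" "e * e = 1" "l \<ge> 1" "c \<noteq> (0, 0)"
  shows "proj_param e l s (point_of c) = abs_cp3 (hom_param e l s c)"
proof -
  obtain r where r: "r \<noteq> 0" "c = (r * fst (coords (point_of c)), r * snd (coords (point_of c)))" using coords_point_of[OF assms(4)] by blast
  have "hom_param e l s c = hom_param e l s (r * fst (coords (point_of c)), r * snd (coords (point_of c)))" using r(2) by (rule arg_cong)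
  also have "\<dots> = scaleC (r ^ (2 * l + 1)) (hom_param e l s (coords (point_of c)))" by (rule hom_param_scale)
  finally have "abs_cp3 (hom_param e l s c) = abs_cp3 (scaleC (r ^ (2 * l + 1)) (hom_param e l s (coords (point_of c))))" by (rule arg_cong)
  also have "\<dots> = abs_cp3 (hom_param e l s (coords (point_of c)))"
    by (rule abs_cp3_scale[OF hom_param_nonzero[OF assms(1-3) coords_nonzero]]) (use r(1) in simp)
  finally show ?thesis unfolding proj_param_def by (rule sym)
qed

lemma proj_param_affine: "z \<notin> poles l s \<Longrightarrow> proj_param e l s z = affine_part (param e l s (coords z))"
  unfolding proj_param_def hom_param_def poles_def by (subst abs_cp3_normalize(1)) (simp_all add: param_eq_hom_param affine_part_def)

lemma cdiff_hom_param:
  assumes "cdiff C x" "s \<noteq> 0"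
  shows "cdiff (\<lambda>x. hom_param1 e l s (C x)) x" "cdiff (\<lambda>x. hom_param2 e l s (C x)) x" "cdiff (\<lambda>x. denom l s (C x)) x"
  unfolding hom_param1_def hom_param2_def using assms
  by (intro cdiff_mult cdiff_const cdiff_toep cdiff_denom; simp)+

lemma proj_param_holomorphic:
  assumes s: "s \<noteq> 0" and e: "e * e = 1" and l: "l \<ge> 1"
  shows "holomorphic_map sphere_charts cp3_charts UNIV (proj_param e l s)"
proof (rule holomorphic_mapI)
  fix \<phi> u assume \<phi>: "\<phi> \<in> sphere_charts"
  obtain h where h: "\<And>w. \<phi> w = point_of (h w)" "\<And>w. h w \<noteq> (0, 0)" "\<And>w. cdiff h w"
    using sphere_chartE[OF \<phi>] by metis
  define a where "a w = hom_param1 e l s (h w)" for w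
  define b where "b w = hom_param2 e l s (h w)" for w
  define d where "d w = denom l s (h w)" for w
  have g: "proj_param e l s (\<phi> w) = abs_cp3 (a w, b w, s * d w, d w)" for w
    using proj_param_point_of[OF s e l h(2)] by (simp add: h(1) hom_param_def a_def b_def d_def)
  have c: "cdiff a w" "cdiff b w" "cdiff d w" for w
    unfolding a_def b_def d_def using cdiff_hom_param[OF h(3) s] by auto
  have key: "\<exists>\<psi>\<in>cp3_charts. \<exists>V h. open V \<and> u \<in> V \<and> (\<forall>v\<in>V. cdiff h v \<and> (\<phi> v \<in> UNIV \<longrightarrow> proj_param e l s (\<phi> v) = \<psi> (h v)))"
    (is ?chart) if "\<psi> \<in> cp3_charts" "q u \<noteq> 0" "\<And>w. cdiff q w" "\<And>w. q w \<noteq> 0 \<Longrightarrow> cdiff H w"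
      "\<And>w. q w \<noteq> 0 \<Longrightarrow> proj_param e l s (\<phi> w) = \<psi> (H w)" for \<psi> H and q :: "complex \<Rightarrow> complex"
  proof -
    define V where "V = {w \<in> UNIV. q w \<noteq> 0}"
    have "open V" unfolding V_def using that(3) by (intro open_nonzero) auto
    moreover have "u \<in> V" using that(2) by (simp add: V_def)
    moreover have "\<forall>v\<in>V. cdiff H v \<and> (\<phi> v \<in> UNIV \<longrightarrow> proj_param e l s (\<phi> v) = \<psi> (H v))" using that(4,5) by (simp add: V_def)
    ultimately show ?thesis using that(1) by blast
  qed
  have "(a u, b u, s * d u, d u) \<noteq> 0"
    using hom_param_nonzero[OF s e l h(2)] by (simp add: hom_param_def a_def b_def d_def)
  \<comment> \<open>The third coordinate is s times the fourth, so a nonzero vector has a nonzero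
    first, second or fourth coordinate.\<close>
  then consider "d u \<noteq> 0" | "a u \<noteq> 0" | "b u \<noteq> 0" by (auto simp: zero_prod_def)
  then show ?chart
  proof cases
    case 1
    show ?thesis
    proof (rule key[of "\<lambda>(x, y, z). abs_cp3 (x, y, z, 1)" d "\<lambda>w. (a w / d w, b w / d w, s * d w / d w)"])
      show "proj_param e l s (\<phi> w) = (\<lambda>(x, y, z). abs_cp3 (x, y, z, 1)) (a w / d w, b w / d w, s * d w / d w)" if "d w \<noteq> 0" for w
        unfolding g prod.case using that by (rule abs_cp3_normalize(1))
      show "cdiff (\<lambda>w. (a w / d w, b w / d w, s * d w / d w)) w" if "d w \<noteq> 0" for w
        using that by (intro cdiff_Pair cdiff_divide cdiff_mult cdiff_const c)
    qed (use 1 in \<open>auto simp: cp3_charts_def intro: c\<close>)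
  next
    case 2
    show ?thesis
    proof (rule key[of "\<lambda>(x, y, z). abs_cp3 (1, x, y, z)" a "\<lambda>w. (b w / a w, s * d w / a w, d w / a w)"])
      show "proj_param e l s (\<phi> w) = (\<lambda>(x, y, z). abs_cp3 (1, x, y, z)) (b w / a w, s * d w / a w, d w / a w)" if "a w \<noteq> 0" for w
        unfolding g prod.case using that by (rule abs_cp3_normalize(2))
      show "cdiff (\<lambda>w. (b w / a w, s * d w / a w, d w / a w)) w" if "a w \<noteq> 0" for w
        using that by (intro cdiff_Pair cdiff_divide cdiff_mult cdiff_const c)
    qed (use 2 in \<open>auto simp: cp3_charts_def intro: c\<close>)
  next
    case 3
    show ?thesis
    proof (rule key[of "\<lambda>(x, y, z). abs_cp3 (x, 1, y, z)" b "\<lambda>w. (a w / b w, s * d w / b w, d w / b w)"])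
      show "proj_param e l s (\<phi> w) = (\<lambda>(x, y, z). abs_cp3 (x, 1, y, z)) (a w / b w, s * d w / b w, d w / b w)" if "b w \<noteq> 0" for w
        unfolding g prod.case using that by (rule abs_cp3_normalize(3))
      show "cdiff (\<lambda>w. (a w / b w, s * d w / b w, d w / b w)) w" if "b w \<noteq> 0" for w
        using that by (intro cdiff_Pair cdiff_divide cdiff_mult cdiff_const c)
    qed (use 3 in \<open>auto simp: cp3_charts_def intro: c\<close>)
  qed
qed

text \<open>Two closed unit discs, in t and in 1 / t, cover the sphere; this compactness makes the
  image closed.\<close>

lemma range_proj_param:
  assumes "s \<noteq> 0" "e * e = 1" "l \<ge> 1"
  shows "range (proj_param e l s) = (\<lambda>w. abs_cp3 (hom_param e l s (1, w))) ` cball 0 1 \<union> (\<lambda>w. abs_cp3 (hom_param e l s (w, 1))) ` cball 0 1"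
    (is "?L = ?R")
proof (intro equalityI subsetI)
  fix p assume "p \<in> ?L"
  then obtain z where z: "p = proj_param e l s z" by blast
  show "p \<in> ?R"
  proof (cases z)
    case (Finite t)
    show ?thesis
    proof (cases "norm t \<le> 1")
      case True
      then show ?thesis using z Finite by (auto simp: proj_param_def)
    next
      case False
      have "z = point_of (1 / t, 1)" using False Finite by (auto simp: point_of_def)
      then have "p = abs_cp3 (hom_param e l s (1 / t, 1))" using proj_param_point_of[OF assms, of "(1 / t, 1)"] z by simp
      moreover have "1 / t \<in> cball 0 1" using False by (simp add: norm_divide divide_le_eq_1)
      ultimately show ?thesis by blast
    qed
  next
    case Infty
    then have "p = abs_cp3 (hom_param e l s (0, 1))" using z by (simp add: proj_param_def)
    moreover have "(0 :: complex) \<in> cball 0 1" by simp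
    ultimately show ?thesis by blast
  qed
next
  fix p assume "p \<in> ?R"
  then obtain c where "p = abs_cp3 (hom_param e l s c)" "c \<noteq> (0, 0)" by auto
  then show "p \<in> ?L" using proj_param_point_of[OF assms] by (metis rangeI)
qed

text \<open>A closed condition that expresses proportionality of nonzero vectors.\<close>

definition minors :: "c4 \<Rightarrow> c4 \<Rightarrow> bool" where
  "minors v x \<longleftrightarrow> fst v * fst (snd x) = fst (snd v) * fst x \<and>
     fst v * fst (snd (snd x)) = fst (snd (snd v)) * fst x \<and>
     fst v * snd (snd (snd x)) = snd (snd (snd v)) * fst x \<and>
     fst (snd v) * fst (snd (snd x)) = fst (snd (snd v)) * fst (snd x) \<and>
     fst (snd v) * snd (snd (snd x)) = snd (snd (snd v)) * fst (snd x) \<and>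
     fst (snd (snd v)) * snd (snd (snd x)) = snd (snd (snd v)) * fst (snd (snd x))"

lemma abs_cp3_eq_iff_minors:
  assumes "v \<noteq> 0" "x \<noteq> 0"
  shows "abs_cp3 v = abs_cp3 x \<longleftrightarrow> minors v x"
proof
  assume "abs_cp3 v = abs_cp3 x"
  then obtain k where "x = scaleC k v" using assms by (rule abs_cp3_eqD)
  then show "minors v x" by (cases v) (simp add: minors_def scaleC4)
next
  assume m: "minors v x"
  obtain v1 v2 v3 v4 x1 x2 x3 x4 where vx: "v = (v1, v2, v3, v4)" "x = (x1, x2, x3, x4)"
    by (cases v; cases x)
  have "\<exists>k. v = scaleC k x"
  proof -
    have "x1 \<noteq> 0 \<or> x2 \<noteq> 0 \<or> x3 \<noteq> 0 \<or> x4 \<noteq> 0" using assms(2) by (auto simp: vx zero_prod_def)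
    then consider "x1 \<noteq> 0" | "x2 \<noteq> 0" | "x3 \<noteq> 0" | "x4 \<noteq> 0" by blast
    then show ?thesis
    proof cases
      case 1 then show ?thesis using m by (intro exI[of _ "v1 / x1"]) (auto simp: minors_def vx scaleC4 field_simps)
    next
      case 2 then show ?thesis using m by (intro exI[of _ "v2 / x2"]) (auto simp: minors_def vx scaleC4 field_simps)
    next
      case 3 then show ?thesis using m by (intro exI[of _ "v3 / x3"]) (auto simp: minors_def vx scaleC4 field_simps)
    next
      case 4 then show ?thesis using m by (intro exI[of _ "v4 / x4"]) (auto simp: minors_def vx scaleC4 field_simps)
    qed
  qed
  then obtain k where k: "v = scaleC k x" by blast
  then have "k \<noteq> 0" using assms(1) by (auto simp: vx scaleC4 zero_prod_def)
  then show "abs_cp3 v = abs_cp3 x" unfolding k by (rule abs_cp3_scale[OF assms(2)])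
qed

lemma continuous_hom_param:
  assumes "s \<noteq> 0" "\<And>w. cdiff h w"
  shows "continuous_on UNIV (\<lambda>w. hom_param e l s (h w))"
proof -
  have "cdiff (\<lambda>w. hom_param e l s (h w)) w" for w
    unfolding hom_param_def by (intro cdiff_Pair cdiff_mult cdiff_const cdiff_hom_param assms)
  then show ?thesis using cdiff_isCont continuous_at_imp_continuous_on by blast
qed

text \<open>Among nonzero vectors, the preimage of the image consists of those proportional to the
  parametrization somewhere on two compact discs; \<open>minors\<close> makes this closed before the
  disc is projected away.\<close>

lemma closed_range_proj_param:
  assumes s: "s \<noteq> 0" and e: "e * e = 1" and l: "l \<ge> 1"
  shows "closed (range (proj_param e l s))"
proof -
  have cl: "closed {v. \<exists>w\<in>cball 0 1. (v, w) \<in> {(v, w). minors v (G w)}}"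
    if G: "continuous_on UNIV G" for G :: "complex \<Rightarrow> c4"
  proof (rule closed_compact_projection[OF compact_cball])
    have G': "continuous_on UNIV (\<lambda>x. G (snd x))" for x :: "c4 \<times> complex"
      by (rule continuous_on_compose2[OF G]) (auto intro: continuous_intros)
    show "closed {(v, w). minors v (G w)}"
      unfolding minors_def case_prod_unfold
      by (intro closed_Collect_conj closed_Collect_eq continuous_intros G')
  qed
  let ?S = "\<lambda>h. {v. \<exists>w\<in>cball 0 1. (v, w) \<in> {(v, w). minors v (hom_param e l s (h w))}}"
  have S: "closed (?S (\<lambda>w. (1, w)))" "closed (?S (\<lambda>w. (w, 1)))"
    by (intro cl continuous_hom_param[OF s] cdiff_Pair cdiff_const cdiff_ident)+
  have "{v. v \<noteq> 0 \<and> abs_cp3 v \<in> - range (proj_param e l s)} = - {0} \<inter> - ?S (\<lambda>w. (1, w)) \<inter> - ?S (\<lambda>w. (w, 1))"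
  proof (intro Set.set_eqI)
    fix v
    have "abs_cp3 v \<in> range (proj_param e l s) \<longleftrightarrow> v \<in> ?S (\<lambda>w. (1, w)) \<union> ?S (\<lambda>w. (w, 1))" if v: "v \<noteq> 0"
    proof -
      have "abs_cp3 v = abs_cp3 (hom_param e l s (1, w)) \<longleftrightarrow> minors v (hom_param e l s (1, w))"
        "abs_cp3 v = abs_cp3 (hom_param e l s (w, 1)) \<longleftrightarrow> minors v (hom_param e l s (w, 1))" for w
        by (intro abs_cp3_eq_iff_minors[OF v] hom_param_nonzero[OF s e l]; simp)+
      then show ?thesis unfolding range_proj_param[OF s e l] by auto
    qed
    then show "v \<in> {v. v \<noteq> 0 \<and> abs_cp3 v \<in> - range (proj_param e l s)} \<longleftrightarrow> v \<in> - {0} \<inter> - ?S (\<lambda>w. (1, w)) \<inter> - ?S (\<lambda>w. (w, 1))"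
      by blast
  qed
  moreover have "open (- {0} \<inter> - ?S (\<lambda>w. (1, w)) \<inter> - ?S (\<lambda>w. (w, 1)))"
    using S by (intro open_Int open_Compl) auto
  ultimately show ?thesis unfolding closed_def open_cp3_def by simp
qed

text \<open>The image is closed and contains the affine points. Conversely the poles are finite in
  number, so each neighbourhood of an image point contains affine ones.\<close>

lemma projective_closure_fiber:
  assumes s: "s \<noteq> 0" and e: "e * e = 1" and l: "l \<ge> 1"
  shows "projective_closure (surface_fiber l e s) = range (proj_param e l s)"
proof -
  have img: "affine_part ` surface_fiber l e s = proj_param e l s ` (- poles l s)"
    unfolding surface_fiber_eq(1)[OF e l s] image_image using proj_param_affine by (intro image_cong) auto
  have "range (proj_param e l s) \<subseteq> closure (proj_param e l s ` (- poles l s))"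
  proof (rule image_subsetI, rule ccontr)
    fix z assume z: "proj_param e l s z \<notin> closure (proj_param e l s ` (- poles l s))"
    define U where "U = - closure (proj_param e l s ` (- poles l s))"
    have "open U" unfolding U_def by (rule open_Compl[OF closed_closure])
    then have oU: "open {v. v \<noteq> 0 \<and> abs_cp3 v \<in> U}" by (simp add: open_cp3_def)
    obtain \<phi> u where \<phi>: "\<phi> \<in> sphere_charts" "\<phi> u = z"
    proof (cases z)
      case (Finite t)
      then show ?thesis using that[of Finite t] by (simp add: sphere_charts_def)
    next
      case Infty
      then show ?thesis using that[of "\<lambda>w. if w = 0 then Infty else Finite (1 / w)" 0] by (simp add: sphere_charts_def)
    qed
    obtain h where h: "h = (\<lambda>w. (1, w)) \<or> h = (\<lambda>w. (w, 1))" "\<And>w. \<phi> w = point_of (h w)" "\<And>w. h w \<noteq> (0, 0)" "\<And>w. cdiff h w"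
      using sphere_chartE[OF \<phi>(1)] by metis
    have g: "proj_param e l s (\<phi> w) = abs_cp3 (hom_param e l s (h w))" for w
      using proj_param_point_of[OF s e l h(3)] by (simp add: h(2))
    have "open ((\<lambda>w. hom_param e l s (h w)) -` {v. v \<noteq> 0 \<and> abs_cp3 v \<in> U})"
      by (rule open_vimage[OF oU continuous_hom_param[OF s h(4)]])
    moreover have "u \<in> (\<lambda>w. hom_param e l s (h w)) -` {v. v \<noteq> 0 \<and> abs_cp3 v \<in> U}"
      using z hom_param_nonzero[OF s e l h(3)] by (simp add: U_def g[symmetric] \<phi>(2))
    ultimately obtain d where d: "d > 0" "ball u d \<subseteq> (\<lambda>w. hom_param e l s (h w)) -` {v. v \<noteq> 0 \<and> abs_cp3 v \<in> U}"
      by (meson openE)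
    have "finite (\<phi> -` poles l s)"
    proof (rule finite_vimageI[OF poles_finite(1)[OF s]])
      show "inj \<phi>" using h(1) unfolding h(2) by (auto simp: inj_on_def point_of_def split: if_splits)
    qed
    moreover have "infinite (ball u d)" using d(1) by (simp add: uncountable_ball uncountable_infinite)
    ultimately have "\<not> ball u d \<subseteq> \<phi> -` poles l s" using finite_subset by blast
    then obtain w where w: "w \<in> ball u d" "\<phi> w \<notin> poles l s" by blast
    then have "proj_param e l s (\<phi> w) \<in> U" using d(2) by (auto simp: g)
    moreover have "proj_param e l s (\<phi> w) \<in> closure (proj_param e l s ` (- poles l s))"
      using w by (intro subsetD[OF closure_subset]) auto
    ultimately show False by (simp add: U_def)
  qed
  moreover have "closure (proj_param e l s ` (- poles l s)) \<subseteq> range (proj_param e l s)"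
    by (rule closure_minimal) (auto intro: closed_range_proj_param[OF s e l])
  ultimately show ?thesis unfolding projective_closure_def img by blast
qed

lemma proj_param_in_hyperplane_iff:
  assumes s: "s \<noteq> 0" and e: "e * e = 1" and l: "l \<ge> 1"
  shows "proj_param e l s z \<in> hyperplane (h1, h2, h3, h4) \<longleftrightarrow>
    h1 * hom_param1 e l s (coords z) + h2 * hom_param2 e l s (coords z) + h3 * (s * denom l s (coords z)) + h4 * denom l s (coords z) = 0"
    (is "?L \<longleftrightarrow> ?R")
proof
  have nz: "hom_param e l s (coords z) \<noteq> 0" by (rule hom_param_nonzero[OF s e l]) simp
  show "?R \<Longrightarrow> ?L" unfolding hyperplane_def proj_param_def using nz unfolding hom_param_def by auto
  assume ?L
  then obtain x y u w where x: "proj_param e l s z = abs_cp3 (x, y, u, w)" "(x, y, u, w) \<noteq> 0"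
    "h1 * x + h2 * y + h3 * u + h4 * w = 0" by (auto simp: hyperplane_def)
  obtain k where "hom_param e l s (coords z) = scaleC k (x, y, u, w)"
    using abs_cp3_eqD[OF x(1)[unfolded proj_param_def, symmetric] x(2) nz] by blast
  then have k: "hom_param1 e l s (coords z) = k * x" "hom_param2 e l s (coords z) = k * y" "s * denom l s (coords z) = k * u" "denom l s (coords z) = k * w"
    unfolding hom_param_def scaleC4 prod.inject by blast+
  have "h1 * (k * x) + h2 * (k * y) + h3 * (k * u) + h4 * (k * w) = k * (h1 * x + h2 * y + h3 * u + h4 * w)"
    by (simp add: algebra_simps)
  then show ?R unfolding k(3) unfolding k(1,2,4) x(3) by simp
qed

lemma card_roots_rsquarefree:
  assumes "rsquarefree (p :: complex poly)"
  shows "card {t. poly p t = 0} = Polynomial.degree p"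
proof -
  have p: "p \<noteq> 0" using assms by (simp add: rsquarefree_def)
  have "Polynomial.degree p = size (proots p)" by (rule size_proots_complex[symmetric])
  also have "\<dots> = (\<Sum>t\<in>{t. poly p t = 0}. order t p)"
    using p by (simp add: size_multiset_overloaded_eq)
  also have "\<dots> = (\<Sum>t\<in>{t. poly p t = 0}. 1)"
  proof (intro sum.cong refl)
    fix t assume "t \<in> {t. poly p t = 0}"
    then have "order t p \<noteq> 0" using p by (simp add: order_root)
    moreover have "order t p = 0 \<or> order t p = 1"
      using assms[unfolded rsquarefree_def, THEN conjunct2, THEN spec, of t] .
    ultimately show "order t p = 1" by simp
  qed
  finally show ?thesis by simp
qed

text \<open>For generic h the form F of degree 2 l + 1 has a nonzero top coefficient, so
  \<open>Infty\<close> is no zero, and its roots are distinct. At a pole exactly one of the first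
  two coordinates survives; as h1 and h2 are nonzero, F is nonzero there. So the parametrization is
  injective on the zeros.\<close>

lemma fiber_degree:
  assumes s: "s \<noteq> 0" and e: "e * e = 1" and l: "l \<ge> 1"
  shows "has_degree (surface_fiber l e s) (2 * l + 1)"
proof -
  let ?N = "2 * l + 1"
  obtain P1 P2 P4 where P: "form ?N (hom_param1 e l s) P1" "form ?N (hom_param2 e l s) P2"
    "form ?N (denom l s) P4" "P4 \<noteq> 0" using hom_param_forms[OF s] by blast
  define R where "R = (\<lambda>(h1, h2, h3, h4). Polynomial.smult h1 P1 + Polynomial.smult h2 P2 + Polynomial.smult (h3 * s + h4) P4)"
  note pole = hom_param_at_pole[OF s e l]
  have p1: "poly P1 t = 0 \<longleftrightarrow> poly P2 t \<noteq> 0" if "poly P4 t = 0" for t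
    using pole[of "(1, t)"] that P by (simp add: form_def)
  have p2: "poly.coeff P1 ?N = 0 \<longleftrightarrow> poly.coeff P2 ?N \<noteq> 0" if "poly.coeff P4 ?N = 0"
    using pole[of "(0, 1)"] that P by (simp add: form_def)
  obtain H where H: "open H" "closure H = UNIV"
    "\<And>h. h \<in> H \<Longrightarrow> fst h \<noteq> 0 \<and> fst (snd h) \<noteq> 0 \<and> poly.coeff (R h) ?N \<noteq> 0 \<and> rsquarefree (R h)"
    using generic_squarefree[of P1 ?N P2 P4 s, OF _ _ _ _ P(4) p1 p2] P unfolding R_def form_def by auto
  have "finite (projective_closure (surface_fiber l e s) \<inter> hyperplane h) \<and>
      card (projective_closure (surface_fiber l e s) \<inter> hyperplane h) = ?N" if h: "h \<in> H" for h
  proof -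
    obtain h1 h2 h3 h4 where hh: "h = (h1, h2, h3, h4)" by (cases h)
    define F where "F c = h1 * hom_param1 e l s c + h2 * hom_param2 e l s c + h3 * (s * denom l s c) + h4 * denom l s c" for c
    have "form ?N (\<lambda>c. h1 * hom_param1 e l s c + h2 * hom_param2 e l s c + (h3 * s + h4) * denom l s c) (R h)"
      unfolding R_def hh prod.case using P by (intro form_add form_smult)
    moreover have "(\<lambda>c. h1 * hom_param1 e l s c + h2 * hom_param2 e l s c + (h3 * s + h4) * denom l s c) = F"
      by (rule ext) (simp add: F_def algebra_simps)
    ultimately have F: "form ?N F (R h)" by simp
    have R0: "R h \<noteq> 0" using H(3)[OF h] by (auto simp: rsquarefree_def)
    have zeros: "projective_closure (surface_fiber l e s) \<inter> hyperplane h = proj_param e l s ` {z. F (coords z) = 0}"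
      unfolding projective_closure_fiber[OF s e l] using proj_param_in_hyperplane_iff[OF s e l] by (auto simp: hh F_def)
    have np: "z \<notin> poles l s" if "F (coords z) = 0" for z
    proof
      assume "z \<in> poles l s"
      then have t: "denom l s (coords z) = 0" by (simp add: poles_def)
      then have "h1 * hom_param1 e l s (coords z) + h2 * hom_param2 e l s (coords z) = 0" using that by (simp add: F_def)
      then show False using pole[OF coords_nonzero t] H(3)[OF h] by (auto simp: hh)
    qed
    have "inj_on (proj_param e l s) {z. F (coords z) = 0}"
    proof (rule inj_onI)
      fix z z' assume z: "z \<in> {z. F (coords z) = 0}" "z' \<in> {z. F (coords z) = 0}" "proj_param e l s z = proj_param e l s z'"
      then have n: "z \<in> - poles l s" "z' \<in> - poles l s" using np by auto
      then have "param e l s (coords z) = param e l s (coords z')" using z(3) proj_param_affine injD[OF inj_affine_part] by (metis ComplD)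
      then show "z = z'" using inj_onD[OF surface_fiber_eq(2)[OF e l s]] n by blast
    qed
    moreover have eq: "{z. F (coords z) = 0} = Finite ` {t. poly (R h) t = 0}"
    proof (rule Set.set_eqI)
      fix z show "z \<in> {z. F (coords z) = 0} \<longleftrightarrow> z \<in> Finite ` {t. poly (R h) t = 0}"
        using F H(3)[OF h] by (cases z) (auto simp: form_def)
    qed
    moreover have "card (Finite ` {t. poly (R h) t = 0}) = ?N"
    proof -
      have "card (Finite ` {t. poly (R h) t = 0}) = card {t. poly (R h) t = 0}"
        by (rule card_image) (auto simp: inj_on_def)
      also have "\<dots> = Polynomial.degree (R h)"
        using card_roots_rsquarefree H(3)[OF h] by simp
      also have "\<dots> = ?N" using F H(3)[OF h] by (simp add: form_def le_antisym le_degree)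
      finally show ?thesis .
    qed
    moreover have "finite {z. F (coords z) = 0}"
      by (rule form_zeros(1)[OF F R0])
    ultimately show ?thesis unfolding zeros by (simp add: card_image)
  qed
  then show ?thesis unfolding has_degree_def using H(1,2) by blast
qed

theorem theorem1p14:
  fixes l :: nat
  assumes "l \<ge> 1"
  shows
    "((\<forall>\<epsilon>\<in>{1, -1}. complex_submanifold TYPE(complex) (surface_o l \<epsilon>)) \<and>
      surface_o l 1 \<inter> surface_o l (-1) = {} \<and>
      (\<forall>\<epsilon>\<in>{1, -1}. surface_o l \<epsilon> \<inter> {(chi, a, s). chi = 0 \<and> a = 0} = {}))
     \<and>
     (\<forall>\<epsilon>\<in>{1, -1}.
        holomorphic_fibration (surface_o l \<epsilon>) (- {0}) s_coord \<and>
        (\<forall>s. s \<noteq> 0 \<longrightarrow>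
           complex_submanifold TYPE(complex \<times> complex) (surface_fiber l \<epsilon> s) \<and>
           rational_curve (surface_fiber l \<epsilon> s) \<and>
           has_degree (surface_fiber l \<epsilon> s) (2 * l + 1) \<and>
           (\<exists>Q f g. finite Q \<and> card Q \<le> 2 * l + 1 \<and>
              biholomorphic_map sphere_charts c3_charts (- Q) (surface_fiber l \<epsilon> s) f \<and>
              holomorphic_map sphere_charts cp3_charts UNIV g \<and>
              (\<forall>z. z \<notin> Q \<longrightarrow> g z = affine_part (f z)) \<and>
              range g = projective_closure (surface_fiber l \<epsilon> s))))
     \<and>
     (\<forall>\<epsilon>\<in>{1, -1}.
        \<exists>\<Sigma> \<Phi>. analytic_hypersurface plane_sphere_charts ((- {0}) \<times> UNIV) \<Sigma> \<and>
          biholomorphic_map plane_sphere_charts c3_charts ((- {0}) \<times> UNIV - \<Sigma>) (surface_o l \<epsilon>) \<Phi> \<and>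
          (\<forall>s z. (s, z) \<in> (- {0}) \<times> UNIV - \<Sigma> \<longrightarrow> s_coord (\<Phi> (s, z)) = s))"
proof -
  have e: "\<epsilon> * \<epsilon> = 1" if "\<epsilon> \<in> {1, -1 :: complex}" for \<epsilon> using that by auto
  show ?thesis
  proof (intro conjI ballI allI impI)
    show "surface_o l 1 \<inter> surface_o l (-1) = {}" by (rule surface_o_disjoint[OF assms])
  next
    fix \<epsilon> :: complex assume \<epsilon>: "\<epsilon> \<in> {1, -1}"
    show "complex_submanifold TYPE(complex) (surface_o l \<epsilon>)" by (rule submanifold_surface_o[OF e[OF \<epsilon>] assms])
    show "surface_o l \<epsilon> \<inter> {(chi, a, s). chi = 0 \<and> a = 0} = {}" by (rule surface_o_axis[OF assms e[OF \<epsilon>]])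
    show "holomorphic_fibration (surface_o l \<epsilon>) (- {0}) s_coord" by (rule fibration[OF e[OF \<epsilon>] assms])
    have "(- {0}) \<times> UNIV - {(s, z). s \<noteq> 0 \<and> z \<in> poles l s} = dom_Phi l" by (auto simp: dom_Phi_def)
    moreover have "s_coord (Phi \<epsilon> l (s, z)) = s" for s z by (simp add: s_coord_def Phi_def param_def)
    ultimately show "\<exists>\<Sigma> \<Phi>. analytic_hypersurface plane_sphere_charts ((- {0}) \<times> UNIV) \<Sigma> \<and>
          biholomorphic_map plane_sphere_charts c3_charts ((- {0}) \<times> UNIV - \<Sigma>) (surface_o l \<epsilon>) \<Phi> \<and>
          (\<forall>s z. (s, z) \<in> (- {0}) \<times> UNIV - \<Sigma> \<longrightarrow> s_coord (\<Phi> (s, z)) = s)"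
      using hypersurface[of l] Phi_biholomorphic[OF e[OF \<epsilon>] assms]
      by (intro exI[of _ "{(s, z). s \<noteq> 0 \<and> z \<in> poles l s}"] exI[of _ "Phi \<epsilon> l"]) simp
    fix s :: complex assume s: "s \<noteq> 0"
    show "complex_submanifold TYPE(complex \<times> complex) (surface_fiber l \<epsilon> s)" by (rule submanifold_surface_fiber[OF e[OF \<epsilon>] assms])
    show "rational_curve (surface_fiber l \<epsilon> s)" by (rule fiber_rational[OF e[OF \<epsilon>] assms s])
    show "has_degree (surface_fiber l \<epsilon> s) (2 * l + 1)" by (rule fiber_degree[OF s e[OF \<epsilon>] assms])
    show "\<exists>Q f g. finite Q \<and> card Q \<le> 2 * l + 1 \<and>
              biholomorphic_map sphere_charts c3_charts (- Q) (surface_fiber l \<epsilon> s) f \<and>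
              holomorphic_map sphere_charts cp3_charts UNIV g \<and>
              (\<forall>z. z \<notin> Q \<longrightarrow> g z = affine_part (f z)) \<and>
              range g = projective_closure (surface_fiber l \<epsilon> s)"
      using poles_finite[OF s] fiber_biholomorphic[OF e[OF \<epsilon>] assms s] proj_param_holomorphic[OF s e[OF \<epsilon>] assms]
        proj_param_affine projective_closure_fiber[OF s e[OF \<epsilon>] assms]
      by (intro exI[of _ "poles l s"] exI[of _ "\<lambda>z. param \<epsilon> l s (coords z)"] exI[of _ "proj_param \<epsilon> l s"]) auto
  qed
qed

end
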